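(* Let $k$ be a field, $R$ a standard graded $k$-algebra, and let $a,b\in R_1$ form an exact pair of zero divisors on $R$. Then for every finitely generated positively graded $R/aR$-module $M$, $$P^R_M(s,t)=P^{R/aR}_M(s,t)\cdot\frac{1}{1-st}.$$
   Context: A standard graded $k$-algebra is a commutative graded ring $R=\bigoplus_{n\ge0}R_n$ with $R_0=k$, finitely generated as a $k$-algebra by $R_1$. Elements $a,b\in R$ form an exact pair of zero divisors if $a,b$ are nonzero non-units with $(0:_R a)=bR$ and $(0:_R b)=aR$. For a finitely generated graded module $M$ over a standard graded $k$-algebra $S$, $\operatorname{Tor}^S_i(M,k)$ inherits a grading from a graded free resolution; set $\beta^S_{i,j}(M)=\operatorname{rank}_k\operatorname{Tor}^S_i(M,k)_j$ and define the graded Poincaré series $P^S_M(s,t)=\sum_{i,j}\beta^S_{i,j}(M)s^it^j\in\mathbb Z[s^{\pm1}][[t]]$. *)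

theory Defs
  imports Main
begin

definition is_sum_decomp :: "(nat \<Rightarrow> 'r::zero set) \<Rightarrow> (nat \<Rightarrow> 'r) \<Rightarrow> nat \<Rightarrow> bool" where
  "is_sum_decomp G f N \<longleftrightarrow> (\<forall>n. f n \<in> G n) \<and> (\<forall>n>N. f n = 0)"

definition standard_graded_algebra ::
  "('k::field \<Rightarrow> 'r::comm_ring_1) \<Rightarrow> (nat \<Rightarrow> 'r set) \<Rightarrow> bool" where
  "standard_graded_algebra emb Rg \<longleftrightarrow>
     \<comment> \<open>k-algebra structure\<close>
     inj emb \<and> emb 0 = 0 \<and> emb 1 = 1 \<and>
     (\<forall>x y. emb (x + y) = emb x + emb y) \<and> (\<forall>x y. emb (x * y) = emb x * emb y) \<and>
     \<comment> \<open>each R_n is a k-subspace\<close>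
     (\<forall>n. 0 \<in> Rg n \<and> (\<forall>x\<in>Rg n. \<forall>y\<in>Rg n. x + y \<in> Rg n) \<and>
          (\<forall>c. \<forall>x\<in>Rg n. emb c * x \<in> Rg n)) \<and>
     \<comment> \<open>multiplicativity of the grading\<close>
     (\<forall>m n. \<forall>x\<in>Rg m. \<forall>y\<in>Rg n. x * y \<in> Rg (m + n)) \<and>
     \<comment> \<open>R is the direct sum of the R_n\<close>
     (\<forall>x. \<exists>f N. is_sum_decomp Rg f N \<and> x = (\<Sum>n\<le>N. f n)) \<and>
     (\<forall>f N. is_sum_decomp Rg f N \<and> (\<Sum>n\<le>N. f n) = 0 \<longrightarrow> (\<forall>n. f n = 0)) \<and>
     \<comment> \<open>R_0 = k\<close>
     Rg 0 = range emb \<and>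
     \<comment> \<open>finitely generated as a k-algebra by R_1: R_1 is finite dimensional and
        R_(n+1) is spanned by products of elements of R_1 and R_n\<close>
     (\<exists>B. finite B \<and> B \<subseteq> Rg 1 \<and>
          (\<forall>x\<in>Rg 1. \<exists>c. x = (\<Sum>v\<in>B. emb (c v) * v))) \<and>
     (\<forall>n. \<forall>x\<in>Rg (Suc n). \<exists>(N::nat) u v. (\<forall>i<N. u i \<in> Rg 1 \<and> v i \<in> Rg n) \<and>
                                 x = (\<Sum>i<N. u i * v i))"

definition Rz :: "(nat \<Rightarrow> 'r::comm_ring_1 set) \<Rightarrow> int \<Rightarrow> 'r set" where
  "Rz Rg z = (if z < 0 then {0} else Rg (nat z))"

definition irrelevant_ideal :: "(nat \<Rightarrow> 'r::comm_ring_1 set) \<Rightarrow> 'r set" where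
  "irrelevant_ideal Rg = {x. \<exists>f N. is_sum_decomp Rg f N \<and> f 0 = 0 \<and> x = (\<Sum>n\<le>N. f n)}"

definition exact_zero_divisor_pair :: "'r::comm_ring_1 \<Rightarrow> 'r \<Rightarrow> bool" where
  "exact_zero_divisor_pair a b \<longleftrightarrow>
     a \<noteq> 0 \<and> b \<noteq> 0 \<and> \<not> (a dvd 1) \<and> \<not> (b dvd 1) \<and>
     {x. x * a = 0} = range (\<lambda>r. b * r) \<and> {x. x * b = 0} = range (\<lambda>r. a * r)"

definition graded_module ::
  "('k::field \<Rightarrow> 'r::comm_ring_1) \<Rightarrow> (nat \<Rightarrow> 'r set) \<Rightarrow>
   ('r \<Rightarrow> 'm::ab_group_add \<Rightarrow> 'm) \<Rightarrow> (int \<Rightarrow> 'm set) \<Rightarrow> bool" where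
  "graded_module emb Rg act Mg \<longleftrightarrow>
     (\<forall>r m n. act r (m + n) = act r m + act r n) \<and>
     (\<forall>r s m. act (r + s) m = act r m + act s m) \<and>
     (\<forall>r s m. act (r * s) m = act r (act s m)) \<and>
     (\<forall>m. act 1 m = m) \<and>
     (\<forall>j. 0 \<in> Mg j \<and> (\<forall>x\<in>Mg j. \<forall>y\<in>Mg j. x + y \<in> Mg j) \<and>
          (\<forall>c. \<forall>x\<in>Mg j. act (emb c) x \<in> Mg j)) \<and>
     (\<forall>n j. \<forall>r\<in>Rg n. \<forall>x\<in>Mg j. act r x \<in> Mg (int n + j)) \<and>
     (\<forall>x. \<exists>f (N::nat). (\<forall>j. f j \<in> Mg j) \<and> (\<forall>j. \<bar>j\<bar> > int N \<longrightarrow> f j = 0) \<and>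
          x = (\<Sum>j\<in>{-int N..int N}. f j)) \<and>
     (\<forall>f (N::nat). (\<forall>j. f j \<in> Mg j) \<and> (\<forall>j. \<bar>j\<bar> > int N \<longrightarrow> f j = 0) \<and>
          (\<Sum>j\<in>{-int N..int N}. f j) = 0 \<longrightarrow> (\<forall>j. f j = 0))"

definition finitely_generated_module :: "('r::comm_ring_1 \<Rightarrow> 'm::ab_group_add \<Rightarrow> 'm) \<Rightarrow> bool" where
  "finitely_generated_module act \<longleftrightarrow>
     (\<exists>N (g::nat \<Rightarrow> 'm). \<forall>m. \<exists>x. m = (\<Sum>c<N. act (x c) (g c)))"

definition positively_graded :: "(int \<Rightarrow> 'm::zero set) \<Rightarrow> bool" where
  "positively_graded Mg \<longleftrightarrow> (\<forall>j<0. Mg j = {0})"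

text \<open>We work over S = R/I for an ideal I of R (I = {0} gives S = R, I = aR gives R/aR).
  The i-th free module F_i is S^(n i) with basis element c in degree deg i c;
  its elements are represented by vectors x :: nat => 'r (entries mod I) supported below n i.
  The differential d_(i+1) : F_(i+1) -> F_i is given by the matrix d i (row, column),
  and the augmentation F_0 -> M sends basis element c to gen c.
  Minimality means all matrix entries lie in the homogeneous maximal ideal.\<close>

definition vsupp :: "nat \<Rightarrow> (nat \<Rightarrow> 'r::zero) \<Rightarrow> bool" where
  "vsupp N x \<longleftrightarrow> (\<forall>c\<ge>N. x c = 0)"

definition matapp :: "(nat \<Rightarrow> nat \<Rightarrow> 'r::comm_ring_1) \<Rightarrow> nat \<Rightarrow> (nat \<Rightarrow> 'r) \<Rightarrow> nat \<Rightarrow> 'r" where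
  "matapp A N y r = (\<Sum>c<N. A r c * y c)"

definition minimal_graded_free_resolution ::
  "(nat \<Rightarrow> 'r::comm_ring_1 set) \<Rightarrow> 'r set \<Rightarrow>
   ('r \<Rightarrow> 'm::ab_group_add \<Rightarrow> 'm) \<Rightarrow> (int \<Rightarrow> 'm set) \<Rightarrow>
   (nat \<Rightarrow> nat) \<Rightarrow> (nat \<Rightarrow> nat \<Rightarrow> int) \<Rightarrow> (nat \<Rightarrow> nat \<Rightarrow> nat \<Rightarrow> 'r) \<Rightarrow> (nat \<Rightarrow> 'm) \<Rightarrow> bool" where
  "minimal_graded_free_resolution Rg I act Mg n deg d gen \<longleftrightarrow>
     \<comment> \<open>the augmentation is graded and surjective\<close>
     (\<forall>c<n 0. gen c \<in> Mg (deg 0 c)) \<and>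
     (\<forall>m. \<exists>x. m = (\<Sum>c<n 0. act (x c) (gen c))) \<and>
     \<comment> \<open>the differentials are graded (homogeneous matrix entries) and minimal\<close>
     (\<forall>i r c. r < n i \<and> c < n (Suc i) \<longrightarrow>
        d i r c \<in> Rz Rg (deg (Suc i) c - deg i r) \<and> d i r c \<in> irrelevant_ideal Rg) \<and>
     \<comment> \<open>exactness at F_0: ker(F_0 -> M) = im d_1 (modulo I)\<close>
     (\<forall>x. vsupp (n 0) x \<longrightarrow>
        ((\<Sum>c<n 0. act (x c) (gen c)) = 0 \<longleftrightarrow>
         (\<exists>y. vsupp (n 1) y \<and> (\<forall>r<n 0. x r - matapp (d 0) (n 1) y r \<in> I)))) \<and>
     \<comment> \<open>exactness at F_(i+1): ker d_(i+1) = im d_(i+2) (modulo I)\<close>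
     (\<forall>i x. vsupp (n (Suc i)) x \<longrightarrow>
        ((\<forall>r<n i. matapp (d i) (n (Suc i)) x r \<in> I) \<longleftrightarrow>
         (\<exists>y. vsupp (n (Suc (Suc i))) y \<and>
              (\<forall>r<n (Suc i). x r - matapp (d (Suc i)) (n (Suc (Suc i))) y r \<in> I))))"

text \<open>beta^(R/I)_(i,j)(M): number of basis elements of degree j in F_i of a minimal graded
  free resolution of M over R/I (these numbers are the ranks of Tor_i(M,k)_j).\<close>
definition graded_betti ::
  "(nat \<Rightarrow> 'r::comm_ring_1 set) \<Rightarrow> 'r set \<Rightarrow>
   ('r \<Rightarrow> 'm::ab_group_add \<Rightarrow> 'm) \<Rightarrow> (int \<Rightarrow> 'm set) \<Rightarrow> nat \<Rightarrow> int \<Rightarrow> nat" where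
  "graded_betti Rg I act Mg =
     (SOME b. \<exists>n deg d gen. minimal_graded_free_resolution Rg I act Mg n deg d gen \<and>
        (\<forall>i j. b i j = card {c. c < n i \<and> deg i c = j}))"

text \<open>Graded Poincare series, as its coefficient function: coefficient of s^i t^j.\<close>
definition poincare_coeff ::
  "(nat \<Rightarrow> 'r::comm_ring_1 set) \<Rightarrow> 'r set \<Rightarrow>
   ('r \<Rightarrow> 'm::ab_group_add \<Rightarrow> 'm) \<Rightarrow> (int \<Rightarrow> 'm set) \<Rightarrow> nat \<Rightarrow> int \<Rightarrow> int" where
  "poincare_coeff Rg I act Mg i j = int (graded_betti Rg I act Mg i j)"

end

theory Submission
  imports Defs "HOL.Modules" "HOL-Library.Function_Algebras"
begin

text \<open>Let \<open>F\<close> be the minimal graded free resolution of \<open>M\<close> over \<open>R/aR\<close> (it exists because \<open>R\<close> is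
  Noetherian), with its matrices lifted to \<open>R\<close>.  Over \<open>R\<close>, the module \<open>R/aR\<close> has the periodic
  resolution with differentials \<open>a\<close>, \<open>b\<close>, \<open>a\<close>, \<open>b\<close>, ....  Placing a copy of it, shifted by the
  degrees of the basis elements, over each \<open>F q\<close> and correcting the lifted differential by
  higher terms, as in Wall's construction of the resolution of a group extension, yields a free
  resolution of \<open>M\<close> over \<open>R\<close> whose \<open>i\<close>-th module is the sum of the \<open>F (i - l)\<close> shifted by \<open>l\<close>.
  Each correction term is a quotient by \<open>a\<close> or \<open>b\<close> (degree 1) of sums of products of two entries
  of positive degree, so it again has positive degree and the resolution is minimal.  Since a
  minimal resolution determines the Betti numbers, counting basis elements gives the theorem.\<close>

section \<open>Noetherian modules\<close>

text \<open>The entries of \<open>d i\<close> are only representatives modulo \<open>a\<close>: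
  consecutive lifted matrices compose to multiples of \<open>a\<close>, not to zero, so the plain
  double complex is not a complex over \<open>R\<close>. The square-zero equation for an entry at
  level \<open>Suc l\<close> reads: \<open>zd (Suc l)\<close> times the unknown, plus terms of
  levels at most \<open>l\<close>. Each level is therefore one division, and signs are absorbed into
  the unknowns. The first division is possible because \<open>d\<close> is a complex modulo
  \<open>a\<close>; every later one because the dividend is annihilated by the other member of the
  pair, and exactness of the pair turns annihilation into divisibility. In low degrees, where a
  quotient could be a unit, the dividend is zero and the quotient is chosen to be 0. Exactness of
  the total complex comes from filtering by the position in \<open>F\<close>: the periodic complex
  has homology only at index 0, where it is \<open>R/aR\<close>, and there the exactness of
  \<open>F\<close> takes over. Since \<open>graded_betti\<close> selects an arbitrary minimal
  resolution, existence over \<open>R/aR\<close> and independence of the choice must both be proved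
  before ranks can be counted.\<close>

context module
begin

text \<open>A subring is represented by any set \<open>G\<close> of generators of it: being a submodule over the subring
  generated by \<open>G\<close> is closure under \<open>G\<close>.  Finite generation is expressed by minimality among the
  closed sets, which avoids linear combinations with coefficients in the subring.\<close>

definition closed_under :: "'a set \<Rightarrow> 'b set \<Rightarrow> bool" where
  "closed_under G W \<longleftrightarrow> 0 \<in> W \<and> (\<forall>x\<in>W. \<forall>y\<in>W. x - y \<in> W) \<and> (\<forall>g\<in>G. \<forall>x\<in>W. g *s x \<in> W)"

definition fin_gen :: "'a set \<Rightarrow> 'b set \<Rightarrow> bool" where
  "fin_gen G W \<longleftrightarrow> (\<exists>B. finite B \<and> B \<subseteq> W \<and> (\<forall>W'. closed_under G W' \<longrightarrow> B \<subseteq> W' \<longrightarrow> W \<subseteq> W'))"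

definition noeth :: "'a set \<Rightarrow> 'b set \<Rightarrow> bool" where
  "noeth G V \<longleftrightarrow> closed_under G V \<and> (\<forall>W. W \<subseteq> V \<longrightarrow> closed_under G W \<longrightarrow> fin_gen G W)"

lemma closed_under_diff: "closed_under G W \<Longrightarrow> x \<in> W \<Longrightarrow> y \<in> W \<Longrightarrow> x - y \<in> W"
  and closed_under_zero: "closed_under G W \<Longrightarrow> 0 \<in> W"
  and closed_under_scale: "closed_under G W \<Longrightarrow> g \<in> G \<Longrightarrow> x \<in> W \<Longrightarrow> g *s x \<in> W"
  by (auto simp: closed_under_def)

lemma closed_under_add:
  assumes "closed_under G W" "x \<in> W" "y \<in> W"
  shows "x + y \<in> W"
proof -
  have "0 - y \<in> W" using assms closed_under_diff closed_under_zero by blast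
  then have "x - (0 - y) \<in> W" using assms closed_under_diff by blast
  then show ?thesis by simp
qed

lemma closed_under_sum:
  "closed_under G W \<Longrightarrow> (\<And>i. i \<in> A \<Longrightarrow> f i \<in> W) \<Longrightarrow> sum f A \<in> W"
  by (induction A rule: infinite_finite_induct) (auto intro: closed_under_zero closed_under_add)

lemma closed_under_subset: "closed_under G W \<Longrightarrow> G' \<subseteq> G \<Longrightarrow> closed_under G' W"
  by (auto simp: closed_under_def)

text \<open>The values at \<open>x\<close> of polynomials of degree strictly below \<open>d\<close>
  with coefficients in \<open>V\<close>. The strict bound lets \<open>u + x ^ d *s v\<close> with
  \<open>u\<close> in this set stand for a polynomial of degree at most \<open>d\<close> with
  leading coefficient \<open>v\<close>.\<close>

fun low_terms :: "'a \<Rightarrow> 'b set \<Rightarrow> nat \<Rightarrow> 'b set" where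
  "low_terms x V 0 = {0}"
| "low_terms x V (Suc d) = {u + x ^ d *s v | u v. u \<in> low_terms x V d \<and> v \<in> V}"

lemma low_terms_closed:
  assumes V: "closed_under G V"
  shows "closed_under G (low_terms x V d)"
proof (induction d)
  case 0
  then show ?case by (auto simp: closed_under_def)
next
  case (Suc d)
  show ?case
    unfolding closed_under_def
  proof (intro conjI ballI)
    have "0 = 0 + x ^ d *s 0" by simp
    then show "0 \<in> low_terms x V (Suc d)"
      using closed_under_zero[OF Suc] closed_under_zero[OF V] unfolding low_terms.simps by blast
  next
    fix y z assume "y \<in> low_terms x V (Suc d)" "z \<in> low_terms x V (Suc d)"
    then obtain u v u' v' where *: "y = u + x ^ d *s v" "z = u' + x ^ d *s v'"
      "u \<in> low_terms x V d" "v \<in> V" "u' \<in> low_terms x V d" "v' \<in> V" by auto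
    have "y - z = (u - u') + x ^ d *s (v - v')"
      using * by (simp add: scale_right_diff_distrib)
    then show "y - z \<in> low_terms x V (Suc d)"
      using * closed_under_diff[OF Suc] closed_under_diff[OF V] unfolding low_terms.simps by blast
  next
    fix g y assume g: "g \<in> G" and "y \<in> low_terms x V (Suc d)"
    then obtain u v where *: "y = u + x ^ d *s v" "u \<in> low_terms x V d" "v \<in> V" by auto
    have "g *s y = g *s u + x ^ d *s (g *s v)"
      using * by (simp add: scale_right_distrib mult.commute)
    then show "g *s y \<in> low_terms x V (Suc d)"
      using * g closed_under_scale[OF Suc] closed_under_scale[OF V] unfolding low_terms.simps by blast
  qed
qed

lemma low_terms_mult:
  assumes V: "closed_under G V"
  shows "u \<in> low_terms x V d \<Longrightarrow> x *s u \<in> low_terms x V (Suc d)"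
proof (induction d arbitrary: u)
  case 0
  then show ?case using closed_under_zero[OF V] by force
next
  case (Suc d)
  then obtain u' v where *: "u = u' + x ^ d *s v" "u' \<in> low_terms x V d" "v \<in> V" by auto
  have "x *s u = x *s u' + x ^ Suc d *s v" using * by (simp add: scale_right_distrib)
  then show ?case using Suc.IH[OF *(2)] *(3) unfolding low_terms.simps(2)[of x V "Suc d"] by blast
qed

lemma low_terms_Suc:
  assumes "closed_under G V"
  shows "low_terms x V d \<subseteq> low_terms x V (Suc d)"
proof
  fix u assume "u \<in> low_terms x V d"
  moreover have "u = u + x ^ d *s 0" by simp
  ultimately show "u \<in> low_terms x V (Suc d)"
    using closed_under_zero[OF assms] unfolding low_terms.simps by blast
qed

lemma low_terms_mono:
  assumes "closed_under G V" "d \<le> e"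
  shows "low_terms x V d \<subseteq> low_terms x V e"
  using lift_Suc_mono_le[of "low_terms x V", OF low_terms_Suc[OF assms(1)] assms(2)] .

definition lead_coeffs :: "'a \<Rightarrow> 'b set \<Rightarrow> 'b set \<Rightarrow> nat \<Rightarrow> 'b set" where
  "lead_coeffs x V J d = {v \<in> V. \<exists>u \<in> low_terms x V d. u + x ^ d *s v \<in> J}"

lemma lead_coeffs_closed:
  assumes V: "closed_under G V" and J: "closed_under G J"
  shows "closed_under G (lead_coeffs x V J d)"
  unfolding closed_under_def
proof (intro conjI ballI)
  show "0 \<in> lead_coeffs x V J d"
    unfolding lead_coeffs_def
    using closed_under_zero[OF V] closed_under_zero[OF J] closed_under_zero[OF low_terms_closed[OF V]]
    by (auto intro!: bexI[of _ 0])
next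
  fix v w assume "v \<in> lead_coeffs x V J d" "w \<in> lead_coeffs x V J d"
  then obtain u u' where *: "v \<in> V" "w \<in> V" "u \<in> low_terms x V d" "u' \<in> low_terms x V d"
    "u + x ^ d *s v \<in> J" "u' + x ^ d *s w \<in> J" unfolding lead_coeffs_def by auto
  have "(u - u') + x ^ d *s (v - w) = (u + x ^ d *s v) - (u' + x ^ d *s w)"
    by (simp add: scale_right_diff_distrib)
  also have "\<dots> \<in> J" using * closed_under_diff[OF J] by blast
  finally show "v - w \<in> lead_coeffs x V J d"
    unfolding lead_coeffs_def
    using * closed_under_diff[OF V] closed_under_diff[OF low_terms_closed[OF V]] by blast
next
  fix g v assume g: "g \<in> G" and "v \<in> lead_coeffs x V J d"
  then obtain u where *: "v \<in> V" "u \<in> low_terms x V d" "u + x ^ d *s v \<in> J"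
    unfolding lead_coeffs_def by auto
  have "g *s u + x ^ d *s (g *s v) = g *s (u + x ^ d *s v)"
    by (simp add: scale_right_distrib mult.commute)
  also have "\<dots> \<in> J" using * g closed_under_scale[OF J] by blast
  finally show "g *s v \<in> lead_coeffs x V J d"
    unfolding lead_coeffs_def
    using * g closed_under_scale[OF V] closed_under_scale[OF low_terms_closed[OF V]] by blast
qed

lemma lead_coeffs_mono:
  assumes V: "closed_under G V" and J: "closed_under {x} J" and "d \<le> e"
  shows "lead_coeffs x V J d \<subseteq> lead_coeffs x V J e"
  using _ assms(3)
proof (rule lift_Suc_mono_le)
  fix d
  show "lead_coeffs x V J d \<subseteq> lead_coeffs x V J (Suc d)"
  proof
    fix v assume "v \<in> lead_coeffs x V J d"
    then obtain u where *: "v \<in> V" "u \<in> low_terms x V d" "u + x ^ d *s v \<in> J"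
      unfolding lead_coeffs_def by auto
    have "x *s u + x ^ Suc d *s v = x *s (u + x ^ d *s v)" by (simp add: scale_right_distrib)
    also have "\<dots> \<in> J" using * closed_under_scale[OF J] by blast
    finally show "v \<in> lead_coeffs x V J (Suc d)"
      unfolding lead_coeffs_def using * low_terms_mult[OF V] by blast
  qed
qed

text \<open>A finite generating set of the union already lies in one member of the chain, and that
  member is then the whole union.\<close>

lemma fin_gen_chain_stable:
  fixes L :: "nat \<Rightarrow> 'b set"
  assumes "fin_gen G (\<Union>d. L d)" and "\<And>d. closed_under G (L d)" and mono: "\<And>d e. d \<le> e \<Longrightarrow> L d \<subseteq> L e"
  obtains D where "\<And>d. L d \<subseteq> L D"
proof -
  obtain B where B: "finite B" "B \<subseteq> (\<Union>d. L d)"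
    and hull: "\<And>W'. closed_under G W' \<Longrightarrow> B \<subseteq> W' \<Longrightarrow> (\<Union>d. L d) \<subseteq> W'"
    using assms(1) unfolding fin_gen_def by blast
  have "\<exists>D. B \<subseteq> L D"
    using B
  proof (induction B)
    case (insert b B)
    then obtain D d where "B \<subseteq> L D" "b \<in> L d" by auto
    then have "insert b B \<subseteq> L (max D d)"
      using mono[of D "max D d"] mono[of d "max D d"] by auto
    then show ?case by blast
  qed simp
  then obtain D where "B \<subseteq> L D" by blast
  from hull[OF assms(2) this] show ?thesis by (intro that[of D]) blast
qed

text \<open>Hilbert's argument does not need \<open>x\<close> to be a variable: \<open>lead_coeffs\<close> uses all expressions of
  elements as polynomials in \<open>x\<close> with coefficients in \<open>V\<close>.\<close>

theorem hilbert_basis_step: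
  assumes N: "noeth G V"
  obtains V' where "V \<subseteq> V'" "noeth (insert x G) V'"
proof -
  define V' where "V' = (\<Union>d. low_terms x V d)"
  have V: "closed_under G V" using N unfolding noeth_def by blast
  have "V \<subseteq> V'"
  proof
    fix v assume "v \<in> V"
    then have "v \<in> low_terms x V 1" by simp
    then show "v \<in> V'" unfolding V'_def by blast
  qed
  moreover have "noeth (insert x G) V'"
    unfolding noeth_def
  proof (intro conjI allI impI)
    show "closed_under (insert x G) V'"
      unfolding closed_under_def
    proof (intro conjI ballI)
      show "0 \<in> V'" unfolding V'_def using low_terms.simps(1) by blast
    next
      fix y z assume "y \<in> V'" "z \<in> V'"
      then obtain d e where "y \<in> low_terms x V d" "z \<in> low_terms x V e" unfolding V'_def by blast
      then have "y \<in> low_terms x V (max d e)" "z \<in> low_terms x V (max d e)"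
        using low_terms_mono[OF V, of d "max d e" x] low_terms_mono[OF V, of e "max d e" x] by auto
      then show "y - z \<in> V'" using closed_under_diff[OF low_terms_closed[OF V]] unfolding V'_def by blast
    next
      fix g y assume g: "g \<in> insert x G" and "y \<in> V'"
      then obtain d where d: "y \<in> low_terms x V d" unfolding V'_def by blast
      have "g *s y \<in> low_terms x V d \<or> g *s y \<in> low_terms x V (Suc d)"
        using g low_terms_mult[OF V d] closed_under_scale[OF low_terms_closed[OF V] _ d] by blast
      then show "g *s y \<in> V'" unfolding V'_def by blast
    qed
  next
    fix J assume JV: "J \<subseteq> V'" and J: "closed_under (insert x G) J"
    have JG: "closed_under G J" and Jx: "closed_under {x} J"
      using J closed_under_subset by blast+
    define L where "L = lead_coeffs x V J"
    have Lc: "closed_under G (L d)" for d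
      unfolding L_def using lead_coeffs_closed[OF V JG] .
    have Lmono: "d \<le> e \<Longrightarrow> L d \<subseteq> L e" for d e
      unfolding L_def using lead_coeffs_mono[OF V Jx] by blast
    have LV: "L d \<subseteq> V" for d unfolding L_def lead_coeffs_def by blast
    have "closed_under G (\<Union>d. L d)"
      unfolding closed_under_def
    proof (intro conjI ballI)
      show "0 \<in> (\<Union>d. L d)" using closed_under_zero[OF Lc] by blast
    next
      fix y z assume "y \<in> (\<Union>d. L d)" "z \<in> (\<Union>d. L d)"
      then obtain d e where "y \<in> L d" "z \<in> L e" by blast
      then have "y \<in> L (max d e)" "z \<in> L (max d e)"
        using Lmono[of d "max d e"] Lmono[of e "max d e"] by auto
      then show "y - z \<in> (\<Union>d. L d)" using closed_under_diff[OF Lc] by blast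
    next
      fix g y assume "g \<in> G" "y \<in> (\<Union>d. L d)"
      then show "g *s y \<in> (\<Union>d. L d)" using closed_under_scale[OF Lc] by blast
    qed
    moreover have "(\<Union>d. L d) \<subseteq> V" using LV by blast
    ultimately have "fin_gen G (\<Union>d. L d)" using N unfolding noeth_def by blast
    then obtain D where D: "\<And>d. L d \<subseteq> L D"
      by (rule fin_gen_chain_stable[of G L]) (use Lc Lmono in auto)
    have "\<forall>d. fin_gen G (L d)" using N LV Lc unfolding noeth_def by blast
    then obtain B where B: "\<And>d. finite (B d)" "\<And>d. B d \<subseteq> L d"
      and hull: "\<And>d W'. closed_under G W' \<Longrightarrow> B d \<subseteq> W' \<Longrightarrow> L d \<subseteq> W'"
      unfolding fin_gen_def by metis
    have "\<forall>d. \<forall>v\<in>B d. \<exists>u. u \<in> low_terms x V d \<and> u + x ^ d *s v \<in> J"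
      using B(2) unfolding L_def lead_coeffs_def by blast
    then obtain u where u: "\<And>d v. v \<in> B d \<Longrightarrow> u d v \<in> low_terms x V d"
      "\<And>d v. v \<in> B d \<Longrightarrow> u d v + x ^ d *s v \<in> J" by metis
    \<comment> \<open>Degrees up to \<open>D\<close> suffice: a leading coefficient occurring in a
      higher degree already occurs in degree \<open>D\<close>, and a power of \<open>x\<close> lifts
      it back.\<close>
    define Gens where "Gens = (\<Union>d\<le>D. (\<lambda>v. u d v + x ^ d *s v) ` B d)"
    have "finite Gens" unfolding Gens_def using B(1) by blast
    moreover have "Gens \<subseteq> J" unfolding Gens_def using u(2) by blast
    moreover have "J \<subseteq> W'" if W': "closed_under (insert x G) W'" "Gens \<subseteq> W'" for W'
    proof -
      \<comment> \<open>Working in \<open>W' \<inter> J\<close> instead of \<open>W'\<close> makes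
        the element subtracted below lie in \<open>J\<close> as well, so the difference stays in
        \<open>J\<close> and the induction hypothesis applies to it.\<close>
      have WJ: "closed_under (insert x G) (W' \<inter> J)"
        using W' J unfolding closed_under_def by blast
      have WJG: "closed_under G (W' \<inter> J)" and WJx: "closed_under {x} (W' \<inter> J)"
        using WJ closed_under_subset by blast+
      have "J \<inter> low_terms x V d \<subseteq> W'" for d
      proof (induction d)
        case 0
        then show ?case using closed_under_zero[OF W'(1)] by auto
      next
        case (Suc d)
        show ?case
        proof
          fix f assume "f \<in> J \<inter> low_terms x V (Suc d)"
          then obtain t v where f: "f \<in> J" "f = t + x ^ d *s v" "t \<in> low_terms x V d" "v \<in> V"
            by auto
          \<comment> \<open>The degree in which the generators are looked up;
            \<open>lead_coeffs_mono\<close> then carries the result from \<open>e\<close> back to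
            \<open>d\<close>.\<close>
          define e where "e = min d D"
          have "v \<in> L d" using f unfolding L_def lead_coeffs_def by blast
          then have "v \<in> L e" using D unfolding e_def min_def by auto
          moreover have "B e \<subseteq> lead_coeffs x V (W' \<inter> J) e"
          proof
            fix b assume b: "b \<in> B e"
            have "e \<le> D" unfolding e_def by simp
            then have "u e b + x ^ e *s b \<in> Gens" unfolding Gens_def using b by blast
            then show "b \<in> lead_coeffs x V (W' \<inter> J) e"
              unfolding lead_coeffs_def using u b B(2)[of e] LV[of e] W'(2) by blast
          qed
          ultimately have "v \<in> lead_coeffs x V (W' \<inter> J) e"
            using hull lead_coeffs_closed[OF V WJG] by blast
          then have "v \<in> lead_coeffs x V (W' \<inter> J) d"
            using lead_coeffs_mono[OF V WJx, of e d] unfolding e_def by auto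
          then obtain s where s: "s \<in> low_terms x V d" "s + x ^ d *s v \<in> W' \<inter> J"
            unfolding lead_coeffs_def by blast
          have eq: "f - (s + x ^ d *s v) = t - s" using f by simp
          have "f - (s + x ^ d *s v) \<in> J" using f s closed_under_diff[OF J] by blast
          moreover have "t - s \<in> low_terms x V d"
            using f s closed_under_diff[OF low_terms_closed[OF V]] by blast
          ultimately have "f - (s + x ^ d *s v) \<in> J \<inter> low_terms x V d" by (simp only: eq Int_iff)
          then have "f - (s + x ^ d *s v) \<in> W'" using Suc by blast
          then have "f - (s + x ^ d *s v) + (s + x ^ d *s v) \<in> W'"
            using s closed_under_add[OF W'(1)] by blast
          then show "f \<in> W'" by simp
        qed
      qed
      then show ?thesis using JV unfolding V'_def by blast
    qed
    ultimately show "fin_gen (insert x G) J" unfolding fin_gen_def by blast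
  qed
  ultimately show ?thesis using that by blast
qed

lemma noeth_adjoin_finite:
  assumes "finite X" "noeth G V"
  obtains V' where "V \<subseteq> V'" "noeth (X \<union> G) V'"
  using assms
proof (induction X arbitrary: thesis)
  case empty
  then show ?case by auto
next
  case (insert x X)
  then obtain V' where V': "V \<subseteq> V'" "noeth (X \<union> G) V'" by blast
  obtain V'' where "V' \<subseteq> V''" "noeth (insert x (X \<union> G)) V''"
    using hilbert_basis_step[OF V'(2)] by blast
  then show ?case using insert.prems(1)[of V''] V' by auto
qed

text \<open>The dimension argument for one more vector: a subspace \<open>W\<close> not contained in
  \<open>V\<close> is generated by \<open>W \<inter> V\<close> and a single \<open>w\<close> outside
  \<open>V\<close>, because the scalars form a field and every element of \<open>W\<close> can be
  moved into \<open>V\<close> by a multiple of \<open>w\<close>.\<close>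

lemma noeth_add_vector:
  fixes emb :: "'k::field \<Rightarrow> 'a"
  assumes emb: "emb 1 = 1" "\<And>x y. emb (x - y) = emb x - emb y" "\<And>x y. emb (x * y) = emb x * emb y"
    and N: "noeth (range emb) V"
  obtains V' where "V \<subseteq> V'" "v \<in> V'" "noeth (range emb) V'"
proof -
  define V' where "V' = {u + emb c *s v | u c. u \<in> V}"
  have V: "closed_under (range emb) V" using N unfolding noeth_def by blast
  have emb0: "emb 0 = 0" using emb(2)[of 0 0] by simp
  have "V \<subseteq> V'"
  proof
    fix u assume "u \<in> V"
    moreover have "u = u + emb 0 *s v" using emb0 by simp
    ultimately show "u \<in> V'" unfolding V'_def by blast
  qed
  moreover have "v \<in> V'"
  proof -
    have "v = 0 + emb 1 *s v" using emb by simp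
    then show ?thesis unfolding V'_def using closed_under_zero[OF V] by blast
  qed
  moreover have "noeth (range emb) V'"
    unfolding noeth_def
  proof (intro conjI allI impI)
    show "closed_under (range emb) V'"
      unfolding closed_under_def
    proof (intro conjI ballI)
      show "0 \<in> V'" using \<open>V \<subseteq> V'\<close> closed_under_zero[OF V] by blast
    next
      fix y z assume "y \<in> V'" "z \<in> V'"
      then obtain u c u' c' where *: "u \<in> V" "u' \<in> V" "y = u + emb c *s v" "z = u' + emb c' *s v"
        unfolding V'_def by blast
      then have "y - z = (u - u') + emb (c - c') *s v"
        by (simp add: emb scale_left_diff_distrib)
      then show "y - z \<in> V'" unfolding V'_def using * closed_under_diff[OF V] by blast
    next
      fix g y assume "g \<in> range emb" "y \<in> V'"
      then obtain e u c where *: "u \<in> V" "g = emb e" "y = u + emb c *s v"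
        unfolding V'_def by blast
      then have "g *s y = emb e *s u + emb (e * c) *s v"
        by (simp add: emb scale_right_distrib)
      then show "g *s y \<in> V'" unfolding V'_def using * closed_under_scale[OF V] by blast
    qed
  next
    fix W assume WV: "W \<subseteq> V'" and W: "closed_under (range emb) W"
    have "closed_under (range emb) (W \<inter> V)" using W V unfolding closed_under_def by blast
    then have "fin_gen (range emb) (W \<inter> V)" using N unfolding noeth_def by blast
    then obtain B where B: "finite B" "B \<subseteq> W \<inter> V"
      and hull: "\<And>W'. closed_under (range emb) W' \<Longrightarrow> B \<subseteq> W' \<Longrightarrow> W \<inter> V \<subseteq> W'"
      unfolding fin_gen_def by blast
    show "fin_gen (range emb) W"
    proof (cases "W \<subseteq> V")
      case True
      then have "W \<inter> V = W" by blast
      then show ?thesis using \<open>fin_gen (range emb) (W \<inter> V)\<close> by simp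
    next
      case False
      then obtain w where w: "w \<in> W" "w \<notin> V" by blast
      then obtain u c where uc: "u \<in> V" "w = u + emb c *s v" using WV unfolding V'_def by blast
      have "c \<noteq> 0" using uc w emb0 by auto
      have "W \<subseteq> W'" if W': "closed_under (range emb) W'" "insert w B \<subseteq> W'" for W'
      proof
        fix y assume y: "y \<in> W"
        then obtain u' c' where *: "u' \<in> V" "y = u' + emb c' *s v" using WV unfolding V'_def by blast
        \<comment> \<open>The factor for which \<open>t *s w\<close> has the same multiple of
          \<open>v\<close> as \<open>y\<close>, so that the difference falls into
          \<open>V\<close>.\<close>
        define t where "t = emb (c' / c)"
        have "t * emb c = emb c'" unfolding t_def emb(3)[symmetric] using \<open>c \<noteq> 0\<close> by simp
        then have "y - t *s w = u' - t *s u"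
          using * uc by (simp add: scale_right_distrib)
        moreover have "u' - t *s u \<in> V"
          unfolding t_def using * uc closed_under_diff[OF V] closed_under_scale[OF V] by blast
        moreover have "y - t *s w \<in> W"
          unfolding t_def using y w closed_under_diff[OF W] closed_under_scale[OF W] by blast
        ultimately have "y - t *s w \<in> W'" using hull[of W'] W' by auto
        moreover have "t *s w \<in> W'" unfolding t_def using W' closed_under_scale[OF W'(1)] by blast
        ultimately have "(y - t *s w) + t *s w \<in> W'" using closed_under_add[OF W'(1)] by blast
        then show "y \<in> W'" by simp
      qed
      then show ?thesis unfolding fin_gen_def using B w by (intro exI[of _ "insert w B"]) auto
    qed
  qed
  ultimately show ?thesis using that by blast
qed

text \<open>The start of the Hilbert induction: before any algebra generator is adjoined, only
  scalars act, and a finite set of vectors is reached one vector at a time.\<close>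

lemma noeth_fin_dim:
  fixes emb :: "'k::field \<Rightarrow> 'a"
  assumes emb: "emb 1 = 1" "\<And>x y. emb (x - y) = emb x - emb y" "\<And>x y. emb (x * y) = emb x * emb y"
    and "finite B"
  obtains V where "B \<subseteq> V" "noeth (range emb) V"
  using assms(4)
proof (induction B arbitrary: thesis)
  case empty
  have "noeth (range emb) {0}"
    unfolding noeth_def fin_gen_def
  proof (intro conjI allI impI)
    show "closed_under (range emb) {0}" by (auto simp: closed_under_def)
  next
    fix W assume "W \<subseteq> {0}" "closed_under (range emb) W"
    then show "\<exists>B. finite B \<and> B \<subseteq> W \<and> (\<forall>W'. closed_under (range emb) W' \<longrightarrow> B \<subseteq> W' \<longrightarrow> W \<subseteq> W')"
      by (intro exI[of _ W]) (auto intro: finite_subset)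
  qed
  then show ?case using empty by blast
next
  case (insert v B)
  then obtain V where V: "B \<subseteq> V" "noeth (range emb) V" by blast
  then obtain V' where "V \<subseteq> V'" "v \<in> V'" "noeth (range emb) V'"
    using noeth_add_vector[OF emb V(2)] by blast
  then show ?case using insert.prems V by blast
qed

end

section \<open>Finite generation of submodules over a standard graded algebra\<close>

lemma
  assumes "standard_graded_algebra emb Rg"
  shows sga_inj: "inj emb"
    and sga_one: "emb 1 = 1"
    and sga_add: "emb (x + y) = emb x + emb y"
    and sga_mult: "emb (x * y) = emb x * emb y"
    and sga_zero_mem: "0 \<in> Rg n"
    and sga_add_mem: "\<lbrakk>r \<in> Rg n; s \<in> Rg n\<rbrakk> \<Longrightarrow> r + s \<in> Rg n"
    and sga_scale_mem: "r \<in> Rg n \<Longrightarrow> emb x * r \<in> Rg n"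
    and sga_mult_mem: "\<lbrakk>r \<in> Rg m; s \<in> Rg n\<rbrakk> \<Longrightarrow> r * s \<in> Rg (m + n)"
    and sga_decomp: "\<exists>f N. is_sum_decomp Rg f N \<and> r = (\<Sum>n\<le>N. f n)"
    and sga_unique: "\<lbrakk>is_sum_decomp Rg f N; (\<Sum>n\<le>N. f n) = 0\<rbrakk> \<Longrightarrow> f k = 0"
    and sga_degree_0: "Rg 0 = range emb"
    and sga_degree_1: "\<exists>B. finite B \<and> B \<subseteq> Rg 1 \<and> (\<forall>x\<in>Rg 1. \<exists>c. x = (\<Sum>v\<in>B. emb (c v) * v))"
    and sga_degree_Suc: "r \<in> Rg (Suc n) \<Longrightarrow>
      \<exists>(N::nat) u v. (\<forall>i<N. u i \<in> Rg 1 \<and> v i \<in> Rg n) \<and> r = (\<Sum>i<N. u i * v i)"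
  using assms unfolding standard_graded_algebra_def by (simp_all, blast)

lemma sga_diff:
  assumes "standard_graded_algebra emb Rg"
  shows "emb (x - y) = emb x - emb y"
  using sga_add[OF assms, of "x - y" y] by simp

text \<open>This is where generation in degree 1 is used: \<open>R\<close> is generated by the
  scalars and \<open>B\<close>, so closure under these propagates to each \<open>Rg n\<close> by
  induction on \<open>n\<close> and then to all of \<open>R\<close> by decomposition.\<close>

lemma sga_closed_subspace:
  fixes emb :: "'k::field \<Rightarrow> 'r::comm_ring_1" and act :: "'r \<Rightarrow> 'm::ab_group_add \<Rightarrow> 'm"
  assumes R: "standard_graded_algebra emb Rg" and "module act"
    and B: "\<And>x. x \<in> Rg 1 \<Longrightarrow> \<exists>c. x = (\<Sum>v\<in>B. emb (c v) * v)"
    and V: "module.closed_under act (B \<union> range emb) V"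
  shows "module.subspace act V"
proof -
  interpret module act by fact
  have homog: "\<forall>r\<in>Rg n. \<forall>x\<in>V. act r x \<in> V" for n
  proof (induction n)
    case 0
    show ?case using closed_under_scale[OF V] sga_degree_0[OF R] by auto
  next
    case (Suc n)
    have one: "act u x \<in> V" if u: "u \<in> Rg 1" and x: "x \<in> V" for u x
    proof -
      obtain c where "u = (\<Sum>v\<in>B. emb (c v) * v)" using B[OF u] by blast
      then have "act u x = (\<Sum>v\<in>B. act (emb (c v)) (act v x))"
        by (simp add: scale_sum_left)
      also have "\<dots> \<in> V"
        by (intro closed_under_sum[OF V] closed_under_scale[OF V]) (auto simp: x)
      finally show ?thesis .
    qed
    show ?case
    proof (intro ballI)
      fix r x assume "r \<in> Rg (Suc n)" and x: "x \<in> V"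
      then obtain N :: nat and u v where "\<forall>i<N. u i \<in> Rg 1 \<and> v i \<in> Rg n" and r: "r = (\<Sum>i<N. u i * v i)"
        using sga_degree_Suc[OF R] by blast
      then have "act (u i) (act (v i) x) \<in> V" if "i < N" for i
        using Suc one x that by blast
      moreover have "act r x = (\<Sum>i<N. act (u i) (act (v i) x))"
        by (simp add: r scale_sum_left)
      ultimately show "act r x \<in> V" by (simp only:) (rule closed_under_sum[OF V], simp)
    qed
  qed
  show ?thesis
  proof (rule subspaceI)
    show "0 \<in> V" using closed_under_zero[OF V] .
    show "x + y \<in> V" if "x \<in> V" "y \<in> V" for x y using closed_under_add[OF V] that .
    show "act r x \<in> V" if x: "x \<in> V" for r x
    proof -
      obtain f N where f: "is_sum_decomp Rg f N" "r = (\<Sum>n\<le>N. f n)"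
        using sga_decomp[OF R] by blast
      then have "act r x = (\<Sum>n\<le>N. act (f n) x)" by (simp add: scale_sum_left)
      moreover have "act (f n) x \<in> V" for n using f homog x unfolding is_sum_decomp_def by blast
      ultimately show ?thesis by (simp only:) (rule closed_under_sum[OF V], simp)
    qed
  qed
qed

text \<open>Start from a finite-dimensional set containing \<open>E\<close> and adjoin the algebra
  generators. The resulting Noetherian set is closed under \<open>R\<close>, hence contains
  \<open>span E\<close> and with it \<open>Z\<close>. Bounding \<open>Z\<close> by \<open>E\<close>
  allows an ambient type that is not finitely generated itself, such as the functions
  \<open>nat \<Rightarrow> 'r\<close> that represent vectors.\<close>

theorem submodule_finitely_generated:
  fixes emb :: "'k::field \<Rightarrow> 'r::comm_ring_1" and act :: "'r \<Rightarrow> 'm::ab_group_add \<Rightarrow> 'm"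
  assumes R: "standard_graded_algebra emb Rg" and act: "module act"
    and E: "finite E" "Z \<subseteq> module.span act E" and Z: "module.subspace act Z"
  obtains B where "finite B" "B \<subseteq> Z" "Z = module.span act B"
proof -
  interpret module act by fact
  obtain X where X: "finite X" "\<And>x. x \<in> Rg 1 \<Longrightarrow> \<exists>c. x = (\<Sum>v\<in>X. emb (c v) * v)"
    using sga_degree_1[OF R] by blast
  obtain V0 where V0: "E \<subseteq> V0" "noeth (range emb) V0"
    using noeth_fin_dim[OF sga_one[OF R] sga_diff[OF R] sga_mult[OF R] E(1)] by blast
  obtain V where V: "V0 \<subseteq> V" "noeth (X \<union> range emb) V"
    using noeth_adjoin_finite[OF X(1) V0(2)] by blast
  have "subspace V" using sga_closed_subspace[OF R act X(2)] V(2) unfolding noeth_def by blast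
  then have "span E \<subseteq> V" using V0 V by (intro span_minimal) auto
  moreover have "closed_under (X \<union> range emb) Z"
    using Z subspace_diff[OF Z] subspace_0[OF Z] subspace_scale[OF Z] unfolding closed_under_def by blast
  ultimately have "fin_gen (X \<union> range emb) Z" using V(2) E(2) unfolding noeth_def by blast
  then obtain B where B: "finite B" "B \<subseteq> Z"
    and hull: "\<And>W'. closed_under (X \<union> range emb) W' \<Longrightarrow> B \<subseteq> W' \<Longrightarrow> Z \<subseteq> W'"
    unfolding fin_gen_def by blast
  have "closed_under (X \<union> range emb) (span B)"
    unfolding closed_under_def by (auto intro: span_zero span_diff span_scale)
  then have "Z \<subseteq> span B" using hull span_superset by blast
  moreover have "span B \<subseteq> Z" using span_minimal[OF B(2) Z] .
  ultimately show ?thesis using B that by blast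
qed

section \<open>Homogeneous components\<close>

text \<open>The choice is made once for the whole family of components; over a graded module the
  family is unique, so any decomposition computes it (\<open>gcomp_eqI\<close>).\<close>

definition gcomp :: "(int \<Rightarrow> 'm::comm_monoid_add set) \<Rightarrow> int \<Rightarrow> 'm \<Rightarrow> 'm" where
  "gcomp Mg j x = (SOME f. (\<forall>j. f j \<in> Mg j) \<and> finite {j. f j \<noteq> 0} \<and> x = sum f {j. f j \<noteq> 0}) j"

text \<open>A grading given by its projections, so that one set of lemmas serves the ring, the
  module \<open>M\<close> and the free modules with shifted basis degrees. The carrier
  \<open>C\<close> is there for the free modules, whose elements are only the supported
  functions.\<close>

locale graded_on = module act
  for act :: "'r::comm_ring_1 \<Rightarrow> 'm::ab_group_add \<Rightarrow> 'm" +
  fixes Rh :: "int \<Rightarrow> 'r set" and C :: "'m set" and \<pi> :: "int \<Rightarrow> 'm \<Rightarrow> 'm"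
  assumes subspace_C: "subspace C"
    and proj_add: "\<lbrakk>x \<in> C; y \<in> C\<rbrakk> \<Longrightarrow> \<pi> j (x + y) = \<pi> j x + \<pi> j y"
    and proj_proj: "x \<in> C \<Longrightarrow> \<pi> j (\<pi> k x) = (if j = k then \<pi> k x else 0)"
    and proj_finite: "x \<in> C \<Longrightarrow> finite {j. \<pi> j x \<noteq> 0}"
    and proj_decomp: "x \<in> C \<Longrightarrow> x = (\<Sum>j | \<pi> j x \<noteq> 0. \<pi> j x)"
    and proj_act: "\<lbrakk>x \<in> C; r \<in> Rh e\<rbrakk> \<Longrightarrow> \<pi> j (act r x) = act r (\<pi> (j - e) x)"
begin

lemma proj_zero [simp]: "\<pi> j 0 = 0"
proof -
  have "\<pi> j (0 + 0) = \<pi> j 0 + \<pi> j 0" using proj_add subspace_0[OF subspace_C] by blast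
  then show ?thesis by simp
qed

lemma proj_sum: "(\<And>i. i \<in> A \<Longrightarrow> f i \<in> C) \<Longrightarrow> \<pi> j (sum f A) = (\<Sum>i\<in>A. \<pi> j (f i))"
proof (induction A rule: infinite_finite_induct)
  case (insert x F)
  then show ?case using subspace_sum[OF subspace_C, of F f] by (simp add: proj_add)
qed simp_all

end

lemma
  assumes "graded_module emb Rg act Mg"
  shows gm_module: "module act"
    and gm_zero_mem: "0 \<in> Mg j"
    and gm_add_mem: "\<lbrakk>x \<in> Mg j; y \<in> Mg j\<rbrakk> \<Longrightarrow> x + y \<in> Mg j"
    and gm_emb_mem: "x \<in> Mg j \<Longrightarrow> act (emb c) x \<in> Mg j"
    and gm_act_mem: "\<lbrakk>r \<in> Rg n; x \<in> Mg j\<rbrakk> \<Longrightarrow> act r x \<in> Mg (int n + j)"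
    and gm_decomp: "\<exists>f (N::nat). (\<forall>j. f j \<in> Mg j) \<and> (\<forall>j. \<bar>j\<bar> > int N \<longrightarrow> f j = 0) \<and>
          x = (\<Sum>j\<in>{-int N..int N}. f j)"
    and gm_unique0: "\<lbrakk>\<And>j. f j \<in> Mg j; \<And>j. \<bar>j\<bar> > int N \<Longrightarrow> f j = 0; (\<Sum>j\<in>{-int N..int N}. f j) = 0\<rbrakk> \<Longrightarrow> f k = 0"
  using assms unfolding graded_module_def module_def by (simp_all, blast)

lemma gm_unique:
  assumes M: "graded_module emb Rg act Mg"
    and f: "\<And>j. f j \<in> Mg j" "finite S" "\<And>j. j \<notin> S \<Longrightarrow> f j = 0" "sum f S = 0"
  shows "f k = 0"
proof -
  define N where "N = nat (Max (insert 0 (abs ` S)))"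
  have N: "\<bar>j\<bar> \<le> int N" if "j \<in> S" for j
  proof -
    have "\<bar>j\<bar> \<le> Max (insert 0 (abs ` S))" using that f(2) by (intro Max_ge) auto
    then show ?thesis unfolding N_def by linarith
  qed
  have "f j = 0" if "\<bar>j\<bar> > int N" for j using N f(3) that by fastforce
  moreover have "S \<subseteq> {-int N..int N}" using N by fastforce
  then have "(\<Sum>j\<in>{-int N..int N}. f j) = sum f S"
    using f by (intro sum.mono_neutral_right) auto
  ultimately show ?thesis using gm_unique0[OF M, of f N k] f by simp
qed

lemma gm_diff_mem:
  assumes R: "standard_graded_algebra emb Rg" and M: "graded_module emb Rg act Mg"
    and "x \<in> Mg j" "y \<in> Mg j"
  shows "x - y \<in> Mg j"
proof -
  interpret module act using gm_module[OF M] .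
  have "act (emb (0 - 1)) y = - y"
    using sga_diff[OF R, of 0 1] sga_diff[OF R, of 0 0] sga_one[OF R] by simp
  then have "- y \<in> Mg j" using gm_emb_mem[OF M assms(4), of "0 - 1"] by simp
  then show ?thesis using gm_add_mem[OF M assms(3)] by fastforce
qed

lemma gcomp_eqI:
  assumes R: "standard_graded_algebra emb Rg" and M: "graded_module emb Rg act Mg"
    and f: "\<And>j. f j \<in> Mg j" "finite S" "\<And>j. j \<notin> S \<Longrightarrow> f j = 0" and x: "x = sum f S"
  shows "gcomp Mg k x = f k"
proof -
  define P where "P f \<longleftrightarrow> (\<forall>j. f j \<in> Mg j) \<and> finite {j. f j \<noteq> 0} \<and> x = sum f {j. f j \<noteq> 0}" for f
  have "{j. f j \<noteq> 0} \<subseteq> S" using f by blast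
  then have "P f" unfolding P_def x using f
    by (auto intro: finite_subset intro!: sum.mono_neutral_right)
  define h where "h = (SOME f. P f)"
  have h: "P h" unfolding h_def using someI[of P f] \<open>P f\<close> by blast
  let ?T = "{j. f j \<noteq> 0} \<union> {j. h j \<noteq> 0}"
  have fin: "finite ?T" using h \<open>P f\<close> unfolding P_def by blast
  have "sum f {j. f j \<noteq> 0} = sum f ?T" "sum h {j. h j \<noteq> 0} = sum h ?T"
    using fin by (auto intro!: sum.mono_neutral_left)
  then have "(\<Sum>j\<in>?T. f j - h j) = 0"
    using h \<open>P f\<close> unfolding P_def by (simp add: sum_subtractf)
  then have "f k - h k = 0"
    using gm_unique[OF M, of "\<lambda>j. f j - h j" ?T k] fin gm_diff_mem[OF R M] h f(1) unfolding P_def by simp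
  then show ?thesis unfolding gcomp_def P_def[symmetric] h_def[symmetric] by simp
qed

lemma gcomp_props:
  assumes R: "standard_graded_algebra emb Rg" and M: "graded_module emb Rg act Mg"
  shows "gcomp Mg j x \<in> Mg j \<and> finite {j. gcomp Mg j x \<noteq> 0} \<and> x = (\<Sum>j | gcomp Mg j x \<noteq> 0. gcomp Mg j x)"
proof -
  obtain f and N :: nat where f: "\<And>j. f j \<in> Mg j" "\<And>j. \<bar>j\<bar> > int N \<Longrightarrow> f j = 0"
    "x = (\<Sum>j\<in>{-int N..int N}. f j)" using gm_decomp[OF M, of x] by blast
  have z: "f j = 0" if "j \<notin> {-int N..int N}" for j using f(2)[of j] that by auto
  then have eq: "gcomp Mg j x = f j" for j
    using gcomp_eqI[OF R M f(1) _ _ f(3)] by simp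
  have sub: "{j. f j \<noteq> 0} \<subseteq> {-int N..int N}" using z by blast
  then have "finite {j. f j \<noteq> 0}" by (rule finite_subset) simp
  moreover have "x = (\<Sum>j | f j \<noteq> 0. f j)"
    unfolding f(3) by (rule sum.mono_neutral_right[OF _ sub]) auto
  ultimately show ?thesis using eq f(1) by simp
qed

lemma gcomp_mem: 
  assumes R: "standard_graded_algebra emb Rg" and M: "graded_module emb Rg act Mg"
  shows "gcomp Mg j x \<in> Mg j"
  using gcomp_props[OF assms] by blast

lemma gcomp_homogeneous:
  assumes R: "standard_graded_algebra emb Rg" and M: "graded_module emb Rg act Mg" and "x \<in> Mg k"
  shows "gcomp Mg j x = (if j = k then x else 0)"
  using gcomp_eqI[OF R M, of "\<lambda>j. if j = k then x else 0" "{k}" x j] assms gm_zero_mem[OF M] by auto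

lemma graded_on_gcomp:
  assumes R: "standard_graded_algebra emb Rg" and M: "graded_module emb Rg act Mg"
  shows "graded_on act (Rz Rg) UNIV (gcomp Mg)"
proof -
  interpret module act using gm_module[OF M] .
  have fin: "finite {j. gcomp Mg j x \<noteq> 0}" and dec: "x = (\<Sum>j | gcomp Mg j x \<noteq> 0. gcomp Mg j x)" for x
    using gcomp_props[OF R M] by blast+
  show ?thesis
  proof
    fix x y j
    let ?T = "{j. gcomp Mg j x \<noteq> 0} \<union> {j. gcomp Mg j y \<noteq> 0}"
    have "(\<Sum>j | gcomp Mg j x \<noteq> 0. gcomp Mg j x) = (\<Sum>j\<in>?T. gcomp Mg j x)"
      "(\<Sum>j | gcomp Mg j y \<noteq> 0. gcomp Mg j y) = (\<Sum>j\<in>?T. gcomp Mg j y)"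
      using fin by (auto intro!: sum.mono_neutral_left)
    then have "x + y = (\<Sum>j\<in>?T. gcomp Mg j x + gcomp Mg j y)"
      using dec[of x] dec[of y] by (simp only: sum.distrib)
    then show "gcomp Mg j (x + y) = gcomp Mg j x + gcomp Mg j y"
      by (intro gcomp_eqI[OF R M _ finite_UnI[OF fin fin]])
        (auto intro: gcomp_mem[OF R M] gm_add_mem[OF M])
  next
    fix x j k
    show "gcomp Mg j (gcomp Mg k x) = (if j = k then gcomp Mg k x else 0)"
      using gcomp_homogeneous[OF R M gcomp_mem[OF R M]] .
  next
    fix x r e j assume r: "r \<in> Rz Rg e"
    show "gcomp Mg j (act r x) = act r (gcomp Mg (j - e) x)"
    proof (cases "e < 0")
      case True
      then have "r = 0" using r unfolding Rz_def by simp
      then show ?thesis using gcomp_homogeneous[OF R M gm_zero_mem[OF M]] by (auto split: if_splits)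
    next
      case False
      let ?S = "{j. gcomp Mg j x \<noteq> 0}"
      have r': "r \<in> Rg (nat e)" "int (nat e) = e" using r False unfolding Rz_def by auto
      have mem: "act r (gcomp Mg (j - e) x) \<in> Mg j" for j
        using gm_act_mem[OF M r'(1) gcomp_mem[OF R M, of "j - e" x]] r'(2) by simp
      have "act r x = (\<Sum>j\<in>?S. act r (gcomp Mg j x))"
        using arg_cong[OF dec[of x], of "act r"] by (simp add: scale_sum_right)
      also have "\<dots> = (\<Sum>j\<in>(+) e ` ?S. act r (gcomp Mg (j - e) x))"
        by (subst sum.reindex) (auto simp: inj_on_def)
      finally have "act r x = (\<Sum>j\<in>(+) e ` ?S. act r (gcomp Mg (j - e) x))" .
      moreover have "act r (gcomp Mg (j - e) x) = 0" if "j \<notin> (+) e ` ?S" for j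
      proof -
        have "gcomp Mg (j - e) x = 0" using that by (force simp: image_iff)
        then show ?thesis by simp
      qed
      ultimately show ?thesis using gcomp_eqI[OF R M mem finite_imageI[OF fin]] by blast
    qed
  qed (use fin dec in auto)
qed

lemma graded_module_self:
  assumes R: "standard_graded_algebra emb Rg"
  shows "graded_module emb Rg (*) (Rz Rg)"
proof -
  have sum_eq: "(\<Sum>j\<in>{-int N..int N}. f j) = (\<Sum>n\<le>N. f (int n))"
    if "\<And>j. j < 0 \<Longrightarrow> f j = 0" for f :: "int \<Rightarrow> 'b" and N
  proof -
    have "(\<Sum>j\<in>{-int N..int N}. f j) = (\<Sum>j\<in>int ` {..N}. f j)"
    proof (rule sum.mono_neutral_right)
      show "\<forall>i\<in>{- int N..int N} - int ` {..N}. f i = 0"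
      proof
        fix i assume i: "i \<in> {- int N..int N} - int ` {..N}"
        have "i < 0"
        proof (rule ccontr)
          assume "\<not> i < 0"
          then have "i = int (nat i)" "nat i \<le> N" using i by auto
          then show False using i by blast
        qed
        then show "f i = 0" using that by blast
      qed
    qed auto
    also have "\<dots> = (\<Sum>n\<le>N. f (int n))" by (subst sum.reindex) auto
    finally show ?thesis .
  qed
  have dec: "\<exists>f (N::nat). (\<forall>j. f j \<in> Rz Rg j) \<and> (\<forall>j. \<bar>j\<bar> > int N \<longrightarrow> f j = 0) \<and>
          x = (\<Sum>j\<in>{-int N..int N}. f j)" for x
  proof -
    obtain f N where f: "is_sum_decomp Rg f N" "x = (\<Sum>n\<le>N. f n)"
      using sga_decomp[OF R] by blast
    let ?g = "\<lambda>j::int. if j < 0 then 0 else f (nat j)"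
    have "(\<Sum>j\<in>{-int N..int N}. ?g j) = x"
      using sum_eq[of ?g N] f(2) by simp
    moreover have "\<forall>j. ?g j \<in> Rz Rg j" "\<forall>j. \<bar>j\<bar> > int N \<longrightarrow> ?g j = 0"
      using f(1) unfolding is_sum_decomp_def Rz_def by auto
    ultimately show ?thesis by (intro exI[of _ ?g] exI[of _ N]) simp
  qed
  have uniq: "f k = 0" if f: "\<forall>j. f j \<in> Rz Rg j" "\<forall>j. \<bar>j\<bar> > int N \<longrightarrow> f j = 0"
      "(\<Sum>j\<in>{-int N..int N}. f j) = 0" for f k and N :: nat
  proof -
    have neg: "f j = 0" if "j < 0" for j using f(1) that unfolding Rz_def by (metis singletonD)
    have "is_sum_decomp Rg (\<lambda>n. f (int n)) N"
      unfolding is_sum_decomp_def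
    proof (intro conjI allI impI)
      fix n show "f (int n) \<in> Rg n" using f(1)[rule_format, of "int n"] unfolding Rz_def by simp
    qed (use f(2) in auto)
    moreover have "(\<Sum>n\<le>N. f (int n)) = 0" using sum_eq[of f N] neg f(3) by simp
    ultimately have "f (int (nat k)) = 0" by (rule sga_unique[OF R])
    then show ?thesis using neg[of k] by (cases "k < 0") auto
  qed
  show ?thesis
    unfolding graded_module_def
  proof (intro conjI)
    show "\<forall>j. 0 \<in> Rz Rg j \<and> (\<forall>x\<in>Rz Rg j. \<forall>y\<in>Rz Rg j. x + y \<in> Rz Rg j) \<and>
        (\<forall>c. \<forall>x\<in>Rz Rg j. emb c * x \<in> Rz Rg j)"
      unfolding Rz_def using sga_zero_mem[OF R] sga_add_mem[OF R] sga_scale_mem[OF R] by auto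
    show "\<forall>n j. \<forall>r\<in>Rg n. \<forall>x\<in>Rz Rg j. r * x \<in> Rz Rg (int n + j)"
      unfolding Rz_def using sga_zero_mem[OF R] sga_mult_mem[OF R] by (auto simp: nat_add_distrib)
    show "\<forall>x. \<exists>f (N::nat). (\<forall>j. f j \<in> Rz Rg j) \<and> (\<forall>j. \<bar>j\<bar> > int N \<longrightarrow> f j = 0) \<and>
          x = (\<Sum>j\<in>{-int N..int N}. f j)" using dec by blast
    show "\<forall>f (N::nat). (\<forall>j. f j \<in> Rz Rg j) \<and> (\<forall>j. \<bar>j\<bar> > int N \<longrightarrow> f j = 0) \<and>
          (\<Sum>j\<in>{-int N..int N}. f j) = 0 \<longrightarrow> (\<forall>j. f j = 0)" using uniq by blast
  qed (auto simp: algebra_simps)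
qed

section \<open>The ring as a graded module over itself and its residue map\<close>

locale graded_algebra =
  fixes emb :: "'k::field \<Rightarrow> 'r::comm_ring_1" and Rg :: "nat \<Rightarrow> 'r set"
  assumes R: "standard_graded_algebra emb Rg"
begin

abbreviation \<rho> :: "int \<Rightarrow> 'r \<Rightarrow> 'r" where "\<rho> \<equiv> gcomp (Rz Rg)"

sublocale ring: graded_on "(*)" "Rz Rg" UNIV \<rho>
  using graded_on_gcomp[OF R graded_module_self[OF R]] .

text \<open>For the action of \<open>R\<close> on itself this rule is the reverse of \<open>mult.assoc\<close>.\<close>

declare ring.scale_scale [simp del]

lemma \<rho>_mem: "\<rho> j x \<in> Rz Rg j"
  using gcomp_mem[OF R graded_module_self[OF R]] .

lemma \<rho>_homogeneous: "x \<in> Rz Rg k \<Longrightarrow> \<rho> j x = (if j = k then x else 0)"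
  using gcomp_homogeneous[OF R graded_module_self[OF R]] .

lemma \<rho>_add: "\<rho> j (x + y) = \<rho> j x + \<rho> j y"
  by (simp add: ring.proj_add)

lemma \<rho>_sum: "\<rho> j (sum f A) = (\<Sum>i\<in>A. \<rho> j (f i))"
  by (simp add: ring.proj_sum)

lemma \<rho>_diff: "\<rho> j (x - y) = \<rho> j x - \<rho> j y"
  using \<rho>_add[of j "x - y" y] by simp

lemma \<rho>_mult: "r \<in> Rz Rg e \<Longrightarrow> \<rho> j (r * x) = r * \<rho> (j - e) x"
  using ring.proj_act by simp

lemma Rz_zero [simp]: "0 \<in> Rz Rg j"
  and Rz_add: "\<lbrakk>x \<in> Rz Rg j; y \<in> Rz Rg j\<rbrakk> \<Longrightarrow> x + y \<in> Rz Rg j"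
  and Rz_diff: "\<lbrakk>x \<in> Rz Rg j; y \<in> Rz Rg j\<rbrakk> \<Longrightarrow> x - y \<in> Rz Rg j"
  using gm_zero_mem[OF graded_module_self[OF R]] gm_add_mem[OF graded_module_self[OF R]]
    gm_diff_mem[OF R graded_module_self[OF R]] by auto

lemma Rz_sum: "(\<And>i. i \<in> A \<Longrightarrow> f i \<in> Rz Rg j) \<Longrightarrow> sum f A \<in> Rz Rg j"
  by (induction A rule: infinite_finite_induct) (auto intro: Rz_add)

lemma Rz_mult: 
  assumes "x \<in> Rz Rg j" "y \<in> Rz Rg k"
  shows "x * y \<in> Rz Rg (j + k)"
proof -
  have "\<rho> (j + k) (x * y) = x * y" using \<rho>_mult[OF assms(1), of "j + k" y] \<rho>_homogeneous[OF assms(2), of k] by simp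
  then show ?thesis using \<rho>_mem[of "j + k" "x * y"] by simp
qed

lemma Rz_neg: "j < 0 \<Longrightarrow> x \<in> Rz Rg j \<Longrightarrow> x = 0"
  unfolding Rz_def by simp

lemma \<rho>_neg: "j < 0 \<Longrightarrow> \<rho> j x = 0"
  using Rz_neg \<rho>_mem by blast

lemma Rz_0: "Rz Rg 0 = range emb"
  unfolding Rz_def using sga_degree_0[OF R] by simp

lemma one_mem: "1 \<in> Rz Rg 0"
  unfolding Rz_0 using sga_one[OF R] by (metis rangeI)

lemma Rg_Rz: "x \<in> Rg n \<Longrightarrow> x \<in> Rz Rg (int n)"
  unfolding Rz_def by simp

text \<open>As no degree is negative, only the product of the two degree 0 parts lands in degree 0.
  So \<open>\<rho> 0\<close> is the residue map onto the copy of \<open>k\<close>, and reduction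
  modulo the irrelevant ideal is expressed by it throughout.\<close>

lemma \<rho>0_mult: "\<rho> 0 (x * y) = \<rho> 0 x * \<rho> 0 y"
proof -
  let ?S = "{j. \<rho> j x \<noteq> 0}"
  have "x = (\<Sum>j\<in>?S. \<rho> j x)" using ring.proj_decomp by blast
  then have "\<rho> 0 (x * y) = \<rho> 0 (\<Sum>j\<in>?S. \<rho> j x * y)" by (metis sum_distrib_right)
  also have "\<dots> = (\<Sum>j\<in>?S. \<rho> j x * \<rho> (- j) y)" by (simp add: \<rho>_sum \<rho>_mult[OF \<rho>_mem])
  also have "\<dots> = (\<Sum>j\<in>?S. if j = 0 then \<rho> 0 x * \<rho> 0 y else 0)"
  proof (rule sum.cong)
    fix j show "\<rho> j x * \<rho> (- j) y = (if j = 0 then \<rho> 0 x * \<rho> 0 y else 0)"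
      using \<rho>_neg[of j x] \<rho>_neg[of "-j" y] by (cases "j < 0"; cases "j = 0") auto
  qed simp
  also have "\<dots> = \<rho> 0 x * \<rho> 0 y"
    using ring.proj_finite[of x] by (auto simp: sum.delta)
  finally show ?thesis .
qed

lemma irrelevant_ideal_iff: "x \<in> irrelevant_ideal Rg \<longleftrightarrow> \<rho> 0 x = 0"
proof
  assume "x \<in> irrelevant_ideal Rg"
  then obtain f N where f: "is_sum_decomp Rg f N" "f 0 = 0" "x = (\<Sum>n\<le>N. f n)"
    unfolding irrelevant_ideal_def by blast
  have "\<rho> 0 (f n) = 0" for n
    using \<rho>_homogeneous[of "f n" "int n" 0] f Rg_Rz[of "f n" n] unfolding is_sum_decomp_def by (cases "n = 0") auto
  then show "\<rho> 0 x = 0" by (simp add: f(3) \<rho>_sum)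
next
  assume x: "\<rho> 0 x = 0"
  obtain f N where f: "is_sum_decomp Rg f N" "x = (\<Sum>n\<le>N. f n)"
    using sga_decomp[OF R] by blast
  have "\<rho> 0 (f n) = (if n = 0 then f 0 else 0)" for n
    using \<rho>_homogeneous[of "f n" "int n" 0] f Rg_Rz[of "f n" n] unfolding is_sum_decomp_def by (cases "n = 0") auto
  then have "\<rho> 0 x = f 0" by (simp add: f(2) \<rho>_sum)
  then show "x \<in> irrelevant_ideal Rg" unfolding irrelevant_ideal_def using x f by force
qed

end

locale graded_algebra_module = graded_algebra emb Rg + graded_on act "Rz Rg" C \<pi>
  for emb :: "'k::field \<Rightarrow> 'r::comm_ring_1" and Rg :: "nat \<Rightarrow> 'r set"
    and act :: "'r \<Rightarrow> 'm::ab_group_add \<Rightarrow> 'm" and C \<pi>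
begin

text \<open>The counterpart of \<open>proj_act\<close>, with the vector instead of the scalar
  homogeneous. It allows the coefficients of a combination of homogeneous generators to be replaced
  by homogeneous ones.\<close>

lemma proj_act_homogeneous:
  assumes g: "g \<in> C" "\<pi> e g = g"
  shows "\<pi> j (act r g) = act (\<rho> (j - e) r) g"
proof -
  let ?S = "{j. \<rho> j r \<noteq> 0}"
  have "r = (\<Sum>i\<in>?S. \<rho> i r)" using ring.proj_decomp by blast
  then have "act r g = (\<Sum>i\<in>?S. act (\<rho> i r) g)" by (metis scale_sum_left)
  then have "\<pi> j (act r g) = (\<Sum>i\<in>?S. \<pi> j (act (\<rho> i r) g))"
    using proj_sum[of ?S "\<lambda>i. act (\<rho> i r) g"] subspace_scale[OF subspace_C g(1)] by simp
  also have "\<dots> = (\<Sum>i\<in>?S. if i = j - e then act (\<rho> (j - e) r) g else 0)"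
  proof (rule sum.cong)
    fix i
    have "\<pi> j (act (\<rho> i r) g) = act (\<rho> i r) (\<pi> (j - i) (\<pi> e g))"
      using proj_act[OF g(1) \<rho>_mem] g(2) by simp
    also have "\<dots> = (if i = j - e then act (\<rho> (j - e) r) g else 0)"
      using proj_proj[OF g(1), of "j - i" e] g(2) by auto
    finally show "\<pi> j (act (\<rho> i r) g) = (if i = j - e then act (\<rho> (j - e) r) g else 0)" .
  qed simp
  also have "\<dots> = act (\<rho> (j - e) r) g"
    using ring.proj_finite[of r] by (auto simp: sum.delta)
  finally show ?thesis .
qed

end

section \<open>Existence of minimal resolutions\<close>

lemma sum_fun_apply: "(\<Sum>i\<in>A. f i) c = (\<Sum>i\<in>A. f i c)"
  for f :: "'i \<Rightarrow> 'c \<Rightarrow> 'b::comm_monoid_add"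
  by (induction A rule: infinite_finite_induct) auto

context graded_algebra
begin

definition graded_ideal :: "'r set \<Rightarrow> bool" where
  "graded_ideal I \<longleftrightarrow> ring.subspace I \<and> (\<forall>x\<in>I. \<forall>j. \<rho> j x \<in> I)"

lemma
  assumes "graded_ideal I"
  shows ideal_zero: "0 \<in> I"
    and ideal_add: "\<lbrakk>x \<in> I; y \<in> I\<rbrakk> \<Longrightarrow> x + y \<in> I"
    and ideal_mult: "x \<in> I \<Longrightarrow> r * x \<in> I"
    and ideal_sum: "(\<And>i. i \<in> A \<Longrightarrow> f i \<in> I) \<Longrightarrow> sum f A \<in> I"
    and ideal_proj: "x \<in> I \<Longrightarrow> \<rho> j x \<in> I"
proof -
  have I: "ring.subspace I" using assms unfolding graded_ideal_def by blast
  show "0 \<in> I" using ring.subspace_0[OF I] .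
  show "\<lbrakk>x \<in> I; y \<in> I\<rbrakk> \<Longrightarrow> x + y \<in> I" using ring.subspace_add[OF I] .
  show "x \<in> I \<Longrightarrow> r * x \<in> I" using ring.subspace_scale[OF I] .
  show "(\<And>i. i \<in> A \<Longrightarrow> f i \<in> I) \<Longrightarrow> sum f A \<in> I" using ring.subspace_sum[OF I] .
  show "x \<in> I \<Longrightarrow> \<rho> j x \<in> I" using assms unfolding graded_ideal_def by blast
qed

definition vact :: "'r \<Rightarrow> (nat \<Rightarrow> 'r) \<Rightarrow> nat \<Rightarrow> 'r" where
  "vact r x = (\<lambda>c. r * x c)"

definition vproj :: "(nat \<Rightarrow> int) \<Rightarrow> int \<Rightarrow> (nat \<Rightarrow> 'r) \<Rightarrow> nat \<Rightarrow> 'r" where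
  "vproj e j x = (\<lambda>c. \<rho> (j - e c) (x c))"

sublocale vec: module vact
  by standard (simp_all add: vact_def fun_eq_iff algebra_simps)

lemma vec_graded_on: "graded_on vact (Rz Rg) {x. vsupp n x} (vproj e)"
proof
  show "vec.subspace {x. vsupp n x}"
    by (rule vec.subspaceI) (auto simp: vsupp_def vact_def)
next
  fix x y j
  show "vproj e j (x + y) = vproj e j x + vproj e j y" by (simp add: vproj_def fun_eq_iff \<rho>_add)
next
  fix x j k
  show "vproj e j (vproj e k x) = (if j = k then vproj e k x else 0)"
    by (cases "j = k") (simp_all add: vproj_def fun_eq_iff ring.proj_proj)
next
  fix x :: "nat \<Rightarrow> 'r" assume x: "x \<in> {x. vsupp n x}"
  have "{j. vproj e j x \<noteq> 0} \<subseteq> (\<Union>c<n. (\<lambda>k. k + e c) ` {k. \<rho> k (x c) \<noteq> 0})"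
  proof
    fix j assume "j \<in> {j. vproj e j x \<noteq> 0}"
    then obtain c where c: "\<rho> (j - e c) (x c) \<noteq> 0" unfolding vproj_def fun_eq_iff by auto
    then have "x c \<noteq> 0" by auto
    then have "c < n" using x by (intro ccontr[of "c < n"]) (simp add: vsupp_def not_less)
    moreover have "j = (j - e c) + e c" by simp
    ultimately show "j \<in> (\<Union>c<n. (\<lambda>k. k + e c) ` {k. \<rho> k (x c) \<noteq> 0})" using c by blast
  qed
  moreover have "finite (\<Union>c<n. (\<lambda>k. k + e c) ` {k. \<rho> k (x c) \<noteq> 0})"
    using ring.proj_finite by blast
  ultimately show fin: "finite {j. vproj e j x \<noteq> 0}" by (rule finite_subset)
  show "x = (\<Sum>j | vproj e j x \<noteq> 0. vproj e j x)"
  proof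
    fix c
    have "x c = (\<Sum>k | \<rho> k (x c) \<noteq> 0. \<rho> k (x c))" using ring.proj_decomp by blast
    also have "\<dots> = (\<Sum>j\<in>(\<lambda>k. k + e c) ` {k. \<rho> k (x c) \<noteq> 0}. \<rho> (j - e c) (x c))"
      by (subst sum.reindex) (auto simp: inj_on_def)
    also have "\<dots> = (\<Sum>j | vproj e j x \<noteq> 0. \<rho> (j - e c) (x c))"
    proof (rule sum.mono_neutral_left[OF fin])
      show "(\<lambda>k. k + e c) ` {k. \<rho> k (x c) \<noteq> 0} \<subseteq> {j. vproj e j x \<noteq> 0}"
        by (auto simp: vproj_def fun_eq_iff intro!: exI[of _ c])
      show "\<forall>i\<in>{j. vproj e j x \<noteq> 0} - (\<lambda>k. k + e c) ` {k. \<rho> k (x c) \<noteq> 0}. \<rho> (i - e c) (x c) = 0"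
      proof
        fix i assume i: "i \<in> {j. vproj e j x \<noteq> 0} - (\<lambda>k. k + e c) ` {k. \<rho> k (x c) \<noteq> 0}"
        have "i = (i - e c) + e c" by simp
        then have "i - e c \<notin> {k. \<rho> k (x c) \<noteq> 0}" using i by blast
        then show "\<rho> (i - e c) (x c) = 0" by blast
      qed
    qed
    also have "\<dots> = (\<Sum>j | vproj e j x \<noteq> 0. vproj e j x) c"
      by (simp add: sum_fun_apply vproj_def)
    finally show "x c = (\<Sum>j | vproj e j x \<noteq> 0. vproj e j x) c" .
  qed
next
  fix x r d j assume r: "r \<in> Rz Rg d"
  have "j - e c - d = j - d - e c" for c by simp
  then show "vproj e j (vact r x) = vact r (vproj e (j - d) x)"
    by (simp only: vproj_def vact_def \<rho>_mult[OF r])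
qed

lemma vsupp_span:
  "{x. vsupp n x} \<subseteq> vec.span ((\<lambda>i c. if c = i then 1 else 0) ` {..<n})"
proof
  fix x :: "nat \<Rightarrow> 'r" assume "x \<in> {x. vsupp n x}"
  then have x: "x c = 0" if "\<not> c < n" for c using that by (simp add: vsupp_def)
  have "x = (\<Sum>i<n. vact (x i) (\<lambda>c. if c = i then 1 else 0))"
  proof
    fix c
    have "(\<Sum>i<n. vact (x i) (\<lambda>c. if c = i then 1 else 0)) c = (\<Sum>i<n. if c = i then x i else 0)"
      unfolding sum_fun_apply vact_def by (intro sum.cong) auto
    also have "\<dots> = x c" using x[of c] by simp
    finally show "x c = (\<Sum>i<n. vact (x i) (\<lambda>c. if c = i then 1 else 0)) c" by (rule sym)
  qed
  also have "\<dots> \<in> vec.span ((\<lambda>i c. if c = i then 1 else 0) ` {..<n})"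
    by (intro vec.span_sum vec.span_scale vec.span_base) auto
  finally show "x \<in> vec.span ((\<lambda>i c. if c = i then 1 else 0) ` {..<n})" .
qed

text \<open>What one stage of the resolution hands to the next. Vectors represent elements modulo
  \<open>I\<close>, so those with entries in \<open>I\<close> must belong to \<open>Z\<close>. The
  last clause records the minimality of the previous choice of generators, and makes the next matrix
  minimal.\<close>

definition syzygy_module :: "'r set \<Rightarrow> nat \<Rightarrow> (nat \<Rightarrow> int) \<Rightarrow> (nat \<Rightarrow> 'r) set \<Rightarrow> bool" where
  "syzygy_module I n e Z \<longleftrightarrow> vec.subspace Z \<and> (\<forall>x\<in>Z. vsupp n x) \<and> (\<forall>x\<in>Z. \<forall>j. vproj e j x \<in> Z) \<and>
     (\<forall>x. vsupp n x \<longrightarrow> (\<forall>c. x c \<in> I) \<longrightarrow> x \<in> Z) \<and> (\<forall>x\<in>Z. \<forall>c. \<rho> 0 (x c) = 0)"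

end

section \<open>Minimal homogeneous generators modulo a submodule\<close>

context graded_algebra_module
begin

definition homogeneous_generators :: "'m set \<Rightarrow> 'm set \<Rightarrow> 'm set \<Rightarrow> bool" where
  "homogeneous_generators Z K E \<longleftrightarrow> finite E \<and> E \<subseteq> Z \<and> (\<forall>g\<in>E. \<exists>e. \<pi> e g = g) \<and>
     (\<forall>z\<in>Z. \<exists>x. z - (\<Sum>g\<in>E. act (x g) g) \<in> K)"

lemma homogeneous_generators_exist:
  assumes Z: "Z \<subseteq> C" "\<And>z j. z \<in> Z \<Longrightarrow> \<pi> j z \<in> Z"
    and K: "subspace K" and B: "finite B" "B \<subseteq> Z" "Z \<subseteq> span B"
  obtains E where "homogeneous_generators Z K E"
proof -
  define E where "E = (\<Union>b\<in>B. (\<lambda>j. \<pi> j b) ` {j. \<pi> j b \<noteq> 0})"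
  have fin: "finite E" unfolding E_def using B Z proj_finite by blast
  have "b \<in> span E" if "b \<in> B" for b
  proof -
    have "b = (\<Sum>j | \<pi> j b \<noteq> 0. \<pi> j b)" using proj_decomp that B Z by blast
    also have "\<dots> \<in> span E"
      by (intro span_sum span_base) (use that in \<open>auto simp: E_def\<close>)
    finally show ?thesis .
  qed
  then have "span B \<subseteq> span E" by (intro span_minimal) auto
  have "\<exists>x. z - (\<Sum>g\<in>E. act (x g) g) \<in> K" if "z \<in> Z" for z
  proof -
    have "z \<in> span E" using that \<open>span B \<subseteq> span E\<close> B by blast
    then obtain x where "z = (\<Sum>g\<in>E. act (x g) g)" unfolding span_finite[OF fin] by blast
    then show ?thesis using subspace_0[OF K] by (intro exI[of _ x]) simp
  qed
  moreover have "E \<subseteq> Z" unfolding E_def using B Z by blast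
  moreover have "\<exists>e. \<pi> e g = g" if g: "g \<in> E" for g
  proof -
    obtain b j where "b \<in> B" "g = \<pi> j b" using g unfolding E_def by blast
    then have "\<pi> j g = g" using proj_proj[of b j j] B Z by auto
    then show ?thesis by blast
  qed
  ultimately have "homogeneous_generators Z K E"
    using fin unfolding homogeneous_generators_def by simp
  then show ?thesis by (rule that)
qed

text \<open>The elimination step behind the graded Nakayama lemma: a relation in which
  \<open>g0\<close> has a coefficient with nonzero scalar part expresses \<open>g0\<close> through
  the other generators.\<close>

lemma remove_redundant_generator:
  assumes K: "subspace K" "\<And>z j. z \<in> K \<Longrightarrow> \<pi> j z \<in> K" and Z: "Z \<subseteq> C"
    and E: "homogeneous_generators Z K E"
    and rel: "(\<Sum>g\<in>E. act (x g) g) \<in> K" and g0: "g0 \<in> E" "\<rho> 0 (x g0) \<noteq> 0"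
  shows "homogeneous_generators Z K (E - {g0})"
proof -
  have fin: "finite E" and EZ: "E \<subseteq> Z" and hom: "\<And>g. g \<in> E \<Longrightarrow> \<exists>e. \<pi> e g = g"
    and gen: "\<And>z. z \<in> Z \<Longrightarrow> \<exists>x. z - (\<Sum>g\<in>E. act (x g) g) \<in> K"
    using E unfolding homogeneous_generators_def by blast+
  obtain e where e: "\<And>g. g \<in> E \<Longrightarrow> \<pi> (e g) g = g" using hom by metis
  \<comment> \<open>The component of the relation in the degree of \<open>g0\<close>. At
    \<open>g0\<close> itself this coefficient is \<open>\<rho> 0 (x g0)\<close>, a nonzero scalar
    and hence invertible.\<close>
  define y where "y g = \<rho> (e g0 - e g) (x g)" for g
  have EC: "g \<in> C" if "g \<in> E" for g using EZ Z that by blast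
  have "\<pi> (e g0) (\<Sum>g\<in>E. act (x g) g) = (\<Sum>g\<in>E. act (y g) g)"
    unfolding y_def using proj_act_homogeneous[OF EC e] subspace_scale[OF subspace_C EC]
    by (simp add: proj_sum)
  then have y: "(\<Sum>g\<in>E. act (y g) g) \<in> K" using K(2)[OF rel, of "e g0"] by simp
  have "y g0 \<in> range emb" unfolding y_def using \<rho>_mem[of 0] Rz_0 by simp
  then obtain u where u: "y g0 = emb u" by blast
  have "u \<noteq> 0" using u g0(2) sga_diff[OF R, of 0 0] unfolding y_def by auto
  then have inv: "emb (inverse u) * y g0 = 1" using u sga_mult[OF R, of "inverse u" u] sga_one[OF R] by simp
  define w where "w g = emb (inverse u) * y g" for g
  have "act (emb (inverse u)) (\<Sum>g\<in>E. act (y g) g) \<in> K" using subspace_scale[OF K(1) y] .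
  then have "(\<Sum>g\<in>E. act (w g) g) \<in> K" unfolding w_def by (simp add: scale_sum_right)
  then have w: "g0 + (\<Sum>g\<in>E - {g0}. act (w g) g) \<in> K"
    using sum.remove[OF fin g0(1), of "\<lambda>g. act (w g) g"] inv unfolding w_def by simp
  have "\<exists>x. z - (\<Sum>g\<in>E - {g0}. act (x g) g) \<in> K" if z: "z \<in> Z" for z
  proof -
    obtain t where t: "z - (\<Sum>g\<in>E. act (t g) g) \<in> K" using gen[OF z] by blast
    have "z - (\<Sum>g\<in>E - {g0}. act (t g - t g0 * w g) g)
        = (z - (\<Sum>g\<in>E. act (t g) g)) + act (t g0) (g0 + (\<Sum>g\<in>E - {g0}. act (w g) g))"
      by (simp add: sum.remove[OF fin g0(1)] scale_left_diff_distrib sum_subtractf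
          scale_right_distrib scale_sum_right)
    also have "\<dots> \<in> K" using subspace_add[OF K(1) t subspace_scale[OF K(1) w]] .
    finally show ?thesis by (intro exI[of _ "\<lambda>g. t g - t g0 * w g"])
  qed
  then show ?thesis using fin EZ hom unfolding homogeneous_generators_def by blast
qed

text \<open>Generators of least cardinality are taken; a relation with a coefficient outside the
  irrelevant ideal would allow one to be removed. The relations therefore form a
  \<open>syzygy_module\<close>, and the construction can be iterated.\<close>

lemma minimal_generators:
  assumes Z: "Z \<subseteq> C" "\<And>z j. z \<in> Z \<Longrightarrow> \<pi> j z \<in> Z"
    and K: "subspace K" "\<And>z j. z \<in> K \<Longrightarrow> \<pi> j z \<in> K"
    and IZ: "\<And>r z. r \<in> I \<Longrightarrow> z \<in> Z \<Longrightarrow> act r z \<in> K"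
    and B: "finite B" "B \<subseteq> Z" "Z \<subseteq> span B"
  obtains n g e where "\<And>c. c < n \<Longrightarrow> g c \<in> Z" "\<And>c. c < n \<Longrightarrow> \<pi> (e c) (g c) = g c"
    "\<And>z. z \<in> Z \<Longrightarrow> \<exists>x. z - (\<Sum>c<n. act (x c) (g c)) \<in> K"
    "syzygy_module I n e {x. vsupp n x \<and> (\<Sum>c<n. act (x c) (g c)) \<in> K}"
proof -
  obtain E0 where "homogeneous_generators Z K E0"
    using homogeneous_generators_exist[OF Z K(1) B] by blast
  then obtain E where E: "homogeneous_generators Z K E"
    and least: "\<And>E'. homogeneous_generators Z K E' \<Longrightarrow> card E \<le> card E'"
    using ex_has_least_nat[of "homogeneous_generators Z K" E0 card] by blast
  have fin: "finite E" and EZ: "E \<subseteq> Z" and hom: "\<And>g. g \<in> E \<Longrightarrow> \<exists>e. \<pi> e g = g"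
    and gen: "\<And>z. z \<in> Z \<Longrightarrow> \<exists>x. z - (\<Sum>g\<in>E. act (x g) g) \<in> K"
    using E unfolding homogeneous_generators_def by blast+
  have minimal: "\<rho> 0 (x g) = 0" if "(\<Sum>g\<in>E. act (x g) g) \<in> K" "g \<in> E" for x g
  proof (rule ccontr)
    assume "\<rho> 0 (x g) \<noteq> 0"
    then have "homogeneous_generators Z K (E - {g})"
      using remove_redundant_generator[OF K Z(1) E] that by blast
    then have "card E \<le> card (E - {g})" by (rule least)
    moreover have "card (E - {g}) < card E" using fin that(2) by (intro card_Diff1_less)
    ultimately show False by simp
  qed
  define n where "n = card E"
  obtain g where g: "bij_betw g {..<n} E"
    using ex_bij_betw_nat_finite[OF fin] unfolding n_def atLeast0LessThan by blast
  have gE: "g c \<in> E" if "c < n" for c using g that unfolding bij_betw_def by blast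
  have sum_eq: "(\<Sum>c<n. act (x (g c)) (g c)) = (\<Sum>h\<in>E. act (x h) h)" for x
    by (rule sum.reindex_bij_betw[OF g, of "\<lambda>h. act (x h) h"])
  have "\<forall>c. \<exists>e. c < n \<longrightarrow> \<pi> e (g c) = g c" using hom gE by blast
  then obtain e where e: "\<And>c. c < n \<Longrightarrow> \<pi> (e c) (g c) = g c" by metis
  have gC: "g c \<in> C" if "c < n" for c using gE[OF that] EZ Z by blast
  let ?S = "{x. vsupp n x \<and> (\<Sum>c<n. act (x c) (g c)) \<in> K}"
  have "syzygy_module I n e ?S"
    unfolding syzygy_module_def
  proof (intro conjI ballI allI impI)
    show "vec.subspace ?S"
    proof (rule vec.subspaceI)
      show "0 \<in> ?S" using subspace_0[OF K(1)] by (simp add: vsupp_def)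
    next
      fix x y assume "x \<in> ?S" "y \<in> ?S"
      then show "x + y \<in> ?S" using subspace_add[OF K(1)]
        by (auto simp: vsupp_def scale_left_distrib sum.distrib)
    next
      fix r x assume x: "x \<in> ?S"
      then have "act r (\<Sum>c<n. act (x c) (g c)) \<in> K" using subspace_scale[OF K(1)] by blast
      then show "vact r x \<in> ?S" using x
        by (auto simp: vsupp_def vact_def scale_sum_right)
    qed
  next
    fix x j assume x: "x \<in> ?S"
    have "\<pi> j (\<Sum>c<n. act (x c) (g c)) = (\<Sum>c<n. act (vproj e j x c) (g c))"
      unfolding vproj_def using proj_act_homogeneous[OF gC e] subspace_scale[OF subspace_C gC]
      by (subst proj_sum) auto
    moreover have "\<pi> j (\<Sum>c<n. act (x c) (g c)) \<in> K" using x K(2) by blast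
    moreover have "vsupp n (vproj e j x)" using x by (simp add: vsupp_def vproj_def)
    ultimately show "vproj e j x \<in> ?S" by simp
  next
    fix x assume x: "vsupp n x" "\<forall>c. x c \<in> I"
    have "(\<Sum>c<n. act (x c) (g c)) \<in> K"
      using x(2) gE EZ by (intro subspace_sum[OF K(1)] IZ) auto
    then show "x \<in> ?S" using x by blast
  next
    fix x c assume x: "x \<in> ?S"
    show "\<rho> 0 (x c) = 0"
    proof (cases "c < n")
      case True
      define h where "h = the_inv_into {..<n} g"
      have h: "h (g c) = c" if "c < n" for c
        unfolding h_def using g that by (intro the_inv_into_f_f) (auto simp: bij_betw_def)
      have "(\<Sum>c<n. act (x (h (g c))) (g c)) = (\<Sum>c<n. act (x c) (g c))"
        using h by (intro sum.cong) auto
      then have "(\<Sum>t\<in>E. act (x (h t)) t) \<in> K" using x sum_eq[of "\<lambda>t. x (h t)"] by simp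
      then have "\<rho> 0 (x (h (g c))) = 0" using minimal[of "\<lambda>t. x (h t)"] gE[OF True] by blast
      then show ?thesis using h True by simp
    next
      case False
      then show ?thesis using x by (simp add: vsupp_def)
    qed
  qed simp
  moreover have "\<exists>x. z - (\<Sum>c<n. act (x c) (g c)) \<in> K" if z: "z \<in> Z" for z
  proof -
    obtain x where "z - (\<Sum>h\<in>E. act (x h) h) \<in> K" using gen[OF z] by blast
    then show ?thesis using sum_eq[of x] by (intro exI[of _ "\<lambda>c. x (g c)"]) simp
  qed
  ultimately show ?thesis using that[of n g e] gE EZ e by blast
qed

end

section \<open>The resolution as an iteration of syzygies\<close>

context graded_algebra
begin

text \<open>The last clause of one step and the second clause of the next describe the same set,
  once as a kernel and once as an image; together they give the exactness required of a
  resolution.\<close>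

definition cover_step ::
  "'r set \<Rightarrow> nat \<Rightarrow> (nat \<Rightarrow> int) \<Rightarrow> (nat \<Rightarrow> 'r) set \<Rightarrow> nat \<Rightarrow> (nat \<Rightarrow> int) \<Rightarrow> (nat \<Rightarrow> 'r) set \<Rightarrow>
   (nat \<Rightarrow> nat \<Rightarrow> 'r) \<Rightarrow> bool" where
  "cover_step I n e Z n' e' Z' D \<longleftrightarrow>
     (\<forall>r c. r < n \<and> c < n' \<longrightarrow> D r c \<in> Rz Rg (e' c - e r) \<and> D r c \<in> irrelevant_ideal Rg) \<and>
     (\<forall>x. vsupp n x \<longrightarrow> (x \<in> Z \<longleftrightarrow> (\<exists>y. vsupp n' y \<and> (\<forall>r<n. x r - matapp D n' y r \<in> I)))) \<and>
     Z' = {y. vsupp n' y \<and> (\<forall>r<n. matapp D n' y r \<in> I)}"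

lemma
  assumes "cover_step I n e Z n' e' Z' D"
  shows cover_step_exact: "vsupp n x \<Longrightarrow>
      x \<in> Z \<longleftrightarrow> (\<exists>y. vsupp n' y \<and> (\<forall>r<n. x r - matapp D n' y r \<in> I))"
    and cover_step_kernel: "x \<in> Z' \<longleftrightarrow> vsupp n' x \<and> (\<forall>r<n. matapp D n' x r \<in> I)"
proof -
  show "vsupp n x \<Longrightarrow> x \<in> Z \<longleftrightarrow> (\<exists>y. vsupp n' y \<and> (\<forall>r<n. x r - matapp D n' y r \<in> I))"
    using assms unfolding cover_step_def by blast
  have "Z' = {y. vsupp n' y \<and> (\<forall>r<n. matapp D n' y r \<in> I)}"
    using assms unfolding cover_step_def by blast
  then show "x \<in> Z' \<longleftrightarrow> vsupp n' x \<and> (\<forall>r<n. matapp D n' x r \<in> I)"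
    by simp
qed

lemma cover_step_exists:
  assumes I: "graded_ideal I" and Z: "syzygy_module I n e Z"
  shows "\<exists>n' e' Z'. syzygy_module I n' e' Z' \<and> (\<exists>D. cover_step I n e Z n' e' Z' D)"
proof -
  interpret V: graded_algebra_module emb Rg vact "{x. vsupp n x}" "vproj e"
    using vec_graded_on[of n e] R by (intro graded_algebra_module.intro graded_algebra.intro)
  define K where "K = {x. vsupp n x \<and> (\<forall>c. x c \<in> I)}"
  have Zs: "vec.subspace Z" and Zn: "Z \<subseteq> {x. vsupp n x}" and Zp: "\<And>x j. x \<in> Z \<Longrightarrow> vproj e j x \<in> Z"
    and KZ: "K \<subseteq> Z" and Zm: "\<And>x c. x \<in> Z \<Longrightarrow> \<rho> 0 (x c) = 0"
    using Z unfolding syzygy_module_def K_def by blast+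
  obtain B where B: "finite B" "B \<subseteq> Z" "Z = vec.span B"
    using submodule_finitely_generated[OF R vec.module_axioms _ order_trans[OF Zn vsupp_span] Zs]
    by blast
  have Ks: "vec.subspace K"
    using ideal_zero[OF I] ideal_add[OF I] ideal_mult[OF I] unfolding K_def
    by (intro vec.subspaceI) (auto simp: vsupp_def vact_def)
  have Kp: "vproj e j x \<in> K" if "x \<in> K" for x j
    using that ideal_proj[OF I] unfolding K_def vproj_def vsupp_def by auto
  have IZ: "vact r z \<in> K" if "r \<in> I" "z \<in> Z" for r z
    using that Zn ideal_mult[OF I, of r] unfolding K_def vact_def vsupp_def by (auto simp: mult.commute[of r])
  obtain n' g e' where g: "\<And>c. c < n' \<Longrightarrow> g c \<in> Z" "\<And>c. c < n' \<Longrightarrow> vproj e (e' c) (g c) = g c"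
    and gen: "\<And>z. z \<in> Z \<Longrightarrow> \<exists>x. z - (\<Sum>c<n'. vact (x c) (g c)) \<in> K"
    and syz: "syzygy_module I n' e' {x. vsupp n' x \<and> (\<Sum>c<n'. vact (x c) (g c)) \<in> K}"
    using V.minimal_generators[OF Zn Zp Ks Kp IZ B(1,2)] B(3) by blast
  \<comment> \<open>The generators are the columns of the matrix. Being elements of
    \<open>Z\<close>, they have entries without component of degree 0, which is the minimality of
    \<open>D\<close>.\<close>
  define D where "D r c = g c r" for r c
  have app: "(\<Sum>c<n'. vact (y c) (g c)) r = matapp D n' y r" for y r
    by (simp add: sum_fun_apply vact_def matapp_def D_def mult.commute)
  have supp: "vsupp n (\<Sum>c<n'. vact (y c) (g c))" for y
    unfolding vsupp_def app
  proof (intro allI impI)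
    fix r assume r: "n \<le> r"
    have "g c r = 0" if "c < n'" for c using g(1)[OF that] Zn r unfolding vsupp_def by blast
    then show "matapp D n' y r = 0" unfolding matapp_def D_def by simp
  qed
  have inK: "x \<in> K \<longleftrightarrow> (\<forall>r<n. x r \<in> I)" if "vsupp n x" for x
    using that ideal_zero[OF I] unfolding K_def vsupp_def by (auto, metis not_less)
  let ?Z' = "{x. vsupp n' x \<and> (\<Sum>c<n'. vact (x c) (g c)) \<in> K}"
  have "cover_step I n e Z n' e' ?Z' D"
    unfolding cover_step_def
  proof (intro conjI allI impI)
    fix r c assume "r < n \<and> c < n'"
    then have c: "c < n'" by blast
    have "D r c = \<rho> (e' c - e r) (D r c)"
      using fun_cong[OF g(2)[OF c], of r] unfolding D_def vproj_def by simp
    then show "D r c \<in> Rz Rg (e' c - e r)" using \<rho>_mem by metis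
    show "D r c \<in> irrelevant_ideal Rg"
      unfolding irrelevant_ideal_iff D_def using Zm[OF g(1)[OF c]] .
  next
    fix x :: "nat \<Rightarrow> 'r" assume x: "vsupp n x"
    show "x \<in> Z \<longleftrightarrow> (\<exists>y. vsupp n' y \<and> (\<forall>r<n. x r - matapp D n' y r \<in> I))"
    proof
      assume "x \<in> Z"
      then obtain y where "x - (\<Sum>c<n'. vact (y c) (g c)) \<in> K" using gen by blast
      then have y: "x r - matapp D n' y r \<in> I" for r unfolding K_def app[symmetric] by simp
      define y' where "y' c = (if c < n' then y c else 0)" for c
      have "vsupp n' y'" "matapp D n' y' = matapp D n' y"
        unfolding vsupp_def y'_def matapp_def by auto
      then show "\<exists>y. vsupp n' y \<and> (\<forall>r<n. x r - matapp D n' y r \<in> I)" using y by metis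
    next
      assume "\<exists>y. vsupp n' y \<and> (\<forall>r<n. x r - matapp D n' y r \<in> I)"
      then obtain y where y: "\<And>r. r < n \<Longrightarrow> x r - matapp D n' y r \<in> I" by blast
      let ?s = "\<Sum>c<n'. vact (y c) (g c)"
      have "vsupp n (x - ?s)" using x supp[of y] unfolding vsupp_def by simp
      moreover have "(x - ?s) r \<in> I" if "r < n" for r using y[OF that] app[of y r] by simp
      ultimately have "x - ?s \<in> Z" using inK KZ by blast
      moreover have "?s \<in> Z" using g(1) by (intro vec.subspace_sum[OF Zs] vec.subspace_scale[OF Zs]) auto
      ultimately have "x - ?s + ?s \<in> Z" using vec.subspace_add[OF Zs] by blast
      then show "x \<in> Z" by simp
    qed
  next
    show "?Z' = {y. vsupp n' y \<and> (\<forall>r<n. matapp D n' y r \<in> I)}"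
      using inK[OF supp] app by auto
  qed
  then show ?thesis using syz by blast
qed

theorem minimal_resolution_exists:
  fixes act :: "'r \<Rightarrow> 'm::ab_group_add \<Rightarrow> 'm"
  assumes M: "graded_module emb Rg act Mg" and fg: "finitely_generated_module act"
    and I: "graded_ideal I" and killed: "\<And>r m. r \<in> I \<Longrightarrow> act r m = 0"
  shows "\<exists>n deg d gen. minimal_graded_free_resolution Rg I act Mg n deg d gen"
proof -
  interpret M: graded_algebra_module emb Rg act UNIV "gcomp Mg"
    using graded_on_gcomp[OF R M] R by (intro graded_algebra_module.intro graded_algebra.intro)
  obtain N :: nat and h where h: "\<And>m. \<exists>x. m = (\<Sum>c<N. act (x c) (h c))"
    using fg unfolding finitely_generated_module_def by blast
  have "UNIV \<subseteq> M.span (h ` {..<N})"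
  proof
    fix m
    obtain x where "m = (\<Sum>c<N. act (x c) (h c))" using h by blast
    then show "m \<in> M.span (h ` {..<N})"
      by (simp only:) (intro M.span_sum M.span_scale M.span_base imageI)
  qed
  then obtain n0 gen e0 where gen: "\<And>c. c < n0 \<Longrightarrow> gcomp Mg (e0 c) (gen c) = gen c"
    "\<And>m. \<exists>x. m - (\<Sum>c<n0. act (x c) (gen c)) \<in> {0}"
    and syz: "syzygy_module I n0 e0 {x. vsupp n0 x \<and> (\<Sum>c<n0. act (x c) (gen c)) \<in> {0}}"
    by - (rule M.minimal_generators[of UNIV "{0}" I "h ` {..<N}"]; use killed in auto)
  define Z0 where "Z0 = {x. vsupp n0 x \<and> (\<Sum>c<n0. act (x c) (gen c)) \<in> {0}}"
  \<comment> \<open>Dependent choice leaves the first state open; the clause for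
    \<open>i = 0\<close> ties it to the generators \<open>gen\<close> chosen above.\<close>
  let ?P = "\<lambda>i (n, e, Z). syzygy_module I n e Z \<and> (i = 0 \<longrightarrow> (n, e, Z) = (n0, e0, Z0))"
  let ?Q = "\<lambda>i (n, e, Z) (n', e', Z'). \<exists>D. cover_step I n e Z n' e' Z' D"
  have "\<exists>s. \<forall>i::nat. ?P i (s i) \<and> ?Q i (s i) (s (Suc i))"
  proof (rule dependent_nat_choice)
    show "\<exists>s. ?P 0 s" using syz unfolding Z0_def by auto
  next
    fix s and i :: nat assume "?P i s"
    then obtain n e Z where s: "s = (n, e, Z)" "syzygy_module I n e Z" by (cases s) auto
    show "\<exists>s'. ?P (Suc i) s' \<and> ?Q i s s'"
      using cover_step_exists[OF I s(2)] unfolding s(1) by auto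
  qed
  then obtain s where s: "\<forall>i::nat. ?P i (s i) \<and> ?Q i (s i) (s (Suc i))" by (rule exE)
  define n where "n i = fst (s i)" for i
  define e where "e i = fst (snd (s i))" for i
  define Z where "Z i = snd (snd (s i))" for i
  have "\<exists>D. cover_step I (n i) (e i) (Z i) (n (Suc i)) (e (Suc i)) (Z (Suc i)) D" for i
    using s[rule_format, of i] unfolding n_def e_def Z_def by (simp only: split_beta)
  then have "\<exists>d. \<forall>i. cover_step I (n i) (e i) (Z i) (n (Suc i)) (e (Suc i)) (Z (Suc i)) (d i)"
    by (intro choice) blast
  then obtain d where d: "\<And>i. cover_step I (n i) (e i) (Z i) (n (Suc i)) (e (Suc i)) (Z (Suc i)) (d i)"
    by blast
  have zero: "n 0 = n0" "e 0 = e0" "Z 0 = Z0" using s[rule_format, of 0] unfolding n_def e_def Z_def by auto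
  have "minimal_graded_free_resolution Rg I act Mg n e d gen"
    unfolding minimal_graded_free_resolution_def
  proof (intro conjI)
    show "\<forall>c<n 0. gen c \<in> Mg (e 0 c)"
      unfolding zero using gen(1) gcomp_mem[OF R M] by metis
    show "\<forall>m. \<exists>x. m = (\<Sum>c<n 0. act (x c) (gen c))"
      unfolding zero using gen(2) by simp
    show "\<forall>i r c. r < n i \<and> c < n (Suc i) \<longrightarrow>
        d i r c \<in> Rz Rg (e (Suc i) c - e i r) \<and> d i r c \<in> irrelevant_ideal Rg"
      using d unfolding cover_step_def by blast
    show "\<forall>x. vsupp (n 0) x \<longrightarrow>
        ((\<Sum>c<n 0. act (x c) (gen c)) = 0 \<longleftrightarrow>
         (\<exists>y. vsupp (n 1) y \<and> (\<forall>r<n 0. x r - matapp (d 0) (n 1) y r \<in> I)))"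
    proof (intro allI impI)
      fix x :: "nat \<Rightarrow> 'r" assume x: "vsupp (n 0) x"
      have "x \<in> Z 0 \<longleftrightarrow> (\<Sum>c<n 0. act (x c) (gen c)) = 0" using x unfolding zero Z0_def by simp
      then show "(\<Sum>c<n 0. act (x c) (gen c)) = 0 \<longleftrightarrow>
         (\<exists>y. vsupp (n 1) y \<and> (\<forall>r<n 0. x r - matapp (d 0) (n 1) y r \<in> I))"
        using cover_step_exact[OF d x] by simp
    qed
    show "\<forall>i x. vsupp (n (Suc i)) x \<longrightarrow>
        ((\<forall>r<n i. matapp (d i) (n (Suc i)) x r \<in> I) \<longleftrightarrow>
         (\<exists>y. vsupp (n (Suc (Suc i))) y \<and>
              (\<forall>r<n (Suc i). x r - matapp (d (Suc i)) (n (Suc (Suc i))) y r \<in> I)))"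
    proof (intro allI impI)
      fix i and x :: "nat \<Rightarrow> 'r" assume x: "vsupp (n (Suc i)) x"
      have "x \<in> Z (Suc i) \<longleftrightarrow> (\<forall>r<n i. matapp (d i) (n (Suc i)) x r \<in> I)"
        using cover_step_kernel[OF d] x by blast
      then show "(\<forall>r<n i. matapp (d i) (n (Suc i)) x r \<in> I) \<longleftrightarrow>
         (\<exists>y. vsupp (n (Suc (Suc i))) y \<and>
              (\<forall>r<n (Suc i). x r - matapp (d (Suc i)) (n (Suc (Suc i))) y r \<in> I))"
        using cover_step_exact[OF d x] by simp
    qed
  qed
  then show ?thesis by blast
qed

end

section \<open>Uniqueness of graded Betti numbers\<close>

text \<open>Gaussian elimination: an equation with a pivot \<open>a0\<close> is used to remove that
  unknown from the others, which leaves one equation and one unknown less.\<close>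

lemma homogeneous_system_nontrivial:
  fixes Q :: "'b \<Rightarrow> 'a \<Rightarrow> 'k::field"
  assumes "finite B" "finite A" "card B < card A"
  shows "\<exists>x. (\<exists>a\<in>A. x a \<noteq> 0) \<and> (\<forall>b\<in>B. (\<Sum>a\<in>A. Q b a * x a) = 0)"
  using assms
proof (induction B arbitrary: A Q rule: finite_induct)
  case empty
  then have "A \<noteq> {}" by auto
  then show ?case by (intro exI[of _ "\<lambda>_. 1"]) auto
next
  case (insert b B)
  show ?case
  proof (cases "\<forall>a\<in>A. Q b a = 0")
    case True
    have "card B < card A" using insert by simp
    then obtain x where "\<exists>a\<in>A. x a \<noteq> 0" "\<forall>b\<in>B. (\<Sum>a\<in>A. Q b a * x a) = 0"
      using insert.IH[of A Q] insert.prems by blast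
    then show ?thesis using True by (intro exI[of _ x]) simp
  next
    case False
    then obtain a0 where a0: "a0 \<in> A" "Q b a0 \<noteq> 0" by blast
    have "card B < card (A - {a0})" using insert a0 by simp
    then obtain x where x: "\<exists>a\<in>A - {a0}. x a \<noteq> 0"
      "\<forall>c\<in>B. (\<Sum>a\<in>A - {a0}. (Q c a - Q c a0 * Q b a / Q b a0) * x a) = 0"
      using insert.IH[of "A - {a0}" "\<lambda>c a. Q c a - Q c a0 * Q b a / Q b a0"] insert.prems by blast
    define t where "t = (\<Sum>a\<in>A - {a0}. Q b a * x a) / Q b a0"
    define y where "y = x(a0 := - t)"
    have split: "(\<Sum>a\<in>A. Q c a * y a) = - Q c a0 * t + (\<Sum>a\<in>A - {a0}. Q c a * x a)" for c
    proof -
      have "(\<Sum>a\<in>A - {a0}. Q c a * y a) = (\<Sum>a\<in>A - {a0}. Q c a * x a)"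
        by (intro sum.cong) (auto simp: y_def)
      then show ?thesis
        using sum.remove[OF insert.prems(1) a0(1), of "\<lambda>a. Q c a * y a"] by (simp add: y_def)
    qed
    have "(\<Sum>a\<in>A. Q c a * y a) = 0" if "c \<in> B" for c
    proof -
      have "(\<Sum>a\<in>A - {a0}. (Q c a - Q c a0 * Q b a / Q b a0) * x a)
          = (\<Sum>a\<in>A - {a0}. Q c a * x a) - Q c a0 / Q b a0 * (\<Sum>a\<in>A - {a0}. Q b a * x a)"
        by (simp add: left_diff_distrib sum_subtractf sum_distrib_left mult.assoc)
      then show ?thesis using x(2) that unfolding split t_def by simp
    qed
    moreover have "(\<Sum>a\<in>A. Q b a * y a) = 0" unfolding split t_def using a0 by simp
    moreover have "\<exists>a\<in>A. y a \<noteq> 0" using x(1) unfolding y_def by auto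
    ultimately show ?thesis by blast
  qed
qed

text \<open>With fewer rows than columns \<open>Q\<close> would kill a nonzero vector, but
  \<open>P\<close> times \<open>Q\<close> is the identity.\<close>

lemma card_le_of_matrix_retract:
  fixes P :: "'a \<Rightarrow> 'b \<Rightarrow> 'k::field"
  assumes "finite A" "finite B"
    and PQ: "\<And>a a'. a \<in> A \<Longrightarrow> a' \<in> A \<Longrightarrow> (\<Sum>b\<in>B. P a b * Q b a') = (if a = a' then 1 else 0)"
  shows "card A \<le> card B"
proof (rule ccontr)
  assume "\<not> card A \<le> card B"
  then obtain x where x: "\<exists>a\<in>A. x a \<noteq> 0" "\<And>b. b \<in> B \<Longrightarrow> (\<Sum>a\<in>A. Q b a * x a) = 0"
    using homogeneous_system_nontrivial[OF assms(2,1), of Q] by auto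
  have "x a = 0" if a: "a \<in> A" for a
  proof -
    have "x a = (\<Sum>a'\<in>A. if a = a' then x a' else 0)" using a assms(1) by simp
    also have "\<dots> = (\<Sum>a'\<in>A. (\<Sum>b\<in>B. P a b * Q b a') * x a')"
      by (intro sum.cong) (auto simp: PQ a)
    also have "\<dots> = (\<Sum>b\<in>B. P a b * (\<Sum>a'\<in>A. Q b a' * x a'))"
      unfolding sum_distrib_right sum_distrib_left by (subst sum.swap) (simp add: mult.assoc)
    also have "\<dots> = 0" using x(2) by simp
    finally show ?thesis .
  qed
  then show False using x(1) by blast
qed

lemma matapp_cong: "(\<And>c. c < N \<Longrightarrow> x c = y c) \<Longrightarrow> matapp A N x r = matapp A N y r"
  unfolding matapp_def by (intro sum.cong) auto

lemma matapp_diff: "matapp A N (\<lambda>c. x c - y c) r = matapp A N x r - matapp A N y r"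
  unfolding matapp_def by (simp add: right_diff_distrib sum_subtractf)

lemma matapp_zero [simp]: "matapp (\<lambda>r c. 0) N x r = 0"
  unfolding matapp_def by simp

lemma matapp_unit: "k < N \<Longrightarrow> matapp A N (\<lambda>c. if c = k then 1 else 0) r = A r k"
  unfolding matapp_def by (simp add: if_distrib cong: if_cong)

lemma matapp_matapp:
  "matapp A m (matapp B N x) r = (\<Sum>c<N. matapp A m (\<lambda>s. B s c) r * x c)"
  unfolding matapp_def sum_distrib_left sum_distrib_right
  by (subst sum.swap) (simp add: mult.assoc)

context graded_algebra
begin

lemma matapp_ideal:
  "graded_ideal I \<Longrightarrow> (\<And>c. c < N \<Longrightarrow> x c \<in> I) \<Longrightarrow> matapp A N x r \<in> I"
  unfolding matapp_def by (intro ideal_sum ideal_mult) auto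

end

section \<open>Chain maps that are null-homotopic vanish modulo the irrelevant ideal\<close>

locale resolution = graded_algebra emb Rg
  for emb :: "'k::field \<Rightarrow> 'r::comm_ring_1" and Rg +
  fixes I :: "'r set" and act :: "'r \<Rightarrow> 'm::ab_group_add \<Rightarrow> 'm" and Mg n deg d gen
  assumes M: "graded_module emb Rg act Mg" and I: "graded_ideal I"
    and I_irrelevant: "\<And>x. x \<in> I \<Longrightarrow> \<rho> 0 x = 0"
    and res: "minimal_graded_free_resolution Rg I act Mg n deg d gen"
begin

sublocale mod: module act using gm_module[OF M] .

text \<open>Treating the augmentation as the differential out of \<open>F 0\<close> makes exactness
  one statement for all positions.\<close>

definition cycle :: "nat \<Rightarrow> (nat \<Rightarrow> 'r) \<Rightarrow> bool" where
  "cycle i x \<longleftrightarrow> (case i of 0 \<Rightarrow> (\<Sum>c<n 0. act (x c) (gen c)) = 0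
     | Suc k \<Rightarrow> \<forall>r<n k. matapp (d k) (n (Suc k)) x r \<in> I)"

lemma cycle_0: "cycle 0 x \<longleftrightarrow> (\<Sum>c<n 0. act (x c) (gen c)) = 0"
  and cycle_Suc: "cycle (Suc k) x \<longleftrightarrow> (\<forall>r<n k. matapp (d k) (n (Suc k)) x r \<in> I)"
  unfolding cycle_def by simp_all

lemma surjective: "\<exists>x. m = (\<Sum>c<n 0. act (x c) (gen c))"
  and gen_mem: "c < n 0 \<Longrightarrow> gen c \<in> Mg (deg 0 c)"
  and d_mem: "r < n i \<Longrightarrow> c < n (Suc i) \<Longrightarrow> d i r c \<in> Rz Rg (deg (Suc i) c - deg i r)"
  and d_irrelevant: "r < n i \<Longrightarrow> c < n (Suc i) \<Longrightarrow> \<rho> 0 (d i r c) = 0"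
  using res unfolding minimal_graded_free_resolution_def irrelevant_ideal_iff by blast+

lemma exact_supported:
  assumes "vsupp (n i) x"
  shows "cycle i x \<longleftrightarrow> (\<exists>y. vsupp (n (Suc i)) y \<and> (\<forall>r<n i. x r - matapp (d i) (n (Suc i)) y r \<in> I))"
proof (cases i)
  case 0
  then show ?thesis
    using res assms unfolding minimal_graded_free_resolution_def 0 cycle_0 One_nat_def by blast
next
  case (Suc k)
  then show ?thesis
    using res assms unfolding minimal_graded_free_resolution_def Suc cycle_Suc by blast
qed

lemma cycle_cong:
  assumes "\<And>r. r < n i \<Longrightarrow> x r = y r"
  shows "cycle i x \<longleftrightarrow> cycle i y"
proof (cases i)
  case 0
  then show ?thesis using assms unfolding cycle_def by simp
next
  case (Suc k)
  then show ?thesis using assms matapp_cong[of "n (Suc k)" x y] unfolding cycle_def by simp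
qed

lemma exact: "cycle i x \<longleftrightarrow> (\<exists>y. \<forall>r<n i. x r - matapp (d i) (n (Suc i)) y r \<in> I)"
proof -
  define x' where "x' r = (if r < n i then x r else 0)" for r
  have "cycle i x \<longleftrightarrow> cycle i x'" by (rule cycle_cong) (simp add: x'_def)
  also have "\<dots> \<longleftrightarrow> (\<exists>y. vsupp (n (Suc i)) y \<and> (\<forall>r<n i. x' r - matapp (d i) (n (Suc i)) y r \<in> I))"
    by (rule exact_supported) (simp add: vsupp_def x'_def)
  also have "\<dots> \<longleftrightarrow> (\<exists>y. \<forall>r<n i. x r - matapp (d i) (n (Suc i)) y r \<in> I)" (is "?L = ?R")
  proof
    show "?L \<Longrightarrow> ?R" unfolding x'_def by auto
    assume ?R
    then obtain y where y: "\<And>r. r < n i \<Longrightarrow> x r - matapp (d i) (n (Suc i)) y r \<in> I" by blast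
    define y' where "y' c = (if c < n (Suc i) then y c else 0)" for c
    have "matapp (d i) (n (Suc i)) y' r = matapp (d i) (n (Suc i)) y r" for r
      by (rule matapp_cong) (simp add: y'_def)
    then have "vsupp (n (Suc i)) y' \<and> (\<forall>r<n i. x' r - matapp (d i) (n (Suc i)) y' r \<in> I)"
      using y unfolding vsupp_def y'_def x'_def by simp
    then show ?L by blast
  qed
  finally show ?thesis .
qed

lemma d_cycle: "cycle i (matapp (d i) (n (Suc i)) y)"
  unfolding exact using ideal_zero[OF I] by (intro exI[of _ y]) simp

lemma d_column_cycle:
  assumes "c < n (Suc i)"
  shows "cycle i (\<lambda>r. d i r c)"
proof -
  have "matapp (d i) (n (Suc i)) (\<lambda>k. if k = c then 1 else 0) = (\<lambda>r. d i r c)"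
    using matapp_unit[OF assms] by blast
  then show ?thesis using d_cycle[of i "\<lambda>k. if k = c then 1 else 0"] by simp
qed

text \<open>A null-homotopy is built degree by degree: \<open>X i \<equiv> d h + k\<close> with \<open>k\<close> the part \<open>h d\<close> coming
  from the previous degree, so that minimality of \<open>d\<close> forces the entries of \<open>X i\<close> into the
  irrelevant ideal.\<close>

lemma null_homotopic_irrelevant:
  assumes X0: "\<And>x. cycle 0 (matapp (X 0) (n 0) x)"
    and chain: "\<And>i x r. r < n i \<Longrightarrow> matapp (d i) (n (Suc i)) (matapp (X (Suc i)) (n (Suc i)) x) r
       - matapp (X i) (n i) (matapp (d i) (n (Suc i)) x) r \<in> I"
    and rc: "r < n i" "c < n i"
  shows "\<rho> 0 (X i r c) = 0"
proof -
  \<comment> \<open>The second clause is kept because \<open>k\<close> is later applied to a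
    boundary, where it has to vanish modulo \<open>I\<close>; the third is what lets exactness
    provide the next piece of the homotopy column by column.\<close>
  define good where "good i k \<longleftrightarrow> (\<forall>r<n i. \<forall>c<n i. \<rho> 0 (k r c) = 0) \<and>
     (\<forall>z. cycle i z \<longrightarrow> (\<forall>r<n i. matapp k (n i) z r \<in> I)) \<and>
     (\<forall>x. cycle i (\<lambda>r. matapp (X i) (n i) x r - matapp k (n i) x r))" for i k
  have columns: "\<exists>h. \<forall>c<n i. \<forall>r<n i. X i r c - k r c - matapp (d i) (n (Suc i)) (\<lambda>s. h s c) r \<in> I"
    if "good i k" for i k
  proof -
    have "\<exists>y. \<forall>r<n i. X i r c - k r c - matapp (d i) (n (Suc i)) y r \<in> I" if c: "c < n i" for c
    proof -
      have "cycle i (\<lambda>r. matapp (X i) (n i) (\<lambda>s. if s = c then 1 else 0) r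
          - matapp k (n i) (\<lambda>s. if s = c then 1 else 0) r)"
        using \<open>good i k\<close> unfolding good_def by blast
      then show ?thesis unfolding exact by (simp add: matapp_unit[OF c])
    qed
    then obtain y where "\<And>c r. c < n i \<Longrightarrow> r < n i \<Longrightarrow> X i r c - k r c - matapp (d i) (n (Suc i)) (y c) r \<in> I"
      by metis
    then show ?thesis by (intro exI[of _ "\<lambda>s c. y c s"]) simp
  qed
  have "\<exists>k. good i k"
  proof (induction i)
    case 0
    have "good 0 (\<lambda>r c. 0)" unfolding good_def using X0 ideal_zero[OF I] by simp
    then show ?case by blast
  next
    case (Suc i)
    then obtain k where k: "good i k" by blast
    obtain h where h: "\<And>c r. c < n i \<Longrightarrow> r < n i \<Longrightarrow>
        X i r c - k r c - matapp (d i) (n (Suc i)) (\<lambda>s. h s c) r \<in> I"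
      using columns[OF k] by blast
    define k' where "k' r c = matapp h (n i) (\<lambda>s. d i s c) r" for r c
    have k'_app: "matapp k' (n (Suc i)) x r = matapp h (n i) (matapp (d i) (n (Suc i)) x) r" for x r
      unfolding matapp_matapp k'_def by (simp add: matapp_def)
    have h_app: "matapp (X i) (n i) x r - matapp k (n i) x r - matapp (d i) (n (Suc i)) (matapp h (n i) x) r \<in> I"
      if r: "r < n i" for x r
    proof -
      have "matapp (X i) (n i) x r - matapp k (n i) x r - matapp (d i) (n (Suc i)) (matapp h (n i) x) r
          = (\<Sum>c<n i. x c * (X i r c - k r c - matapp (d i) (n (Suc i)) (\<lambda>s. h s c) r))"
        unfolding matapp_matapp
        by (simp add: matapp_def[of "X i"] matapp_def[of k] sum_subtractf right_diff_distrib mult.commute)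
      also have "\<dots> \<in> I" using h r by (intro ideal_sum[OF I] ideal_mult[OF I]) auto
      finally show ?thesis .
    qed
    have "good (Suc i) k'"
      unfolding good_def
    proof (intro conjI allI impI)
      fix r c assume "c < n (Suc i)"
      then show "\<rho> 0 (k' r c) = 0"
        unfolding k'_def matapp_def by (simp add: \<rho>_sum \<rho>0_mult d_irrelevant)
    next
      fix z r assume "cycle (Suc i) z"
      then show "matapp k' (n (Suc i)) z r \<in> I"
        unfolding k'_app by (intro matapp_ideal[OF I, of "n i"]) (simp add: cycle_Suc)
    next
      fix x
      show "cycle (Suc i) (\<lambda>r. matapp (X (Suc i)) (n (Suc i)) x r - matapp k' (n (Suc i)) x r)"
        unfolding cycle_Suc matapp_diff
      proof (intro allI impI)
        fix r assume r: "r < n i"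
        let ?dx = "matapp (d i) (n (Suc i)) x"
        have "matapp (d i) (n (Suc i)) (matapp k' (n (Suc i)) x) r
            = matapp (d i) (n (Suc i)) (matapp h (n i) ?dx) r"
          by (rule matapp_cong) (rule k'_app)
        then have "matapp (d i) (n (Suc i)) (matapp (X (Suc i)) (n (Suc i)) x) r
            - matapp (d i) (n (Suc i)) (matapp k' (n (Suc i)) x) r
          = (matapp (d i) (n (Suc i)) (matapp (X (Suc i)) (n (Suc i)) x) r - matapp (X i) (n i) ?dx r)
          + (matapp (X i) (n i) ?dx r - matapp k (n i) ?dx r - matapp (d i) (n (Suc i)) (matapp h (n i) ?dx) r)
          + matapp k (n i) ?dx r" by simp
        also have "\<dots> \<in> I"
        proof -
          have "matapp k (n i) ?dx r \<in> I" using k d_cycle[of i x] r unfolding good_def by blast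
          then show ?thesis
            by (rule ideal_add[OF I ideal_add[OF I chain[OF r, of x] h_app[OF r, of ?dx]]])
        qed
        finally show "matapp (d i) (n (Suc i)) (matapp (X (Suc i)) (n (Suc i)) x) r
            - matapp (d i) (n (Suc i)) (matapp k' (n (Suc i)) x) r \<in> I" .
      qed
    qed
    then show ?case by blast
  qed
  then obtain k where k: "good i k" by blast
  obtain h where h: "X i r c - k r c - matapp (d i) (n (Suc i)) (\<lambda>s. h s c) r \<in> I"
    using columns[OF k] rc by blast
  have "\<rho> 0 (k r c) = 0" using k rc unfolding good_def by blast
  moreover have "\<rho> 0 (matapp (d i) (n (Suc i)) (\<lambda>s. h s c) r) = 0"
    unfolding matapp_def using rc by (simp add: \<rho>_sum \<rho>0_mult d_irrelevant)
  ultimately show ?thesis using I_irrelevant[OF h] by (simp add: \<rho>_diff)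
qed

end

section \<open>Comparison of two minimal resolutions\<close>

definition (in graded_algebra) graded_matrix ::
  "nat \<Rightarrow> (nat \<Rightarrow> int) \<Rightarrow> nat \<Rightarrow> (nat \<Rightarrow> int) \<Rightarrow> (nat \<Rightarrow> nat \<Rightarrow> 'r) \<Rightarrow> bool" where
  "graded_matrix m e' n e A \<longleftrightarrow> (\<forall>r<m. \<forall>c<n. A r c \<in> Rz Rg (e c - e' r))"

locale two_resolutions =
  F: resolution emb Rg I act Mg n deg d gen + G: resolution emb Rg I act Mg n' deg' d' gen'
  for emb :: "'k::field \<Rightarrow> 'r::comm_ring_1" and Rg I
    and act :: "'r \<Rightarrow> 'm::ab_group_add \<Rightarrow> 'm" and Mg n deg d gen n' deg' d' gen'
begin

text \<open>\<open>\<phi>\<close> sends each column of \<open>d i\<close> to a cycle, and exactness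
  of the second resolution gives a preimage. Its homogeneous part of the right degree is again a
  preimage because \<open>I\<close> is graded, so the lift can be taken graded.\<close>

lemma lift_step:
  assumes gr: "F.graded_matrix (n' i) (deg' i) (n i) (deg i) \<phi>"
    and cyc: "\<And>x. F.cycle i x \<Longrightarrow> G.cycle i (matapp \<phi> (n i) x)"
  shows "\<exists>\<phi>'. (F.graded_matrix (n' (Suc i)) (deg' (Suc i)) (n (Suc i)) (deg (Suc i)) \<phi>' \<and>
      (\<forall>x. F.cycle (Suc i) x \<longrightarrow> G.cycle (Suc i) (matapp \<phi>' (n (Suc i)) x))) \<and>
      (\<forall>x. \<forall>r<n' i. matapp (d' i) (n' (Suc i)) (matapp \<phi>' (n (Suc i)) x) r
        - matapp \<phi> (n i) (matapp (d i) (n (Suc i)) x) r \<in> I)"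
proof -
  have "\<exists>y. \<forall>r<n' i. matapp \<phi> (n i) (\<lambda>s. d i s c) r - matapp (d' i) (n' (Suc i)) y r \<in> I"
    if "c < n (Suc i)" for c
    using cyc[OF F.d_column_cycle[OF that]] unfolding G.exact .
  then obtain y where y: "\<And>c r. c < n (Suc i) \<Longrightarrow> r < n' i \<Longrightarrow>
      matapp \<phi> (n i) (\<lambda>s. d i s c) r - matapp (d' i) (n' (Suc i)) (y c) r \<in> I" by metis
  define \<phi>' where "\<phi>' s c = F.\<rho> (deg (Suc i) c - deg' (Suc i) s) (y c s)" for s c
  have cols: "matapp \<phi> (n i) (\<lambda>s. d i s c) r - matapp (d' i) (n' (Suc i)) (\<lambda>s. \<phi>' s c) r \<in> I"
    if c: "c < n (Suc i)" and r: "r < n' i" for c r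
  proof -
    let ?j = "deg (Suc i) c - deg' i r"
    have "\<phi> r s * d i s c \<in> Rz Rg ?j" if "s < n i" for s
    proof -
      have "\<phi> r s \<in> Rz Rg (deg i s - deg' i r)" using gr r that unfolding F.graded_matrix_def by blast
      from F.Rz_mult[OF this F.d_mem[OF that c]] show ?thesis by simp
    qed
    then have "matapp \<phi> (n i) (\<lambda>s. d i s c) r \<in> Rz Rg ?j"
      unfolding matapp_def by (intro F.Rz_sum) auto
    then have 1: "F.\<rho> ?j (matapp \<phi> (n i) (\<lambda>s. d i s c) r) = matapp \<phi> (n i) (\<lambda>s. d i s c) r"
      using F.\<rho>_homogeneous by simp
    have 2: "F.\<rho> ?j (matapp (d' i) (n' (Suc i)) (y c) r) = matapp (d' i) (n' (Suc i)) (\<lambda>s. \<phi>' s c) r"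
      unfolding matapp_def F.\<rho>_sum
    proof (rule sum.cong)
      fix s assume "s \<in> {..<n' (Suc i)}"
      then have "d' i r s \<in> Rz Rg (deg' (Suc i) s - deg' i r)" using G.d_mem[OF r] by blast
      from F.\<rho>_mult[OF this, of ?j "y c s"]
      show "F.\<rho> ?j (d' i r s * y c s) = d' i r s * \<phi>' s c" unfolding \<phi>'_def by simp
    qed simp
    show ?thesis using F.ideal_proj[OF F.I y[OF c r], of ?j] unfolding F.\<rho>_diff 1 2 .
  qed
  have chain: "matapp (d' i) (n' (Suc i)) (matapp \<phi>' (n (Suc i)) x) r
        - matapp \<phi> (n i) (matapp (d i) (n (Suc i)) x) r \<in> I" if r: "r < n' i" for x r
  proof -
    have "matapp (d' i) (n' (Suc i)) (matapp \<phi>' (n (Suc i)) x) r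
        - matapp \<phi> (n i) (matapp (d i) (n (Suc i)) x) r
      = (\<Sum>c<n (Suc i). - x c * (matapp \<phi> (n i) (\<lambda>s. d i s c) r - matapp (d' i) (n' (Suc i)) (\<lambda>s. \<phi>' s c) r))"
      unfolding matapp_matapp sum_subtractf[symmetric] by (intro sum.cong) (simp_all add: algebra_simps)
    also have "\<dots> \<in> I" using cols r by (intro F.ideal_sum[OF F.I] F.ideal_mult[OF F.I]) auto
    finally show ?thesis .
  qed
  have "G.cycle (Suc i) (matapp \<phi>' (n (Suc i)) x)" if x: "F.cycle (Suc i) x" for x
    unfolding G.cycle_Suc
  proof (intro allI impI)
    fix r assume r: "r < n' i"
    have "matapp \<phi> (n i) (matapp (d i) (n (Suc i)) x) r \<in> I"
      by (rule F.matapp_ideal[OF F.I]) (use x in \<open>simp add: F.cycle_Suc\<close>)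
    from F.ideal_add[OF F.I chain[OF r, of x] this]
    show "matapp (d' i) (n' (Suc i)) (matapp \<phi>' (n (Suc i)) x) r \<in> I" by simp
  qed
  moreover have "F.graded_matrix (n' (Suc i)) (deg' (Suc i)) (n (Suc i)) (deg (Suc i)) \<phi>'"
    unfolding F.graded_matrix_def \<phi>'_def using F.\<rho>_mem by blast
  ultimately show ?thesis using chain by blast
qed

lemma augmentation_matapp:
  assumes "\<And>c. c < n 0 \<Longrightarrow> gen c = (\<Sum>r<n' 0. act (A r c) (gen' r))"
  shows "(\<Sum>r<n' 0. act (matapp A (n 0) x r) (gen' r)) = (\<Sum>c<n 0. act (x c) (gen c))"
proof -
  have "(\<Sum>c<n 0. act (x c) (gen c)) = (\<Sum>c<n 0. \<Sum>r<n' 0. act (x c * A r c) (gen' r))"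
    using assms by (simp add: F.mod.scale_sum_right)
  also have "\<dots> = (\<Sum>r<n' 0. \<Sum>c<n 0. act (x c * A r c) (gen' r))" by (rule sum.swap)
  also have "\<dots> = (\<Sum>r<n' 0. act (matapp A (n 0) x r) (gen' r))"
    by (simp add: matapp_def F.mod.scale_sum_left mult.commute)
  finally show ?thesis by simp
qed

theorem comparison_map:
  "\<exists>\<phi>. (\<forall>i. F.graded_matrix (n' i) (deg' i) (n i) (deg i) (\<phi> i)) \<and>
    (\<forall>i x. \<forall>r<n' i. matapp (d' i) (n' (Suc i)) (matapp (\<phi> (Suc i)) (n (Suc i)) x) r
        - matapp (\<phi> i) (n i) (matapp (d i) (n (Suc i)) x) r \<in> I) \<and>
    (\<forall>c<n 0. gen c = (\<Sum>r<n' 0. act (\<phi> 0 r c) (gen' r)))"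
proof -
  interpret M: graded_algebra_module emb Rg act UNIV "gcomp Mg"
    using graded_on_gcomp[OF F.R F.M] F.R by (intro graded_algebra_module.intro graded_algebra.intro)
  have "\<forall>c. \<exists>x. gen c = (\<Sum>r<n' 0. act (x r) (gen' r))" using G.surjective by blast
  then obtain u where u: "\<And>c. gen c = (\<Sum>r<n' 0. act (u c r) (gen' r))" by metis
  define \<phi>0 where "\<phi>0 r c = F.\<rho> (deg 0 c - deg' 0 r) (u c r)" for r c
  have \<phi>0: "gen c = (\<Sum>r<n' 0. act (\<phi>0 r c) (gen' r))" if c: "c < n 0" for c
  proof -
    have "gen c = gcomp Mg (deg 0 c) (gen c)"
      using gcomp_homogeneous[OF F.R F.M F.gen_mem[OF c]] by simp
    also have "\<dots> = (\<Sum>r<n' 0. gcomp Mg (deg 0 c) (act (u c r) (gen' r)))"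
      by (subst u) (simp add: M.proj_sum)
    also have "\<dots> = (\<Sum>r<n' 0. act (\<phi>0 r c) (gen' r))"
    proof (rule sum.cong)
      fix r assume "r \<in> {..<n' 0}"
      then have "gcomp Mg (deg' 0 r) (gen' r) = gen' r"
        using gcomp_homogeneous[OF F.R F.M G.gen_mem[of r]] by simp
      then show "gcomp Mg (deg 0 c) (act (u c r) (gen' r)) = act (\<phi>0 r c) (gen' r)"
        unfolding \<phi>0_def by (intro M.proj_act_homogeneous) auto
    qed simp
    finally show ?thesis .
  qed
  let ?P = "\<lambda>i \<phi>. (F.graded_matrix (n' i) (deg' i) (n i) (deg i) \<phi> \<and>
      (\<forall>x. F.cycle i x \<longrightarrow> G.cycle i (matapp \<phi> (n i) x))) \<and> (i = 0 \<longrightarrow> \<phi> = \<phi>0)"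
  let ?Q = "\<lambda>i \<phi> \<phi>'. \<forall>x. \<forall>r<n' i. matapp (d' i) (n' (Suc i)) (matapp \<phi>' (n (Suc i)) x) r
        - matapp \<phi> (n i) (matapp (d i) (n (Suc i)) x) r \<in> I"
  have "\<exists>\<phi>. \<forall>i. ?P i (\<phi> i) \<and> ?Q i (\<phi> i) (\<phi> (Suc i))"
  proof (rule dependent_nat_choice)
    have "F.graded_matrix (n' 0) (deg' 0) (n 0) (deg 0) \<phi>0"
      unfolding F.graded_matrix_def \<phi>0_def using F.\<rho>_mem by blast
    then show "\<exists>\<phi>. ?P 0 \<phi>"
      using augmentation_matapp[OF \<phi>0] unfolding F.cycle_0 G.cycle_0 by (intro exI[of _ \<phi>0]) simp
  next
    fix \<phi> i assume "?P i \<phi>"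
    then show "\<exists>\<phi>'. ?P (Suc i) \<phi>' \<and> ?Q i \<phi> \<phi>'"
      using lift_step[of i \<phi>] by (simp only: nat.distinct simp_thms)
  qed
  then obtain \<phi> where \<phi>: "\<forall>i. ?P i (\<phi> i) \<and> ?Q i (\<phi> i) (\<phi> (Suc i))" by (rule exE)
  then have "\<phi> 0 = \<phi>0" by blast
  then show ?thesis using \<phi> \<phi>0 by (intro exI[of _ \<phi>]) simp
qed

text \<open>The composite of the comparison maps in both directions differs from the identity by a
  null-homotopic map, so it is the identity matrix modulo the irrelevant ideal. Graded entries
  respect the blocks of equal degree, and the block of degree \<open>j\<close> gives a retraction
  over \<open>k\<close>.\<close>

theorem betti_le: "card {c. c < n i \<and> deg i c = j} \<le> card {c. c < n' i \<and> deg' i c = j}"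
proof -
  interpret swap: two_resolutions emb Rg I act Mg n' deg' d' gen' n deg d gen ..
  obtain \<phi> where \<phi>: "\<And>i. F.graded_matrix (n' i) (deg' i) (n i) (deg i) (\<phi> i)"
    "\<And>i x r. r < n' i \<Longrightarrow> matapp (d' i) (n' (Suc i)) (matapp (\<phi> (Suc i)) (n (Suc i)) x) r
        - matapp (\<phi> i) (n i) (matapp (d i) (n (Suc i)) x) r \<in> I"
    "\<And>c. c < n 0 \<Longrightarrow> gen c = (\<Sum>r<n' 0. act (\<phi> 0 r c) (gen' r))"
    using comparison_map by blast
  obtain \<psi> where \<psi>: "\<And>i. F.graded_matrix (n i) (deg i) (n' i) (deg' i) (\<psi> i)"
    "\<And>i x r. r < n i \<Longrightarrow> matapp (d i) (n (Suc i)) (matapp (\<psi> (Suc i)) (n' (Suc i)) x) r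
        - matapp (\<psi> i) (n' i) (matapp (d' i) (n' (Suc i)) x) r \<in> I"
    "\<And>c. c < n' 0 \<Longrightarrow> gen' c = (\<Sum>r<n 0. act (\<psi> 0 r c) (gen r))"
    using swap.comparison_map by blast
  define X where "X i r c = matapp (\<psi> i) (n' i) (\<lambda>s. \<phi> i s c) r - (if c = r then 1 else 0)" for i r c
  have X_app: "matapp (X i) (n i) x r = matapp (\<psi> i) (n' i) (matapp (\<phi> i) (n i) x) r - x r"
    if "r < n i" for i x r
  proof -
    have "(\<Sum>c<n i. (if c = r then 1 else 0) * x c) = x r"
      using that by (simp add: if_distrib[of "\<lambda>t. t * x _"] cong: if_cong)
    then show ?thesis
      unfolding matapp_matapp by (simp add: matapp_def[of "X i"] X_def left_diff_distrib sum_subtractf)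
  qed
  have irr: "F.\<rho> 0 (X i r c) = 0" if "r < n i" "c < n i" for r c
  proof (rule F.null_homotopic_irrelevant[OF _ _ that])
    fix x
    have "(\<Sum>c<n 0. act (matapp (X 0) (n 0) x c) (gen c))
      = (\<Sum>c<n 0. act (matapp (\<psi> 0) (n' 0) (matapp (\<phi> 0) (n 0) x) c) (gen c)) - (\<Sum>c<n 0. act (x c) (gen c))"
      by (simp add: X_app F.mod.scale_left_diff_distrib sum_subtractf)
    then show "F.cycle 0 (matapp (X 0) (n 0) x)"
      unfolding F.cycle_0
      using swap.augmentation_matapp[OF \<psi>(3), of "matapp (\<phi> 0) (n 0) x"] augmentation_matapp[OF \<phi>(3), of x]
      by simp
  next
    fix i x r assume r: "r < n i"
    let ?dx = "matapp (d i) (n (Suc i)) x" and ?\<phi>x = "matapp (\<phi> (Suc i)) (n (Suc i)) x"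
    have "matapp (d i) (n (Suc i)) (matapp (X (Suc i)) (n (Suc i)) x) r
      = matapp (d i) (n (Suc i)) (\<lambda>s. matapp (\<psi> (Suc i)) (n' (Suc i)) ?\<phi>x s - x s) r"
      by (rule matapp_cong) (rule X_app)
    then have "matapp (d i) (n (Suc i)) (matapp (X (Suc i)) (n (Suc i)) x) r - matapp (X i) (n i) ?dx r
      = (matapp (d i) (n (Suc i)) (matapp (\<psi> (Suc i)) (n' (Suc i)) ?\<phi>x) r
          - matapp (\<psi> i) (n' i) (matapp (d' i) (n' (Suc i)) ?\<phi>x) r)
        + matapp (\<psi> i) (n' i) (\<lambda>s. matapp (d' i) (n' (Suc i)) ?\<phi>x s - matapp (\<phi> i) (n i) ?dx s) r"
      unfolding X_app[OF r] matapp_diff by simp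
    also have "\<dots> \<in> I"
      by (rule F.ideal_add[OF F.I \<psi>(2)[OF r] F.matapp_ideal[OF F.I]]) (rule \<phi>(2))
    finally show "matapp (d i) (n (Suc i)) (matapp (X (Suc i)) (n (Suc i)) x) r
       - matapp (X i) (n i) ?dx r \<in> I" .
  qed
  let ?A = "{c. c < n i \<and> deg i c = j}" and ?B = "{c. c < n' i \<and> deg' i c = j}"
  \<comment> \<open>The residues lie in the copy of \<open>k\<close> inside \<open>R\<close>; they
    are pulled back to \<open>k\<close>, where dimensions can be compared.\<close>
  have inv: "emb (inv emb (F.\<rho> 0 y)) = F.\<rho> 0 y" for y
    using F.\<rho>_mem[of 0 y] F.Rz_0 by (simp add: f_inv_into_f)
  show ?thesis
  proof (rule card_le_of_matrix_retract)
    fix a a' assume a: "a \<in> ?A" and a': "a' \<in> ?A"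
    \<comment> \<open>An entry between basis elements of different degrees is homogeneous of nonzero
      degree, so it has no residue.\<close>
    have z: "F.\<rho> 0 (\<psi> i a s) = 0" if "s < n' i" "deg' i s \<noteq> j" for s
    proof -
      have "\<psi> i a s \<in> Rz Rg (deg' i s - deg i a)" using \<psi>(1)[of i] a that unfolding F.graded_matrix_def by blast
      then show ?thesis using F.\<rho>_homogeneous[of _ _ 0] a that by auto
    qed
    have "F.\<rho> 0 (matapp (\<psi> i) (n' i) (\<lambda>s. \<phi> i s a') a) = F.\<rho> 0 (if a' = a then 1 else 0)"
      using irr[of a a'] a a' unfolding X_def F.\<rho>_diff by auto
    also have "\<dots> = (if a = a' then 1 else 0)"
      using F.\<rho>_homogeneous[OF F.one_mem, of 0] by auto
    finally have "(\<Sum>s<n' i. F.\<rho> 0 (\<psi> i a s) * F.\<rho> 0 (\<phi> i s a')) = (if a = a' then 1 else 0)"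
      unfolding matapp_def F.\<rho>_sum F.\<rho>0_mult .
    moreover have "(\<Sum>s<n' i. F.\<rho> 0 (\<psi> i a s) * F.\<rho> 0 (\<phi> i s a')) = (\<Sum>s\<in>?B. F.\<rho> 0 (\<psi> i a s) * F.\<rho> 0 (\<phi> i s a'))"
      using z by (intro sum.mono_neutral_right) auto
    moreover have "emb (\<Sum>s\<in>?B. inv emb (F.\<rho> 0 (\<psi> i a s)) * inv emb (F.\<rho> 0 (\<phi> i s a')))
        = (\<Sum>s\<in>?B. F.\<rho> 0 (\<psi> i a s) * F.\<rho> 0 (\<phi> i s a'))"
    proof -
      have emb_sum: "emb (sum f S) = (\<Sum>s\<in>S. emb (f s))" if "finite S" for f and S :: "nat set"
        using that by (induction S) (use sga_diff[OF F.R, of 0 0] in \<open>auto simp: sga_add[OF F.R]\<close>)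
      show ?thesis by (simp add: emb_sum sga_mult[OF F.R] inv)
    qed
    ultimately have "emb (\<Sum>s\<in>?B. inv emb (F.\<rho> 0 (\<psi> i a s)) * inv emb (F.\<rho> 0 (\<phi> i s a')))
        = emb (if a = a' then 1 else 0)"
      using sga_one[OF F.R] sga_diff[OF F.R, of 0 0] by auto
    then show "(\<Sum>s\<in>?B. inv emb (F.\<rho> 0 (\<psi> i a s)) * inv emb (F.\<rho> 0 (\<phi> i s a'))) = (if a = a' then 1 else 0)"
      using injD[OF sga_inj[OF F.R]] by blast
  qed simp_all
qed

end

text \<open>The resolution at hand shows that the choice in \<open>graded_betti\<close> is made
  among actual resolutions; the inequality in both directions then makes the chosen one
  irrelevant.\<close>

theorem (in resolution) graded_betti_eq:
  "graded_betti Rg I act Mg i j = card {c. c < n i \<and> deg i c = j}"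
proof -
  let ?P = "\<lambda>b. \<exists>n deg d gen. minimal_graded_free_resolution Rg I act Mg n deg d gen \<and>
        (\<forall>i j. b i j = card {c. c < n i \<and> deg i c = j})"
  have "?P (\<lambda>i j. card {c. c < n i \<and> deg i c = j})" using res by blast
  then have "?P (graded_betti Rg I act Mg)" unfolding graded_betti_def by (rule someI[of ?P])
  then obtain n' deg' d' gen' where res': "minimal_graded_free_resolution Rg I act Mg n' deg' d' gen'"
    and eq: "graded_betti Rg I act Mg i j = card {c. c < n' i \<and> deg' i c = j}" by blast
  interpret G: resolution emb Rg I act Mg n' deg' d' gen'
    using M I I_irrelevant res' by unfold_locales
  interpret FG: two_resolutions emb Rg I act Mg n deg d gen n' deg' d' gen' ..
  interpret GF: two_resolutions emb Rg I act Mg n' deg' d' gen' n deg d gen ..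
  show ?thesis unfolding eq using FG.betti_le[of i j] GF.betti_le[of i j] by simp
qed

section \<open>The resolution over the ambient ring\<close>

locale exact_pair_resolution =
  resolution emb Rg "range (\<lambda>r. a * r)" act Mg n deg d gen
  for emb :: "'k::field \<Rightarrow> 'r::comm_ring_1" and Rg a
    and act :: "'r \<Rightarrow> 'm::ab_group_add \<Rightarrow> 'm" and Mg n deg d gen +
  fixes b :: 'r
  assumes a1: "a \<in> Rg 1" and b1: "b \<in> Rg 1" and ab: "exact_zero_divisor_pair a b"
begin

lemma mem_ideal_iff: "x \<in> range (\<lambda>r. a * r) \<longleftrightarrow> a dvd x"
  by (auto simp: dvd_def)

text \<open>The differential of the periodic resolution of \<open>R/aR\<close> from index
  \<open>l\<close> to index \<open>l - 1\<close>, for positive \<open>l\<close>.\<close>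

definition zd :: "nat \<Rightarrow> 'r" where "zd l = (if odd l then a else b)"

lemma zd_1 [simp]: "zd (Suc 0) = a"
  by (simp add: zd_def)

lemma zd_mem: "zd l \<in> Rz Rg 1"
  unfolding zd_def using Rg_Rz[OF a1] Rg_Rz[OF b1] by simp

lemma zd_annihilator: "zd l * y = 0 \<longleftrightarrow> zd (Suc l) dvd y"
proof -
  have "{x. x * a = 0} = range (\<lambda>r. b * r)" "{x. x * b = 0} = range (\<lambda>r. a * r)"
    using ab unfolding exact_zero_divisor_pair_def by blast+
  then have "y * a = 0 \<longleftrightarrow> b dvd y" "y * b = 0 \<longleftrightarrow> a dvd y" by (auto simp: dvd_def)
  then show ?thesis by (simp add: zd_def mult.commute)
qed

text \<open>Membership in the degree \<open>e\<close> part of the irrelevant ideal.\<close>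

definition irr :: "int \<Rightarrow> 'r \<Rightarrow> bool" where
  "irr e x \<longleftrightarrow> x \<in> Rz Rg e \<and> (e < 1 \<longrightarrow> x = 0)"

lemma irr_0: "irr e x \<Longrightarrow> \<rho> 0 x = 0"
  unfolding irr_def using \<rho>_homogeneous[of x e 0] by (cases "e < 1") auto

lemma irrI:
  assumes "x \<in> Rz Rg e" "\<rho> 0 x = 0"
  shows "irr e x"
  unfolding irr_def
proof (intro conjI impI assms(1))
  assume "e < 1"
  then consider "e < 0" | "e = 0" by linarith
  then show "x = 0"
    using Rz_neg[OF _ assms(1)] \<rho>_homogeneous[OF assms(1), of 0] assms(2) by cases auto
qed

lemma irr_mult:
  assumes "irr e x" "irr e' y"
  shows "x * y \<in> Rz Rg (e + e')" "e + e' < 2 \<Longrightarrow> x * y = 0"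
  using assms Rz_mult unfolding irr_def by auto

text \<open>Any quotient may be replaced by its component of degree \<open>e\<close>. Below degree 1
  this component could be a unit, but there \<open>y\<close> is 0 and the quotient 0 is taken, so
  minimality survives.\<close>

lemma divide_zd:
  assumes y: "y \<in> Rz Rg (e + 1)" "e < 1 \<Longrightarrow> y = 0" "zd l dvd y"
  shows "\<exists>z. irr e z \<and> zd l * z = y"
proof (cases "e < 1")
  case True
  then show ?thesis using y by (intro exI[of _ 0]) (simp add: irr_def)
next
  case False
  obtain w where w: "y = zd l * w" using y(3) by (auto simp: dvd_def)
  have "y = \<rho> (e + 1) y" using \<rho>_homogeneous[OF y(1), of "e + 1"] by simp
  also have "\<dots> = zd l * \<rho> e w" unfolding w using \<rho>_mult[OF zd_mem, of "e + 1" l w] by simp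
  finally have "zd l * \<rho> e w = y" by simp
  moreover have "irr e (\<rho> e w)" unfolding irr_def using \<rho>_mem False by simp
  ultimately show ?thesis by blast
qed

section \<open>Construction of the total differential\<close>

definition basis :: "nat \<Rightarrow> (nat \<times> nat) set" where
  "basis i = (SIGMA q:{..i}. {..<n q})"

lemma finite_basis [simp]: "finite (basis i)"
  unfolding basis_def by simp

lemma mem_basis: "p \<in> basis i \<longleftrightarrow> fst p \<le> i \<and> snd p < n (fst p)"
  unfolding basis_def by (cases p) auto

text \<open>Over index \<open>l = i - q\<close> the basis element has degree
  \<open>deg q c + (i - q)\<close>. Removing the total degree \<open>i\<close> makes the quantity
  independent of \<open>i\<close>, so an entry from \<open>p\<close> to \<open>p'\<close> has degree
  \<open>\<delta> p - \<delta> p' + 1\<close> at every level.\<close>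

definition \<delta> :: "nat \<times> nat \<Rightarrow> int" where
  "\<delta> p = deg (fst p) (snd p) - int (fst p)"

text \<open>The entry of the squared differential in row \<open>p'\<close> without the summand
  \<open>s = p'\<close>, which is \<open>zd (Suc l) * T (Suc l) p' p\<close> and carries the
  unknown. As \<open>fst p' < fst s\<close>, the second factor has level at most \<open>l\<close>,
  and the recursion over levels is well-founded.\<close>

definition upper_sum :: "(nat \<Rightarrow> nat \<times> nat \<Rightarrow> nat \<times> nat \<Rightarrow> 'r) \<Rightarrow> nat \<Rightarrow> nat \<times> nat \<Rightarrow> nat \<times> nat \<Rightarrow> 'r" where
  "upper_sum T l p' p = (\<Sum>s\<in>{s \<in> basis (fst p' + l + 1). fst p' < fst s}.
      T l p' s * T (fst p' + l + 1 - fst s) s p)"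

text \<open>A pair \<open>(q, c)\<close> stands for the basis element \<open>c\<close> of \<open>F q\<close>.  In total degree \<open>i\<close> it sits over the
  term of index \<open>l = i - q\<close> of the periodic resolution, so its internal degree is \<open>\<delta> (q, c) + i\<close>.
  \<open>T l p' p\<close> is the entry of the total differential in the row of \<open>p'\<close> at index \<open>l\<close>; the
  index of its column \<open>p\<close> is determined by the total degree.  The last clause says that the
  differential squares to zero, and is solved for level \<open>l\<close> by dividing by \<open>zd l\<close>.\<close>

definition level_spec :: "(nat \<Rightarrow> nat \<times> nat \<Rightarrow> nat \<times> nat \<Rightarrow> 'r) \<Rightarrow> nat \<Rightarrow> (nat \<times> nat \<Rightarrow> nat \<times> nat \<Rightarrow> 'r) \<Rightarrow> bool" where
  "level_spec T l t \<longleftrightarrow>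
     (\<forall>p. t p p = zd (Suc l)) \<and>
     (\<forall>p' p. fst p \<le> fst p' \<longrightarrow> p \<noteq> p' \<longrightarrow> t p' p = 0) \<and>
     (\<forall>p' p. snd p' < n (fst p') \<longrightarrow> snd p < n (fst p) \<longrightarrow> fst p \<le> fst p' + l + 1 \<longrightarrow>
        irr (\<delta> p - \<delta> p' + 1) (t p' p)) \<and>
     (l = 0 \<longrightarrow> (\<forall>q r c. t (q, r) (Suc q, c) = d q r c)) \<and>
     (\<forall>k. l = Suc k \<longrightarrow> (\<forall>p' p. snd p' < n (fst p') \<longrightarrow> snd p < n (fst p) \<longrightarrow>
        fst p' < fst p \<longrightarrow> fst p \<le> fst p' + k + 2 \<longrightarrow> zd (Suc k) * t p' p + upper_sum T k p' p = 0))"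

lemma
  assumes "level_spec T l t"
  shows level_diag: "t p p = zd (Suc l)"
    and level_lower: "fst p \<le> fst p' \<Longrightarrow> p \<noteq> p' \<Longrightarrow> t p' p = 0"
    and level_irr: "\<lbrakk>snd p' < n (fst p'); snd p < n (fst p); fst p \<le> fst p' + l + 1\<rbrakk> \<Longrightarrow>
      irr (\<delta> p - \<delta> p' + 1) (t p' p)"
    and level_0: "l = 0 \<Longrightarrow> t (q, r) (Suc q, c) = d q r c"
    and level_Suc: "\<lbrakk>l = Suc k; snd p' < n (fst p'); snd p < n (fst p); fst p' < fst p; fst p \<le> fst p' + k + 2\<rbrakk> \<Longrightarrow>
      zd (Suc k) * t p' p + upper_sum T k p' p = 0"
  using assms unfolding level_spec_def by blast+

lemma level_lower_less:
  assumes "level_spec T l t" "fst p < fst p'"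
  shows "t p' p = 0"
  using assms(2) by (intro level_lower[OF assms(1)]) auto

text \<open>For \<open>fst p' < fst p\<close> this is the relation imposed on level
  \<open>Suc l\<close>; otherwise triangularity leaves at most the diagonal, the product of two
  consecutive periodic differentials, which is 0 for a pair of zero divisors.\<close>

lemma level_square_zero:
  assumes spec: "\<And>k. k \<le> Suc l \<Longrightarrow> level_spec T k (T k)"
    and p': "snd p' < n (fst p')" and p: "p \<in> basis (fst p' + l + 2)"
  shows "(\<Sum>s\<in>basis (fst p' + l + 1). T l p' s * T (fst p' + l + 1 - fst s) s p) = 0"
proof -
  let ?f = "\<lambda>s. T l p' s * T (fst p' + l + 1 - fst s) s p"
  let ?U = "{s \<in> basis (fst p' + l + 1). fst p' < fst s}"
  have sl: "level_spec T l (T l)" using spec by simp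
  have "T l p' s = 0" if "s \<in> basis (fst p' + l + 1) - insert p' ?U" for s
    using level_lower[OF sl, of s p'] that by auto
  then have "sum ?f (basis (fst p' + l + 1)) = sum ?f (insert p' ?U)"
    using p' by (intro sum.mono_neutral_right ballI) (auto simp: mem_basis)
  also have "\<dots> = zd (Suc l) * T (Suc l) p' p + upper_sum T l p' p"
    unfolding upper_sum_def by (subst sum.insert) (auto simp: level_diag[OF sl])
  also have "\<dots> = 0"
  proof (cases "fst p' < fst p")
    case True
    then show ?thesis using level_Suc[OF spec[of "Suc l"] refl p'] p by (simp add: mem_basis)
  next
    case False
    have "upper_sum T l p' p = 0"
      unfolding upper_sum_def
    proof (intro sum.neutral ballI)
      fix s assume s: "s \<in> ?U"
      have "level_spec T (fst p' + l + 1 - fst s) (T (fst p' + l + 1 - fst s))"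
        using s by (intro spec) auto
      then have "T (fst p' + l + 1 - fst s) s p = 0"
        by (rule level_lower_less) (use False s in simp)
      then show "?f s = 0" by simp
    qed
    moreover have "zd (Suc l) * T (Suc l) p' p = 0"
    proof (cases "p = p'")
      case True
      then show ?thesis using level_diag[OF spec[of "Suc l"]] zd_annihilator[of "Suc l"] by simp
    next
      case neq: False
      then show ?thesis using level_lower[OF spec[of "Suc l"]] False by simp
    qed
    ultimately show ?thesis by simp
  qed
  finally show ?thesis .
qed

text \<open>The one division that does not come from the exact pair, since the periodic complex has
  homology at index 0. Either the second factor is a multiple of the diagonal entry
  \<open>a\<close>, or the sum is an entry of the product of two consecutive lifted matrices, and
  these compose to zero modulo \<open>a\<close>.\<close>

lemma upper_sum_0_dvd:
  assumes spec: "level_spec T 0 (T 0)"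
    and p': "snd p' < n (fst p')" and p: "snd p < n (fst p)" "fst p' < fst p" "fst p \<le> fst p' + 2"
  shows "a dvd upper_sum T 0 p' p"
proof -
  obtain q r where qr: "p' = (q, r)" by (cases p')
  have U: "{s \<in> basis (fst p' + 0 + 1). fst p' < fst s} = Pair (Suc q) ` {..<n (Suc q)}"
    by (auto simp: mem_basis qr le_Suc_eq)
  have eq: "upper_sum T 0 p' t = (\<Sum>c<n (Suc q). d q r c * T 0 (Suc q, c) t)" for t
    unfolding upper_sum_def U
    by (subst sum.reindex) (auto simp: inj_on_def qr level_0[OF spec])
  show ?thesis
  proof (cases "fst p = Suc q")
    case True
    have "a dvd T 0 (Suc q, c) p" for c
      using level_diag[OF spec, of p] level_lower[OF spec, of p "(Suc q, c)"] True
      by (cases "p = (Suc q, c)") auto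
    then show ?thesis unfolding eq by (intro dvd_sum) simp
  next
    case False
    then have "fst p = Suc (Suc q)" using p qr by simp
    then obtain c where c: "p = (Suc (Suc q), c)" "c < n (Suc (Suc q))" using p by (cases p) simp
    have "matapp (d q) (n (Suc q)) (\<lambda>s. d (Suc q) s c) r \<in> range (\<lambda>r. a * r)"
      using d_column_cycle[OF c(2)] p' unfolding cycle_Suc qr by simp
    then show ?thesis unfolding eq mem_ideal_iff matapp_def c(1) level_0[OF spec refl] .
  qed
qed

text \<open>By exactness of the pair it suffices that \<open>zd (Suc m)\<close> kills the sum; multiplying turns the first
  factor into an \<open>upper_sum\<close> one level below, and the square-zero relations of the lower rows apply.\<close>

lemma upper_sum_Suc_dvd:
  assumes spec: "\<And>k. k \<le> Suc m \<Longrightarrow> level_spec T k (T k)"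
    and p': "snd p' < n (fst p')" and p: "p \<in> basis (fst p' + m + 3)"
  shows "zd (Suc (Suc m)) dvd upper_sum T (Suc m) p' p"
proof -
  let ?q = "fst p'"
  let ?U = "{s \<in> basis (?q + Suc m + 1). ?q < fst s}" and ?V = "{s \<in> basis (?q + m + 1). ?q < fst s}"
  let ?g = "\<lambda>s. T (?q + Suc m + 1 - fst s) s p"
  have inner: "(\<Sum>s\<in>?U. T (?q + m + 1 - fst v) v s * ?g s) = 0" if v: "v \<in> ?V" for v
  proof -
    let ?l = "?q + m + 1 - fst v"
    have l: "fst v + ?l + 1 = ?q + Suc m + 1" "fst v + ?l + 2 = ?q + m + 3" "Suc ?l \<le> Suc m"
      using v by (auto simp: mem_basis)
    have "level_spec T ?l (T ?l)" using spec l(3) by simp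
    \<comment> \<open>By triangularity row \<open>v\<close> has no entries at \<open>s\<close> with
      \<open>fst s\<close> at most \<open>?q\<close>, so the restriction to \<open>?U\<close> costs
      nothing and the full square-zero relation of row \<open>v\<close> applies.\<close>
    then have "T ?l v s = 0" if "s \<in> basis (?q + Suc m + 1) - ?U" for s
      by (rule level_lower_less) (use that v in auto)
    then have "(\<Sum>s\<in>?U. T ?l v s * ?g s) = (\<Sum>s\<in>basis (?q + Suc m + 1). T ?l v s * ?g s)"
      by (intro sum.mono_neutral_left ballI) auto
    also have "\<dots> = 0"
      using level_square_zero[of ?l T v p] spec l v p unfolding l by (simp add: mem_basis)
    finally show ?thesis .
  qed
  have "zd (Suc m) * upper_sum T (Suc m) p' p = (\<Sum>s\<in>?U. (zd (Suc m) * T (Suc m) p' s) * ?g s)"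
    unfolding upper_sum_def sum_distrib_left by (simp add: mult.assoc)
  also have "\<dots> = (\<Sum>s\<in>?U. - upper_sum T m p' s * ?g s)"
  proof (rule sum.cong)
    fix s assume "s \<in> ?U"
    then have "zd (Suc m) * T (Suc m) p' s + upper_sum T m p' s = 0"
      using level_Suc[OF spec[of "Suc m"] refl p'] by (simp add: mem_basis)
    then have "zd (Suc m) * T (Suc m) p' s = - upper_sum T m p' s"
      by (simp only: eq_neg_iff_add_eq_0)
    then show "(zd (Suc m) * T (Suc m) p' s) * ?g s = - upper_sum T m p' s * ?g s"
      by (simp only:)
  qed simp
  also have "\<dots> = - (\<Sum>s\<in>?U. \<Sum>v\<in>?V. T m p' v * (T (?q + m + 1 - fst v) v s * ?g s))"
    unfolding upper_sum_def by (simp add: sum_distrib_right sum_negf mult.assoc)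
  also have "\<dots> = - (\<Sum>v\<in>?V. T m p' v * (\<Sum>s\<in>?U. T (?q + m + 1 - fst v) v s * ?g s))"
    unfolding sum_distrib_left by (subst sum.swap) simp
  also have "\<dots> = 0" using inner by simp
  finally show ?thesis unfolding zd_annihilator .
qed

text \<open>A nonzero product of two entries has degree at least 2, so the sum vanishes in every
  degree below 2. This is the low-degree condition that \<open>divide_zd\<close> asks for.\<close>

lemma upper_sum_mem:
  assumes spec: "\<And>k. k \<le> l \<Longrightarrow> level_spec T k (T k)"
    and p': "snd p' < n (fst p')" and p: "p \<in> basis (fst p' + l + 2)"
  shows "upper_sum T l p' p \<in> Rz Rg (\<delta> p - \<delta> p' + 2)"
    and "\<delta> p - \<delta> p' < 0 \<Longrightarrow> upper_sum T l p' p = 0"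
proof -
  have *: "irr (\<delta> s - \<delta> p' + 1) (T l p' s)"
    "irr (\<delta> p - \<delta> s + 1) (T (fst p' + l + 1 - fst s) s p)"
    if "s \<in> {s \<in> basis (fst p' + l + 1). fst p' < fst s}" for s
    using that level_irr[OF spec[of l] p', of s] p
      level_irr[OF spec[of "fst p' + l + 1 - fst s"], of s p] by (auto simp: mem_basis)
  have sum_eq: "(\<delta> s - \<delta> p' + 1) + (\<delta> p - \<delta> s + 1) = \<delta> p - \<delta> p' + 2" for s by simp
  show "upper_sum T l p' p \<in> Rz Rg (\<delta> p - \<delta> p' + 2)"
    unfolding upper_sum_def
  proof (rule Rz_sum)
    fix s assume "s \<in> {s \<in> basis (fst p' + l + 1). fst p' < fst s}"
    from irr_mult(1)[OF *[OF this]]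
    show "T l p' s * T (fst p' + l + 1 - fst s) s p \<in> Rz Rg (\<delta> p - \<delta> p' + 2)"
      unfolding sum_eq .
  qed
  show "upper_sum T l p' p = 0" if "\<delta> p - \<delta> p' < 0"
    unfolding upper_sum_def
  proof (intro sum.neutral ballI)
    fix s assume "s \<in> {s \<in> basis (fst p' + l + 1). fst p' < fst s}"
    from irr_mult(2)[OF *[OF this]] that
    show "T l p' s * T (fst p' + l + 1 - fst s) s p = 0" unfolding sum_eq by simp
  qed
qed

lemma level_exists:
  assumes spec: "\<And>k. k < l \<Longrightarrow> level_spec T k (T k)"
  shows "\<exists>t. level_spec T l t"
proof -
  let ?dom = "\<lambda>p' p. snd p' < n (fst p') \<and> snd p < n (fst p) \<and> fst p' < fst p \<and> fst p \<le> fst p' + l + 1"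
  define Q where "Q p' p z \<longleftrightarrow> (?dom p' p \<longrightarrow> irr (\<delta> p - \<delta> p' + 1) z \<and>
      (\<forall>k. l = Suc k \<longrightarrow> zd (Suc k) * z + upper_sum T k p' p = 0) \<and>
      (l = 0 \<longrightarrow> z = d (fst p') (snd p') (snd p)))" for p' p z
  have "\<exists>z. Q p' p z" for p' p
  proof (cases l)
    case 0
    have "irr (\<delta> p - \<delta> p' + 1) (d (fst p') (snd p') (snd p))" if "?dom p' p"
    proof -
      have q: "fst p = Suc (fst p')" using that 0 by simp
      then have "d (fst p') (snd p') (snd p) \<in> Rz Rg (\<delta> p - \<delta> p' + 1)"
        using d_mem[of "snd p'" "fst p'" "snd p"] that unfolding \<delta>_def q by simp
      then show ?thesis using d_irrelevant[of "snd p'" "fst p'" "snd p"] that q by (intro irrI) simp_all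
    qed
    then show ?thesis unfolding Q_def using 0 by auto
  next
    case (Suc k)
    have "\<exists>z. irr (\<delta> p - \<delta> p' + 1) z \<and> zd (Suc k) * z = - upper_sum T k p' p" if dom: "?dom p' p"
    proof (rule divide_zd)
      have spec': "level_spec T j (T j)" if "j \<le> k" for j using spec that Suc by simp
      have p': "snd p' < n (fst p')" and p: "p \<in> basis (fst p' + k + 2)"
        using dom Suc by (auto simp: mem_basis)
      note mem = upper_sum_mem[OF spec' p' p]
      show "- upper_sum T k p' p \<in> Rz Rg (\<delta> p - \<delta> p' + 1 + 1)"
        using Rz_diff[OF Rz_zero mem(1)] by (simp add: algebra_simps)
      show "- upper_sum T k p' p = 0" if "\<delta> p - \<delta> p' + 1 < 1" using mem(2) that by simp
      show "zd (Suc k) dvd - upper_sum T k p' p"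
      proof (cases k)
        case 0
        then show ?thesis using upper_sum_0_dvd[OF spec'[of 0] p'] dom Suc by simp
      next
        case (Suc m)
        then show ?thesis using upper_sum_Suc_dvd[of m T p' p] spec' p' p by (simp add: numeral_eq_Suc)
      qed
    qed
    then show ?thesis unfolding Q_def using Suc by (auto simp: eq_neg_iff_add_eq_0)
  qed
  then obtain z where zQ: "\<And>p' p. Q p' p (z p' p)" by metis
  then have z: "\<And>p' p. ?dom p' p \<Longrightarrow> irr (\<delta> p - \<delta> p' + 1) (z p' p)"
    "\<And>p' p k. ?dom p' p \<Longrightarrow> l = Suc k \<Longrightarrow> zd (Suc k) * z p' p + upper_sum T k p' p = 0"
    "\<And>p' p. ?dom p' p \<Longrightarrow> l = 0 \<Longrightarrow> z p' p = d (fst p') (snd p') (snd p)"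
    unfolding Q_def by blast+
  \<comment> \<open>\<open>level_spec\<close> prescribes \<open>d\<close> at level 0 for all index
    values, also beyond the ranks, while \<open>z\<close> is controlled only within them; hence the
    separate case.\<close>
  define t where "t p' p = (if p = p' then zd (Suc l) else if fst p \<le> fst p' then 0
      else if l = 0 \<and> fst p = Suc (fst p') then d (fst p') (snd p') (snd p) else z p' p)" for p' p
  have t_dom: "t p' p = z p' p" if "?dom p' p" for p' p
    using that z(3)[OF that] unfolding t_def by auto
  have "level_spec T l t"
    unfolding level_spec_def
  proof (intro conjI allI impI)
    fix p' p assume dom: "snd p' < n (fst p')" "snd p < n (fst p)" "fst p \<le> fst p' + l + 1"
    show "irr (\<delta> p - \<delta> p' + 1) (t p' p)"
    proof (cases "fst p' < fst p")
      case True
      then show ?thesis using dom z(1)[of p' p] t_dom[of p' p] by simp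
    next
      case False
      then show ?thesis using zd_mem[of "Suc l"] by (auto simp: t_def irr_def)
    qed
  next
    fix k p' p assume "l = Suc k" "snd p' < n (fst p')" "snd p < n (fst p)" "fst p' < fst p" "fst p \<le> fst p' + k + 2"
    then show "zd (Suc k) * t p' p + upper_sum T k p' p = 0"
      using z(2)[of p' p k] t_dom[of p' p] by simp
  qed (auto simp: t_def)
  then show ?thesis by blast
qed

text \<open>The condition on level \<open>l\<close> involves only lower levels of the family, so the
  levels can be chosen by well-founded recursion.\<close>

lemma total_differential_exists: "\<exists>T. \<forall>l. level_spec T l (T l)"
proof (rule dependent_wellorder_choice)
  fix t and f g :: "nat \<Rightarrow> nat \<times> nat \<Rightarrow> nat \<times> nat \<Rightarrow> 'r" and l :: nat assume eq: "\<And>k. k < l \<Longrightarrow> f k = g k"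
  have "upper_sum f k p' p = upper_sum g k p' p" if "l = Suc k" for k p' p
    unfolding upper_sum_def using eq that by (intro sum.cong) auto
  then show "level_spec f l t = level_spec g l t"
    unfolding level_spec_def by (cases l) auto
qed (rule level_exists)

section \<open>Exactness of the total complex\<close>

definition T :: "nat \<Rightarrow> nat \<times> nat \<Rightarrow> nat \<times> nat \<Rightarrow> 'r" where
  "T = (SOME T. \<forall>l. level_spec T l (T l))"

lemma T_spec: "level_spec T l (T l)"
  using someI_ex[OF total_differential_exists] unfolding T_def by blast

lemmas T_diag = level_diag[OF T_spec] and T_lower = level_lower[OF T_spec]
  and T_irr = level_irr[OF T_spec] and T_0 = level_0[OF T_spec refl]

definition D :: "nat \<Rightarrow> (nat \<times> nat \<Rightarrow> 'r) \<Rightarrow> nat \<times> nat \<Rightarrow> 'r" where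
  "D i v p' = (\<Sum>p\<in>basis (Suc i). T (i - fst p') p' p * v p)"

lemma D_add: "D i (\<lambda>p. v p + w p) p' = D i v p' + D i w p'"
  unfolding D_def by (simp add: distrib_left sum.distrib)

lemma D_diff: "D i (\<lambda>p. v p - w p) p' = D i v p' - D i w p'"
  unfolding D_def by (simp add: right_diff_distrib sum_subtractf)

lemma D_cong: "(\<And>p. p \<in> basis (Suc i) \<Longrightarrow> v p = w p) \<Longrightarrow> D i v p' = D i w p'"
  unfolding D_def by (intro sum.cong) auto

lemma D_D:
  assumes p': "p' \<in> basis i"
  shows "D i (D (Suc i) v) p' = 0"
proof -
  let ?l = "i - fst p'"
  have i: "fst p' + ?l + 1 = Suc i" "fst p' + ?l + 2 = Suc (Suc i)" using p' by (auto simp: mem_basis)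
  have "D i (D (Suc i) v) p' = (\<Sum>s\<in>basis (Suc i). \<Sum>p\<in>basis (Suc (Suc i)). T ?l p' s * T (Suc i - fst s) s p * v p)"
    unfolding D_def by (simp add: sum_distrib_left mult.assoc)
  also have "\<dots> = (\<Sum>p\<in>basis (Suc (Suc i)). (\<Sum>s\<in>basis (Suc i). T ?l p' s * T (Suc i - fst s) s p) * v p)"
    unfolding sum_distrib_right by (rule sum.swap)
  also have "\<dots> = 0"
    using level_square_zero[OF T_spec, of p' _ ?l] p' unfolding i by (simp add: mem_basis)
  finally show ?thesis .
qed

text \<open>At index 0 only the diagonal entry \<open>a\<close> and the matrix \<open>d i\<close>
  remain in the row. Through these rows the exactness of \<open>F\<close> modulo \<open>a\<close>
  enters.\<close>

lemma D_bottom_row: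
  assumes "c < n i"
  shows "D i v (i, c) = a * v (i, c) + matapp (d i) (n (Suc i)) (\<lambda>s. v (Suc i, s)) c"
proof -
  let ?f = "\<lambda>p. T 0 (i, c) p * v p"
  have split: "basis (Suc i) = basis i \<union> Pair (Suc i) ` {..<n (Suc i)}"
    by (auto simp: basis_def le_Suc_eq)
  have "D i v (i, c) = sum ?f (basis i) + sum ?f (Pair (Suc i) ` {..<n (Suc i)})"
    unfolding D_def split by (subst sum.union_disjoint) (auto simp: mem_basis)
  also have "sum ?f (basis i) = sum ?f {(i, c)}"
  proof (intro sum.mono_neutral_right ballI)
    fix p assume "p \<in> basis i - {(i, c)}"
    then show "?f p = 0" using T_lower[of p "(i, c)" 0] by (auto simp: mem_basis)
  qed (use assms in \<open>auto simp: mem_basis\<close>)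
  also have "sum ?f {(i, c)} = a * v (i, c)" by (simp add: T_diag)
  also have "sum ?f (Pair (Suc i) ` {..<n (Suc i)}) = matapp (d i) (n (Suc i)) (\<lambda>s. v (Suc i, s)) c"
    by (subst sum.reindex) (auto simp: inj_on_def T_0 matapp_def)
  finally show ?thesis .
qed

text \<open>Descent along the filtration by the position in \<open>F\<close>: the topmost part of
  the cycle is a cycle of the periodic complex at a positive index, hence a boundary there.
  Subtracting a total boundary moves the support one step down. The bound on \<open>m\<close>
  excludes index 0, where the periodic complex is not exact.\<close>

lemma D_exact_filtered:
  assumes "m \<le> Suc i" "\<And>p. p \<in> basis (Suc i) \<Longrightarrow> m \<le> fst p \<Longrightarrow> v p = 0"
    and "\<And>p. p \<in> basis i \<Longrightarrow> D i v p = 0"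
  shows "\<exists>w. \<forall>p\<in>basis (Suc i). v p = D (Suc i) w p"
  using assms
proof (induction m arbitrary: v)
  case 0
  then show ?case by (intro exI[of _ "\<lambda>_. 0"]) (simp add: D_def)
next
  case (Suc m)
  \<comment> \<open>Columns beyond \<open>m\<close> drop out by the support of \<open>v\<close>, the
    others except \<open>p\<close> by triangularity; what remains is the periodic differential at
    index \<open>Suc (i - m)\<close>.\<close>
  have "\<exists>w. v p = zd (Suc (Suc (i - m))) * w" if p: "p \<in> basis i" "fst p = m" for p
  proof -
    have "D i v p = (\<Sum>s\<in>{p}. T (i - m) p s * v s)"
      unfolding D_def p(2)
    proof (intro sum.mono_neutral_right ballI)
      fix s assume "s \<in> basis (Suc i) - {p}"
      then show "T (i - m) p s * v s = 0"
        using Suc.prems(2)[of s] T_lower[of s p "i - m"] p by (cases "Suc m \<le> fst s") auto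
    qed (use p in \<open>auto simp: mem_basis\<close>)
    then have "zd (Suc (i - m)) * v p = 0" using Suc.prems(3)[OF p(1)] by (simp add: T_diag)
    then show ?thesis unfolding zd_annihilator by (auto simp: dvd_def)
  qed
  then obtain u where u: "\<And>p. p \<in> basis i \<Longrightarrow> fst p = m \<Longrightarrow> v p = zd (Suc (Suc (i - m))) * u p"
    by metis
  define w where "w p = (if fst p = m then u p else 0)" for p
  have m: "m \<le> i" using Suc.prems by simp
  have top: "v p - D (Suc i) w p = 0" if p: "p \<in> basis (Suc i)" "m \<le> fst p" for p
  proof (cases "fst p = m")
    case True
    have "D (Suc i) w p = (\<Sum>s\<in>{p}. T (Suc i - m) p s * w s)"
      unfolding D_def True
    proof (intro sum.mono_neutral_right ballI)
      fix s assume "s \<in> basis (Suc (Suc i)) - {p}"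
      then show "T (Suc i - m) p s * w s = 0"
        using T_lower[of s p "Suc i - m"] True unfolding w_def by auto
    qed (use p in \<open>auto simp: mem_basis\<close>)
    also have "\<dots> = v p"
      using u[of p] True p m by (simp add: T_diag w_def mem_basis Suc_diff_le)
    finally show ?thesis by simp
  next
    case False
    have "D (Suc i) w p = 0"
      unfolding D_def
    proof (intro sum.neutral ballI)
      fix s
      show "T (Suc i - fst p) p s * w s = 0"
        using level_lower_less[OF T_spec, of s p "Suc i - fst p"] False p unfolding w_def
        by (cases "fst s = m") auto
    qed
    then show ?thesis using Suc.prems(2)[OF p(1)] False p by simp
  qed
  have "D i (\<lambda>p. v p - D (Suc i) w p) p = 0" if "p \<in> basis i" for p
    unfolding D_diff using Suc.prems(3)[OF that] D_D[OF that] by simp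
  then obtain w' where w': "\<forall>p\<in>basis (Suc i). v p - D (Suc i) w p = D (Suc i) w' p"
    using Suc.IH[of "\<lambda>p. v p - D (Suc i) w p"] top m by auto
  have "v p = D (Suc i) (\<lambda>p. w p + w' p) p" if "p \<in> basis (Suc i)" for p
    using w' that unfolding D_add by (simp add: algebra_simps)
  then show ?case by blast
qed

text \<open>The index 0 part of a cycle is a cycle of \<open>F\<close> modulo \<open>a\<close>, so
  exactness of \<open>F\<close> makes it a boundary up to a multiple of \<open>a\<close>.
  Subtracting a total boundary clears this part and leaves the situation of
  \<open>D_exact_filtered\<close>.\<close>

lemma D_exact:
  assumes v: "\<And>p. p \<in> basis i \<Longrightarrow> D i v p = 0"
  shows "\<exists>w. \<forall>p\<in>basis (Suc i). v p = D (Suc i) w p"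
proof -
  have "cycle (Suc i) (\<lambda>s. v (Suc i, s))"
    unfolding cycle_Suc mem_ideal_iff
  proof (intro allI impI)
    fix r assume r: "r < n i"
    have "a * v (i, r) + matapp (d i) (n (Suc i)) (\<lambda>s. v (Suc i, s)) r = 0"
      using v[of "(i, r)"] D_bottom_row[OF r, of v] r by (simp add: mem_basis)
    then have "matapp (d i) (n (Suc i)) (\<lambda>s. v (Suc i, s)) r = a * (- v (i, r))"
      by (simp add: eq_neg_iff_add_eq_0 add.commute)
    then show "a dvd matapp (d i) (n (Suc i)) (\<lambda>s. v (Suc i, s)) r" by simp
  qed
  then obtain y where y: "\<And>r. r < n (Suc i) \<Longrightarrow>
      a dvd v (Suc i, r) - matapp (d (Suc i)) (n (Suc (Suc i))) y r"
    unfolding exact mem_ideal_iff by blast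
  then obtain z where z: "\<And>r. r < n (Suc i) \<Longrightarrow>
      v (Suc i, r) - matapp (d (Suc i)) (n (Suc (Suc i))) y r = a * z r"
    unfolding dvd_def by metis
  \<comment> \<open>\<open>y\<close> sits over \<open>F (Suc (Suc i))\<close> at index 0, while
    \<open>z\<close> sits over \<open>F (Suc i)\<close> at index 1, from where the diagonal entry
    \<open>a\<close> produces the missing multiple.\<close>
  define w where "w p = (if fst p = Suc (Suc i) then y (snd p) else if fst p = Suc i then z (snd p) else 0)" for p
  have top: "v p - D (Suc i) w p = 0" if p: "p \<in> basis (Suc i)" "Suc i \<le> fst p" for p
  proof -
    obtain r where r: "p = (Suc i, r)" "r < n (Suc i)"
      using p by (cases p) (auto simp: mem_basis dest: le_antisym)
    show ?thesis unfolding r(1) D_bottom_row[OF r(2)] using z[OF r(2)] by (simp add: w_def algebra_simps)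
  qed
  have "D i (\<lambda>p. v p - D (Suc i) w p) p = 0" if "p \<in> basis i" for p
    unfolding D_diff using v[OF that] D_D[OF that] by simp
  then obtain w' where w': "\<forall>p\<in>basis (Suc i). v p - D (Suc i) w p = D (Suc i) w' p"
    using D_exact_filtered[of "Suc i" i "\<lambda>p. v p - D (Suc i) w p"] top by auto
  have "v p = D (Suc i) (\<lambda>p. w p + w' p) p" if "p \<in> basis (Suc i)" for p
    using w' that unfolding D_add by (simp add: algebra_simps)
  then show ?thesis by blast
qed

end

section \<open>Numbering the bases and counting degrees\<close>

context exact_pair_resolution
begin

definition rank :: "nat \<Rightarrow> nat" where "rank i = card (basis i)"

definition enum :: "nat \<Rightarrow> nat \<Rightarrow> nat \<times> nat" where
  "enum i = (SOME e. bij_betw e {..<rank i} (basis i))"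

definition idx :: "nat \<Rightarrow> nat \<times> nat \<Rightarrow> nat" where
  "idx i = the_inv_into {..<rank i} (enum i)"

lemma bij_enum: "bij_betw (enum i) {..<rank i} (basis i)"
proof -
  have "\<exists>e. bij_betw e {..<rank i} (basis i)"
    using ex_bij_betw_nat_finite[OF finite_basis, of i] unfolding rank_def atLeast0LessThan .
  then show ?thesis unfolding enum_def by (rule someI_ex)
qed

lemma idx_enum: "k < rank i \<Longrightarrow> idx i (enum i k) = k"
  unfolding idx_def using bij_enum[of i] by (intro the_inv_into_f_f) (auto simp: bij_betw_def)

lemma enum_idx: "p \<in> basis i \<Longrightarrow> enum i (idx i p) = p"
  unfolding idx_def using bij_enum[of i] by (intro f_the_inv_into_f) (auto simp: bij_betw_def)

lemma enum_image: "enum i ` {..<rank i} = basis i"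
  using bij_enum[of i] by (rule bij_betw_imp_surj_on)

lemma enum_mem: "k < rank i \<Longrightarrow> enum i k \<in> basis i"
  using enum_image by blast

lemma all_enum: "(\<forall>k<rank i. P (enum i k)) \<longleftrightarrow> (\<forall>p\<in>basis i. P p)"
  unfolding enum_image[of i, symmetric] by auto

definition total_deg :: "nat \<Rightarrow> nat \<Rightarrow> int" where
  "total_deg i k = \<delta> (enum i k) + int i"

definition total_d :: "nat \<Rightarrow> nat \<Rightarrow> nat \<Rightarrow> 'r" where
  "total_d i k k' = T (i - fst (enum i k)) (enum i k) (enum (Suc i) k')"

definition total_gen :: "nat \<Rightarrow> 'm" where
  "total_gen k = gen (snd (enum 0 k))"

lemma matapp_total_d:
  "matapp (total_d i) (rank (Suc i)) y k = D i (\<lambda>p. y (idx (Suc i) p)) (enum i k)"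
proof -
  have "D i (\<lambda>p. y (idx (Suc i) p)) (enum i k) = (\<Sum>k'<rank (Suc i). total_d i k k' * y (idx (Suc i) (enum (Suc i) k')))"
    unfolding D_def total_d_def
    using sum.reindex_bij_betw[OF bij_enum, of "\<lambda>p. T (i - fst (enum i k)) (enum i k) p * y (idx (Suc i) p)" "Suc i"]
    by simp
  then show ?thesis unfolding matapp_def by (simp add: idx_enum)
qed

text \<open>Translates between vectors indexed by pairs and the supported vectors indexed by numbers
  that the definition of a resolution demands.\<close>

lemma boundary_iff:
  "(\<exists>w. \<forall>p\<in>basis i. x (idx i p) = D i w p) \<longleftrightarrow>
   (\<exists>y. vsupp (rank (Suc i)) y \<and> (\<forall>k<rank i. x k - matapp (total_d i) (rank (Suc i)) y k \<in> {0}))"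
proof
  assume "\<exists>w. \<forall>p\<in>basis i. x (idx i p) = D i w p"
  then obtain w where "\<forall>p\<in>basis i. x (idx i p) = D i w p" by blast
  then have w: "x k = D i w (enum i k)" if "k < rank i" for k
    using enum_mem[OF that] idx_enum[OF that] by metis
  define y where "y k = (if k < rank (Suc i) then w (enum (Suc i) k) else 0)" for k
  have "y (idx (Suc i) p) = w p" if p: "p \<in> basis (Suc i)" for p
  proof -
    obtain k where "k < rank (Suc i)" "p = enum (Suc i) k"
      using enum_image[of "Suc i"] p by blast
    then show ?thesis unfolding y_def by (simp add: idx_enum)
  qed
  then have "matapp (total_d i) (rank (Suc i)) y k = D i w (enum i k)" for k
    unfolding matapp_total_d by (rule D_cong)
  then show "\<exists>y. vsupp (rank (Suc i)) y \<and> (\<forall>k<rank i. x k - matapp (total_d i) (rank (Suc i)) y k \<in> {0})"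
    using w by (intro exI[of _ y]) (simp add: vsupp_def y_def)
next
  assume "\<exists>y. vsupp (rank (Suc i)) y \<and> (\<forall>k<rank i. x k - matapp (total_d i) (rank (Suc i)) y k \<in> {0})"
  then obtain y where "\<forall>k<rank i. x (idx i (enum i k)) = D i (\<lambda>p. y (idx (Suc i) p)) (enum i k)"
    unfolding matapp_total_d using idx_enum by auto
  then show "\<exists>w. \<forall>p\<in>basis i. x (idx i p) = D i w p"
    unfolding all_enum[of i "\<lambda>p. x (idx i p) = D i (\<lambda>p. y (idx (Suc i) p)) p"] by blast
qed

lemma basis_0: "basis 0 = Pair 0 ` {..<n 0}"
  by (auto simp: basis_def)

lemma sum_total_gen: "(\<Sum>k<rank 0. act (x k) (total_gen k)) = (\<Sum>c<n 0. act (x (idx 0 (0, c))) (gen c))"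
proof -
  have "(\<Sum>k<rank 0. act (x k) (total_gen k)) = (\<Sum>k<rank 0. act (x (idx 0 (enum 0 k))) (gen (snd (enum 0 k))))"
    by (simp add: idx_enum total_gen_def)
  also have "\<dots> = (\<Sum>p\<in>basis 0. act (x (idx 0 p)) (gen (snd p)))"
    by (rule sum.reindex_bij_betw[OF bij_enum, of "\<lambda>p. act (x (idx 0 p)) (gen (snd p))"])
  also have "\<dots> = (\<Sum>c<n 0. act (x (idx 0 (0, c))) (gen c))"
    unfolding basis_0 by (subst sum.reindex) (auto simp: inj_on_def)
  finally show ?thesis .
qed

text \<open>In total degree 0 every row has index 0, so the multiples of \<open>a\<close> by which
  exactness of \<open>F\<close> falls short are supplied by the basis elements over
  \<open>F 0\<close> at index 1.\<close>

lemma augmentation_exact: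
  "(\<Sum>c<n 0. act (v (0, c)) (gen c)) = 0 \<longleftrightarrow> (\<exists>w. \<forall>p\<in>basis 0. v p = D 0 w p)"
proof -
  have "(\<Sum>c<n 0. act (v (0, c)) (gen c)) = 0 \<longleftrightarrow> cycle 0 (\<lambda>c. v (0, c))"
    unfolding cycle_0 ..
  also have "\<dots> \<longleftrightarrow> (\<exists>y. \<forall>r<n 0. a dvd v (0, r) - matapp (d 0) (n (Suc 0)) y r)"
    unfolding exact mem_ideal_iff ..
  also have "\<dots> \<longleftrightarrow> (\<exists>w. \<forall>p\<in>basis 0. v p = D 0 w p)"
  proof
    assume "\<exists>y. \<forall>r<n 0. a dvd v (0, r) - matapp (d 0) (n (Suc 0)) y r"
    then obtain y z where yz: "\<And>r. r < n 0 \<Longrightarrow> v (0, r) - matapp (d 0) (n (Suc 0)) y r = a * z r"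
      unfolding dvd_def by metis
    define w where "w p = (if fst p = 0 then z (snd p) else y (snd p))" for p :: "nat \<times> nat"
    have "v (0, r) = D 0 w (0, r)" if "r < n 0" for r
      unfolding D_bottom_row[OF that] using yz[OF that] by (simp add: w_def algebra_simps)
    then show "\<exists>w. \<forall>p\<in>basis 0. v p = D 0 w p" unfolding basis_0 by blast
  next
    assume "\<exists>w. \<forall>p\<in>basis 0. v p = D 0 w p"
    then obtain w where w: "\<And>r. r < n 0 \<Longrightarrow> v (0, r) = D 0 w (0, r)" unfolding basis_0 by blast
    have "a dvd v (0, r) - matapp (d 0) (n (Suc 0)) (\<lambda>s. w (Suc 0, s)) r" if "r < n 0" for r
      unfolding w[OF that] D_bottom_row[OF that] by simp
    then show "\<exists>y. \<forall>r<n 0. a dvd v (0, r) - matapp (d 0) (n (Suc 0)) y r" by blast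
  qed
  finally show ?thesis .
qed

text \<open>\<open>T_irr\<close> yields homogeneity and minimality of the entries together;
  exactness is \<open>augmentation_exact\<close> at the start, and \<open>D_exact\<close> with
  \<open>D_D\<close> afterwards.\<close>

theorem total_resolution:
  "minimal_graded_free_resolution Rg {0} act Mg rank total_deg total_d total_gen"
  unfolding minimal_graded_free_resolution_def
proof (intro conjI allI impI)
  fix k assume "k < rank 0"
  then have "enum 0 k \<in> basis 0" by (rule enum_mem)
  then show "total_gen k \<in> Mg (total_deg 0 k)"
    unfolding total_gen_def total_deg_def \<delta>_def basis_0 using gen_mem by auto
next
  fix m
  obtain x where "m = (\<Sum>c<n 0. act (x c) (gen c))" using surjective by blast
  moreover have "(\<Sum>k<rank 0. act (x (snd (enum 0 k))) (total_gen k)) = (\<Sum>c<n 0. act (x c) (gen c))"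
    unfolding sum_total_gen by (simp add: enum_idx basis_0)
  ultimately show "\<exists>x. m = (\<Sum>k<rank 0. act (x k) (total_gen k))" by metis
next
  fix i k k' assume "k < rank i \<and> k' < rank (Suc i)"
  then have "enum i k \<in> basis i" "enum (Suc i) k' \<in> basis (Suc i)" using enum_mem by blast+
  then have "irr (\<delta> (enum (Suc i) k') - \<delta> (enum i k) + 1) (total_d i k k')"
    unfolding total_d_def by (intro T_irr) (auto simp: mem_basis)
  moreover have "\<delta> (enum (Suc i) k') - \<delta> (enum i k) + 1 = total_deg (Suc i) k' - total_deg i k"
    unfolding total_deg_def by simp
  ultimately have "irr (total_deg (Suc i) k' - total_deg i k) (total_d i k k')" by simp
  then show "total_d i k k' \<in> Rz Rg (total_deg (Suc i) k' - total_deg i k)"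
    "total_d i k k' \<in> irrelevant_ideal Rg"
    using irr_0 unfolding irrelevant_ideal_iff by (auto simp: irr_def)
next
  fix x :: "nat \<Rightarrow> 'r"
  show "(\<Sum>k<rank 0. act (x k) (total_gen k)) = 0 \<longleftrightarrow>
      (\<exists>y. vsupp (rank 1) y \<and> (\<forall>k<rank 0. x k - matapp (total_d 0) (rank 1) y k \<in> {0}))"
    unfolding sum_total_gen augmentation_exact[of "\<lambda>p. x (idx 0 p)"] boundary_iff One_nat_def ..
next
  fix i and x :: "nat \<Rightarrow> 'r"
  let ?v = "\<lambda>p. x (idx (Suc i) p)"
  have "(\<forall>k<rank i. matapp (total_d i) (rank (Suc i)) x k \<in> {0}) \<longleftrightarrow> (\<forall>p\<in>basis i. D i ?v p = 0)"
    unfolding matapp_total_d singleton_iff by (rule all_enum)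
  also have "\<dots> \<longleftrightarrow> (\<exists>w. \<forall>p\<in>basis (Suc i). ?v p = D (Suc i) w p)"
  proof
    assume "\<forall>p\<in>basis i. D i ?v p = 0"
    then show "\<exists>w. \<forall>p\<in>basis (Suc i). ?v p = D (Suc i) w p" by (intro D_exact) blast
  next
    assume "\<exists>w. \<forall>p\<in>basis (Suc i). ?v p = D (Suc i) w p"
    then obtain w where "\<And>p. p \<in> basis (Suc i) \<Longrightarrow> ?v p = D (Suc i) w p" by blast
    then have "D i ?v p = D i (D (Suc i) w) p" for p by (rule D_cong)
    then show "\<forall>p\<in>basis i. D i ?v p = 0" using D_D by simp
  qed
  finally show "(\<forall>k<rank i. matapp (total_d i) (rank (Suc i)) x k \<in> {0}) \<longleftrightarrow>
      (\<exists>y. vsupp (rank (Suc (Suc i))) y \<and>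
        (\<forall>k<rank (Suc i). x k - matapp (total_d (Suc i)) (rank (Suc (Suc i))) y k \<in> {0}))"
    unfolding boundary_iff .
qed

lemma total_rank:
  "card {k. k < rank i \<and> total_deg i k = j} = (\<Sum>l\<le>i. card {c. c < n (i - l) \<and> deg (i - l) c = j - int l})"
proof -
  have img: "enum i ` {k. k < rank i \<and> total_deg i k = j} = {p \<in> basis i. \<delta> p + int i = j}"
    unfolding enum_image[of i, symmetric] total_deg_def by auto
  have inj: "inj_on (enum i) {k. k < rank i \<and> total_deg i k = j}"
    using bij_enum[of i] unfolding bij_betw_def by (auto intro: inj_on_subset)
  have "card {k. k < rank i \<and> total_deg i k = j} = card {p \<in> basis i. \<delta> p + int i = j}"
    using card_image[OF inj] unfolding img by (rule sym)
  also have "{p \<in> basis i. \<delta> p + int i = j} = (SIGMA q:{..i}. {c. c < n q \<and> deg q c = j - int (i - q)})"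
    by (auto simp: basis_def \<delta>_def of_nat_diff)
  also have "card \<dots> = (\<Sum>q\<le>i. card {c. c < n q \<and> deg q c = j - int (i - q)})"
    by (rule card_SigmaI) auto
  also have "\<dots> = (\<Sum>l\<le>i. card {c. c < n (i - l) \<and> deg (i - l) c = j - int l})"
    by (rule sum.reindex_bij_witness[of _ "\<lambda>l. i - l" "\<lambda>q. i - q"]) auto
  finally show ?thesis .
qed

end

text \<open>As \<open>1/(1 - st)\<close> is the sum of all \<open>s^l t^l\<close>, the identity of
  series is read off coefficientwise; the sum stops at \<open>l = i\<close> because there are no
  negative homological degrees. An \<open>R/aR\<close>-module is encoded as an
  \<open>R\<close>-module on which \<open>a\<close> acts as zero.\<close>

theorem theorem1p10:
  fixes emb :: "'k::field \<Rightarrow> 'r::comm_ring_1"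
    and Rg :: "nat \<Rightarrow> 'r set"
    and a b :: 'r
    and act :: "'r \<Rightarrow> 'm::ab_group_add \<Rightarrow> 'm"
    and Mg :: "int \<Rightarrow> 'm set"
  assumes R: "standard_graded_algebra emb Rg"
    and a1: "a \<in> Rg 1" and b1: "b \<in> Rg 1"
    and ab: "exact_zero_divisor_pair a b"
    and M: "graded_module emb Rg act Mg"
    and fg: "finitely_generated_module act"
    and pos: "positively_graded Mg"
    and killed: "\<forall>m. act a m = 0"
  shows "\<forall>i j. poincare_coeff Rg {0} act Mg i j =
              (\<Sum>l\<le>i. poincare_coeff Rg (range (\<lambda>r. a * r)) act Mg (i - l) (j - int l))"
proof (intro allI)
  fix i j
  interpret graded_algebra emb Rg by standard (rule R)
  let ?I = "range (\<lambda>r. a * r)"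
  have a: "a \<in> Rz Rg 1" using Rg_Rz[OF a1] by simp
  have I: "graded_ideal ?I"
    unfolding graded_ideal_def
  proof (intro conjI ballI allI)
    show "ring.subspace ?I"
    proof (rule ring.subspaceI)
      show "0 \<in> ?I" by (rule range_eqI[of _ _ 0]) simp
      show "x + y \<in> ?I" if "x \<in> ?I" "y \<in> ?I" for x y
        using that by (auto simp: distrib_left[symmetric])
      show "c * x \<in> ?I" if "x \<in> ?I" for c x
        using that by (auto simp: mult.left_commute)
    qed
    show "\<rho> k x \<in> ?I" if "x \<in> ?I" for x k
      using that by (auto simp: \<rho>_mult[OF a])
  qed
  have I_irr: "\<rho> 0 x = 0" if "x \<in> ?I" for x
    using that by (auto simp: \<rho>_mult[OF a] \<rho>_neg)
  have killed': "act r m = 0" if "r \<in> ?I" for r m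
    using that killed by (auto simp flip: module.scale_scale[OF gm_module[OF M]])
  obtain n deg d gen where res: "minimal_graded_free_resolution Rg ?I act Mg n deg d gen"
    using minimal_resolution_exists[OF M fg I killed'] by blast
  interpret S: exact_pair_resolution emb Rg a act Mg n deg d gen b
    using M I I_irr res a1 b1 ab by unfold_locales
  interpret tot: resolution emb Rg "{0}" act Mg S.rank S.total_deg S.total_d S.total_gen
    using M S.total_resolution by unfold_locales (auto simp: graded_ideal_def)
  show "poincare_coeff Rg {0} act Mg i j =
      (\<Sum>l\<le>i. poincare_coeff Rg ?I act Mg (i - l) (j - int l))"
    unfolding poincare_coeff_def tot.graded_betti_eq S.graded_betti_eq S.total_rank by simp
qed

end
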